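(* Fix $p\geq2$, $s>0$, and positive numbers $\alpha_1,\ldots,\alpha_p$ with $\sum_i\alpha_i=1$. Let $\lambda_i=\alpha_iN+\delta_i$ be nonnegative integers, where $\delta_i=O(1)$ and $\sum_i\delta_i=0$. Assume that the system $$\sum_{i=1}^pe^{-r_i}=p-1,\qquad \frac{\alpha_1}{r_1e^{-r_1}}=\cdots=\frac{\alpha_p}{r_pe^{-r_p}}$$ has a positive solution $r=(r_1,\ldots,r_p)$, and fix this solution. Put $$h(y_1,\ldots,y_{p-1})=-\log\!\left((p-1)-\sum_{i=1}^{p-1}e^{-y_i}\right),$$ $$\Phi(y_1,\ldots,y_{p-1})=-\sum_{i=1}^{p-1}\alpha_i\log y_i-\alpha_p\log h(y_1,\ldots,y_{p-1}),$$ and let $\mathcal H$ be the Hessian matrix of $\Phi$ at $(r_1,\ldots,r_{p-1})$. Assume further that the smooth critical point $r$ is strictly minimal for the direction $\alpha$ and is nondegenerate, i.e. the reduced Hessian $\mathcal H$ is nonsingular (in the positive real case considered here, $\mathcal H$ is positive definite). Then, as $N\to\infty$, $$(-1)^N\chi_{K_{\lambda_1,\ldots,\lambda_p}}(-s)\sim\left(\prod_{i=1}^p\lambda_i!\right)\left(\prod_{i=1}^pr_i^{-\delta_i}\right)\frac{\lambda_p^{s-1}}{\Gamma(s)}\,\frac{e^{sr_p}}{r_p^s\prod_{i=1}^{p-1}r_i}\,\frac{\exp(N\Phi(r_1,\ldots,r_{p-1}))}{(2\pi N)^{(p-1)/2}\sqrt{\det\mathcal H}}.$$ For connected graphs the left-hand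 side equals $s\,T_{K_{\lambda_1,\ldots,\lambda_p}}(1+s,0)$.
   Context: $K_{\lambda_1,\ldots,\lambda_p}$ is the complete multipartite graph with part sizes $\lambda_i$; $\chi_G$ and $T_G(x,y)$ are the chromatic and Tutte polynomials. Strictly minimal (in the sense of the smooth-point transfer theorem of analytic combinatorics in several variables) means that $r$ is the only zero of $F(y)=\sum_{i=1}^pe^{-y_i}-(p-1)$ in the closed polydisc $\{y\in\mathbb C^p:|y_i|\le r_i\ \forall i\}$. $a_N\sim b_N$ means $a_N/b_N\to1$. *)

theory Defs
  imports
    "HOL-Analysis.Analysis"
    "HOL-Library.Landau_Symbols"
    "HOL-Computational_Algebra.Polynomial"
begin

text \<open>
  A simple graph is given by a vertex set \<open>V\<close> and a set \<open>E\<close> of two-element subsets of \<open>V\<close>.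
\<close>

definition reach :: "'v set \<Rightarrow> 'v set set \<Rightarrow> ('v \<times> 'v) set" where
  "reach V E = {(u, v). {u, v} \<in> E}\<^sup>* \<inter> V \<times> V"

definition num_components :: "'v set \<Rightarrow> 'v set set \<Rightarrow> nat" where
  "num_components V E = card (V // reach V E)"

definition connected_graph :: "'v set \<Rightarrow> 'v set set \<Rightarrow> bool" where
  "connected_graph V E \<longleftrightarrow> V \<noteq> {} \<and> V \<times> V \<subseteq> reach V E"

definition proper_colorings :: "'v set \<Rightarrow> 'v set set \<Rightarrow> nat \<Rightarrow> ('v \<Rightarrow> nat) set" where
  "proper_colorings V E k = {c \<in> V \<rightarrow>\<^sub>E {..<k}. \<forall>u v. {u, v} \<in> E \<longrightarrow> c u \<noteq> c v}"

definition chromatic_poly :: "'v set \<Rightarrow> 'v set set \<Rightarrow> real poly" where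
  "chromatic_poly V E =
     (THE P. \<forall>k::nat. poly P (real k) = real (card (proper_colorings V E k)))"

definition graph_rank :: "'v set \<Rightarrow> 'v set set \<Rightarrow> nat" where
  "graph_rank V A = card V - num_components V A"

text \<open>
  The rank-generating expansion of the Tutte polynomial. For finite \<open>V\<close> and \<open>A \<subseteq> E\<close> no
  subtraction of natural numbers is truncated.
\<close>

definition tutte :: "'v set \<Rightarrow> 'v set set \<Rightarrow> real \<Rightarrow> real \<Rightarrow> real" where
  "tutte V E x y =
     (\<Sum>A\<in>Pow E. (x - 1) ^ (graph_rank V E - graph_rank V A) * (y - 1) ^ (card A - graph_rank V A))"

definition multipartite_verts :: "('i \<Rightarrow> nat) \<Rightarrow> ('i \<times> nat) set" where
  "multipartite_verts l = (SIGMA i:UNIV. {..<l i})"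

definition multipartite_edges :: "('i \<Rightarrow> nat) \<Rightarrow> ('i \<times> nat) set set" where
  "multipartite_edges l =
     {{u, v} | u v. u \<in> multipartite_verts l \<and> v \<in> multipartite_verts l \<and> fst u \<noteq> fst v}"

text \<open>
  The indices \<open>1, \<dots>, p\<close> are the elements of \<open>'m option\<close>: the index \<open>p\<close> is \<open>None\<close>, and
  \<open>1, \<dots>, p - 1\<close> are the \<open>Some i\<close>. Thus \<open>p - 1 = CARD('m)\<close>, and as \<open>'m\<close> ranges over all finite
  types (which are nonempty), \<open>p\<close> ranges over all integers \<open>p \<ge> 2\<close>.
\<close>

definition F_fun :: "complex ^ ('m::finite option) \<Rightarrow> complex" where
  "F_fun y = (\<Sum>i\<in>UNIV. exp (- (y $ i))) - of_nat CARD('m)"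

definition strictly_minimal :: "real ^ ('m::finite option) \<Rightarrow> bool" where
  "strictly_minimal r \<longleftrightarrow>
     {y. (\<forall>i. cmod (y $ i) \<le> r $ i) \<and> F_fun y = 0} = {\<chi> i. complex_of_real (r $ i)}"

definition drop_last :: "real ^ ('m::finite option) \<Rightarrow> real ^ 'm" where
  "drop_last r = (\<chi> i. r $ Some i)"

definition h_fun :: "real ^ ('m::finite) \<Rightarrow> real" where
  "h_fun y = - ln (real CARD('m) - (\<Sum>i\<in>UNIV. exp (- (y $ i))))"

definition Phi :: "real ^ ('m::finite option) \<Rightarrow> real ^ 'm \<Rightarrow> real" where
  "Phi \<alpha> y = - (\<Sum>i\<in>UNIV. \<alpha> $ Some i * ln (y $ i)) - \<alpha> $ None * ln (h_fun y)"

definition partial_deriv :: "'m::finite \<Rightarrow> (real ^ 'm \<Rightarrow> real) \<Rightarrow> real ^ 'm \<Rightarrow> real" where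
  "partial_deriv i f x = deriv (\<lambda>t. f (x + t *\<^sub>R axis i 1)) 0"

definition hessian :: "(real ^ 'm \<Rightarrow> real) \<Rightarrow> real ^ ('m::finite) \<Rightarrow> real ^ 'm ^ 'm" where
  "hessian f x = (\<chi> i j. partial_deriv i (partial_deriv j f) x)"

definition positive_definite :: "real ^ 'm ^ ('m::finite) \<Rightarrow> bool" where
  "positive_definite A \<longleftrightarrow> transpose A = A \<and> (\<forall>v. v \<noteq> 0 \<longrightarrow> 0 < v \<bullet> (A *v v))"

end

theory Submission
  imports Defs "HOL-Complex_Analysis.Complex_Analysis" "HOL-Probability.Probability"
    "HOL-Real_Asymp.Real_Asymp"
begin

text \<open>
  Up to the factor \<open>\<Prod>\<lambda>\<^sub>i!\<close>, the number \<open>(-1)\<^sup>N \<chi>(-s)\<close> is the coefficient of \<open>y\<^sup>\<lambda>\<close> in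
  \<open>F(y)\<^bsup>-s\<^esup>\<close> with \<open>F(y) = \<Sum> e\<^bsup>-y\<^sub>i\<^esup> - (p - 1)\<close>. It is extracted by Fourier inversion over the torus in the
  first \<open>p - 1\<close> variables. For fixed values of these, \<open>F\<close> vanishes in the last variable at \<open>h\<close>, a
  branch point of order \<open>s\<close>, and one-variable singularity analysis, uniform near the positive point,
  gives the coefficient as \<open>n\<^bsup>s-1\<^esup> h\<^bsup>-n\<^esup>\<close> times a constant. Strict minimality gives \<open>|h| \<ge> r\<^sub>p\<close> near
  the positive point, hence a positive semidefinite and by nondegeneracy positive definite Hessian,
  and exponentially smaller coefficients away from that point, so that Laplace's method applies.
\<close>

unbundle no Formal_Power_Series.fps_syntax

section \<open>Colorings of complete multipartite graphs\<close>

text \<open>With c(w) = p - 1 - (sum of e^(-w_j) over the first p - 1 variables), F = e^(-z) - c(w),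
  and the binomial series gives F^(-s) = sum over k of (s)_k/k! e^((s+k)z) c(w)^k. Up to signs this
  is the expansion of the chromatic polynomial at -s by the number k of colours met on the first p -
  1 parts, since c^k generates the colourings of these parts onto k colours. For real s the power
  needs a branch, and on the torus of radii r_j the series in powers of c need not converge. A
  scaling variable \<zeta> is therefore inserted: along w -> \<zeta> w a zero-free disc is simply
  connected and carries a unique branch with value e^(sz) at \<zeta> = 0, its coefficient of
  \<zeta>^M is a finite sum, and the torus integral sees only M = sum of the exponents, so summing
  over all M changes nothing. The constant e^(s r_p) r_p^(-s) / Gamma(s) comes from the branch
  point, and the product of the r_i in the denominator from the change between angles and the
  coordinates of \<Phi>.\<close>

definition onto_colorings :: "('i \<Rightarrow> nat) \<Rightarrow> nat set \<Rightarrow> ('i \<times> nat \<Rightarrow> nat) set" where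
  "onto_colorings l S = {c \<in> multipartite_verts l \<rightarrow>\<^sub>E S. c ` multipartite_verts l = S \<and>
     (\<forall>u\<in>multipartite_verts l. \<forall>v\<in>multipartite_verts l. fst u \<noteq> fst v \<longrightarrow> c u \<noteq> c v)}"

lemma finite_multipartite_verts: "finite (multipartite_verts (l :: 'i::finite \<Rightarrow> nat))"
  by (simp add: multipartite_verts_def)

lemma card_multipartite_verts: "card (multipartite_verts (l :: 'i::finite \<Rightarrow> nat)) = (\<Sum>i\<in>UNIV. l i)"
  by (simp add: multipartite_verts_def)

lemma proper_colorings_multipartite:
  "proper_colorings (multipartite_verts l) (multipartite_edges l) k =
     {c \<in> multipartite_verts l \<rightarrow>\<^sub>E {..<k}.
       \<forall>u\<in>multipartite_verts l. \<forall>v\<in>multipartite_verts l. fst u \<noteq> fst v \<longrightarrow> c u \<noteq> c v}"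
proof -
  have "(\<forall>u v. {u, v} \<in> multipartite_edges l \<longrightarrow> c u \<noteq> c v) \<longleftrightarrow>
    (\<forall>u\<in>multipartite_verts l. \<forall>v\<in>multipartite_verts l. fst u \<noteq> fst v \<longrightarrow> c u \<noteq> c v)" for c :: "'a \<times> nat \<Rightarrow> nat"
    unfolding multipartite_edges_def mem_Collect_eq doubleton_eq_iff by metis
  then show ?thesis by (simp add: proper_colorings_def)
qed

lemma finite_onto_colorings:
  "finite S \<Longrightarrow> finite (onto_colorings (l :: 'i::finite \<Rightarrow> nat) S)"
  unfolding onto_colorings_def
  by (rule finite_subset[of _ "multipartite_verts l \<rightarrow>\<^sub>E S"]) (auto intro!: finite_PiE finite_multipartite_verts)

lemma card_onto_colorings_le:
  fixes l :: "'i::finite \<Rightarrow> nat"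
  assumes bij: "bij_betw g S T" and "finite S"
  shows "card (onto_colorings l S) \<le> card (onto_colorings l T)"
proof (rule card_inj_on_le)
  let ?V = "multipartite_verts l"
  let ?f = "\<lambda>c. \<lambda>v\<in>?V. g (c v)"
  have inj: "inj_on g S" and img: "g ` S = T" using bij by (auto simp: bij_betw_def)
  show "inj_on ?f (onto_colorings l S)"
  proof (rule inj_onI)
    fix c d assume c: "c \<in> onto_colorings l S" and d: "d \<in> onto_colorings l S" and eq: "?f c = ?f d"
    show "c = d"
    proof (rule PiE_ext[of _ ?V "\<lambda>_. S"])
      show "c \<in> ?V \<rightarrow>\<^sub>E S" "d \<in> ?V \<rightarrow>\<^sub>E S" using c d by (auto simp: onto_colorings_def)
      fix v assume v: "v \<in> ?V"
      have "?f c v = ?f d v" using eq by simp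
      then have "g (c v) = g (d v)" using v by simp
      moreover have "c v \<in> S" "d v \<in> S" using c d v unfolding onto_colorings_def by blast+
      ultimately show "c v = d v" using inj by (auto dest: inj_onD)
    qed
  qed
  show "?f ` onto_colorings l S \<subseteq> onto_colorings l T"
  proof
    fix d assume "d \<in> ?f ` onto_colorings l S"
    then obtain c where c: "c \<in> onto_colorings l S" and d: "d = ?f c" by auto
    have cS: "\<And>v. v \<in> ?V \<Longrightarrow> c v \<in> S" using c by (auto simp: onto_colorings_def)
    have "d ` ?V = g ` (c ` ?V)" using d by (auto simp: image_iff)
    also have "\<dots> = T" using c img by (simp add: onto_colorings_def)
    finally have 1: "d ` ?V = T" .
    have 2: "d u \<noteq> d v" if "u \<in> ?V" "v \<in> ?V" "fst u \<noteq> fst v" for u v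
    proof -
      have "c u \<noteq> c v" using c that by (auto simp: onto_colorings_def)
      moreover have "c u \<in> S" "c v \<in> S" using cS that by blast+
      ultimately show ?thesis using d that inj by (auto dest: inj_onD)
    qed
    have 3: "d \<in> ?V \<rightarrow>\<^sub>E T" using d 1 by auto
    show "d \<in> onto_colorings l T"
      unfolding onto_colorings_def using 1 2 3 by blast
  qed
  show "finite (onto_colorings l T)"
    using img \<open>finite S\<close> by (intro finite_onto_colorings) auto
qed

lemma card_onto_colorings_cong:
  fixes l :: "'i::finite \<Rightarrow> nat"
  assumes "finite S" "finite T" "card S = card T"
  shows "card (onto_colorings l S) = card (onto_colorings l T)"
proof -
  obtain g where "bij_betw g S T" using finite_same_card_bij[OF assms] by blast
  then show ?thesis
    using assms(1,2) by (meson bij_betw_inv_into card_onto_colorings_le le_antisym)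
qed

lemma onto_colorings_empty_if_too_many:
  fixes l :: "'i::finite \<Rightarrow> nat"
  assumes "card S > (\<Sum>i\<in>UNIV. l i)"
  shows "onto_colorings l S = {}"
proof -
  have "card S \<le> (\<Sum>i\<in>UNIV. l i)" if "c ` multipartite_verts l = S" for c
    using card_image_le[OF finite_multipartite_verts[of l], of c] that
    by (simp add: card_multipartite_verts)
  then show ?thesis using assms by (fastforce simp: onto_colorings_def)
qed

text \<open>Let S be the set of colours met on the first p - 1 parts. A vertex of the last part is
  adjacent to every vertex of these parts and to none of its own, so it takes any colour outside S,
  independently of the others.\<close>

lemma card_proper_colorings_split:
  fixes l :: "'m::finite option \<Rightarrow> nat"
  shows "card (proper_colorings (multipartite_verts l) (multipartite_edges l) q) =
    (\<Sum>S\<in>Pow {..<q}. card (onto_colorings (\<lambda>j. l (Some j)) S) * (q - card S) ^ l None)"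
proof -
  let ?V = "multipartite_verts l" and ?W = "multipartite_verts (\<lambda>j. l (Some j))"
  let ?P = "proper_colorings (multipartite_verts l) (multipartite_edges l) q"
  let ?B = "SIGMA S:Pow {..<q}. onto_colorings (\<lambda>j. l (Some j)) S \<times> ({..<l None} \<rightarrow>\<^sub>E ({..<q} - S))"
  \<comment> \<open>S is recorded as the image of the restricted colouring; this makes the target a
    disjoint union over S and the count a sum over S.\<close>
  define enc where "enc = (\<lambda>c::'m option \<times> nat \<Rightarrow> nat. 
     let c' = (\<lambda>v\<in>?W. c (Some (fst v), snd v)) in (c' ` ?W, c', \<lambda>t\<in>{..<l None}. c (None, t)))"
  define dec where "dec = (\<lambda>(S::nat set, c'::'m \<times> nat \<Rightarrow> nat, d::nat \<Rightarrow> nat). \<lambda>v\<in>?V. 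
     case fst v of None \<Rightarrow> d (snd v) | Some j \<Rightarrow> c' (j, snd v))"
  have W: "v \<in> ?W \<longleftrightarrow> (Some (fst v), snd v) \<in> ?V" for v
    by (cases v) (auto simp: multipartite_verts_def)
  have N: "(None, t) \<in> ?V \<longleftrightarrow> t < l None" for t
    by (auto simp: multipartite_verts_def)
  have "bij_betw enc ?P ?B"
  proof (rule bij_betw_byWitness[where f' = dec])
    show "\<forall>c\<in>?P. dec (enc c) = c"
    proof
      fix c assume c: "c \<in> ?P"
      have "dec (enc c) v = c v" for v
      proof (cases "v \<in> ?V")
        case True
        then show ?thesis
          by (cases v; cases "fst v") (auto simp: dec_def enc_def Let_def W N)
      next
        case False
        moreover have "c v = undefined"
          using False c unfolding proper_colorings_multipartite by (blast intro: PiE_arb)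
        ultimately show ?thesis by (simp add: dec_def enc_def Let_def)
      qed
      then show "dec (enc c) = c" by blast
    qed
    show "\<forall>b\<in>?B. enc (dec b) = b"
    proof
      fix b assume b: "b \<in> ?B"
      obtain S c' d where bS: "b = (S, c', d)" by (cases b)
      have c': "c' \<in> onto_colorings (\<lambda>j. l (Some j)) S" and d: "d \<in> {..<l None} \<rightarrow>\<^sub>E ({..<q} - S)"
        using b bS by auto
      have 1: "(\<lambda>v\<in>?W. dec b (Some (fst v), snd v)) = c'"
      proof
        fix v show "(\<lambda>v\<in>?W. dec b (Some (fst v), snd v)) v = c' v"
          using c' PiE_arb[of c' ?W "\<lambda>_. S" v] by (auto simp: bS dec_def W[symmetric] onto_colorings_def)
      qed
      have 2: "(\<lambda>t\<in>{..<l None}. dec b (None, t)) = d"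
      proof
        fix t show "(\<lambda>t\<in>{..<l None}. dec b (None, t)) t = d t"
          using d by (auto simp: bS dec_def N PiE_def extensional_def)
      qed
      show "enc (dec b) = b"
        using c' unfolding enc_def Let_def 1 2 by (simp add: bS onto_colorings_def)
    qed
    show "enc ` ?P \<subseteq> ?B"
    proof
      fix b assume "b \<in> enc ` ?P"
      then obtain c where c: "c \<in> ?P" and b: "b = enc c" by auto
      define c' where "c' = (\<lambda>v\<in>?W. c (Some (fst v), snd v))"
      have cV: "\<And>v. v \<in> ?V \<Longrightarrow> c v < q" and cp: "\<And>u v. u \<in> ?V \<Longrightarrow> v \<in> ?V \<Longrightarrow> fst u \<noteq> fst v \<Longrightarrow> c u \<noteq> c v"
        using c by (auto simp: proper_colorings_multipartite)
      have "c' ` ?W \<subseteq> {..<q}" using cV W by (auto simp: c'_def)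
      moreover have "c' \<in> onto_colorings (\<lambda>j. l (Some j)) (c' ` ?W)"
        using cp W by (auto simp: c'_def onto_colorings_def)
      moreover have "(\<lambda>t\<in>{..<l None}. c (None, t)) \<in> {..<l None} \<rightarrow>\<^sub>E ({..<q} - c' ` ?W)"
      proof (rule PiE_I)
        fix t assume t: "t \<in> {..<l None}"
        then have tV: "(None, t) \<in> ?V" by (simp add: N)
        have "c (None, t) \<noteq> c (Some (fst v), snd v)" if "v \<in> ?W" for v
          using cp[OF tV, of "(Some (fst v), snd v)"] that W by simp
        then show "(\<lambda>t\<in>{..<l None}. c (None, t)) t \<in> {..<q} - c' ` ?W"
          using t cV[OF tV] by (auto simp: c'_def)
      qed auto
      ultimately show "b \<in> ?B"
        unfolding b enc_def Let_def c'_def[symmetric] by simp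
    qed
    show "dec ` ?B \<subseteq> ?P"
    proof
      fix c assume "c \<in> dec ` ?B"
      then obtain S c' d where S: "S \<subseteq> {..<q}" and c': "c' \<in> onto_colorings (\<lambda>j. l (Some j)) S"
        and d: "d \<in> {..<l None} \<rightarrow>\<^sub>E ({..<q} - S)" and c: "c = dec (S, c', d)" by auto
      have c'S: "\<And>v. v \<in> ?W \<Longrightarrow> c' v \<in> S" and c'p: "\<And>u v. u \<in> ?W \<Longrightarrow> v \<in> ?W \<Longrightarrow> fst u \<noteq> fst v \<Longrightarrow> c' u \<noteq> c' v"
        using c' by (auto simp: onto_colorings_def)
      have dS: "d t < q" "d t \<notin> S" if "t < l None" for t using d that by (auto simp: PiE_iff)
      have cN: "c (None, t) = d t" if "t < l None" for t using that by (simp add: c dec_def N)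
      have cS: "c (Some j, t) = c' (j, t)" if "(j, t) \<in> ?W" for j t using that by (simp add: c dec_def W)
      have 1: "c v < q" if "v \<in> ?V" for v
      proof (cases v)
        case (Pair a t)
        then show ?thesis
        proof (cases a)
          case None then show ?thesis using Pair that N cN dS by auto
        next
          case (Some j) then have "(j, t) \<in> ?W" using Pair that W by auto
          then show ?thesis using Pair Some S c'S cS by fastforce
        qed
      qed
      have 2: "c u \<noteq> c v" if "u \<in> ?V" "v \<in> ?V" "fst u \<noteq> fst v" for u v
      proof -
        obtain a t b t' where uv: "u = (a, t)" "v = (b, t')" by (cases u, cases v)
        show ?thesis
        proof (cases a)
          case None
          then have "a \<noteq> b" using that uv by simp
          then obtain j where j: "b = Some j" using None by (cases b) auto
          have "(j, t') \<in> ?W" "t < l None" using that uv None j W N by auto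
          then show ?thesis using uv None j cN cS dS c'S by metis
        next
          case (Some i)
          then have i: "(i, t) \<in> ?W" using that uv W by auto
          show ?thesis
          proof (cases b)
            case None
            then have "t' < l None" using that uv N by auto
            then show ?thesis using uv None Some i cN cS dS c'S by metis
          next
            case b: (Some j)
            then have "(j, t') \<in> ?W" using that uv W by auto
            then have "c' (i, t) \<noteq> c' (j, t')" using i that uv Some b by (intro c'p) auto
            then show ?thesis using uv Some b i \<open>(j, t') \<in> ?W\<close> cS by simp
          qed
        qed
      qed
      have "c \<in> ?V \<rightarrow>\<^sub>E {..<q}" using 1 by (auto simp: c dec_def PiE_iff)
      then show "c \<in> ?P" using 2 by (simp add: proper_colorings_multipartite)
    qed
  qed
  then have "card ?P = card ?B" by (rule bij_betw_same_card)
  also have "\<dots> = (\<Sum>S\<in>Pow {..<q}. card (onto_colorings (\<lambda>j. l (Some j)) S \<times> ({..<l None} \<rightarrow>\<^sub>E ({..<q} - S))))"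
    by (intro card_SigmaI) (auto intro!: finite_cartesian_product finite_onto_colorings finite_PiE intro: finite_subset)
  also have "\<dots> = (\<Sum>S\<in>Pow {..<q}. card (onto_colorings (\<lambda>j. l (Some j)) S) * (q - card S) ^ l None)"
  proof (rule sum.cong[OF refl])
    fix S assume S: "S \<in> Pow {..<q}"
    then have "finite S" by (auto intro: finite_subset)
    then have "card ({..<q} - S) = q - card S" using S by (simp add: card_Diff_subset)
    then show "card (onto_colorings (\<lambda>j. l (Some j)) S \<times> ({..<l None} \<rightarrow>\<^sub>E ({..<q} - S))) =
        card (onto_colorings (\<lambda>j. l (Some j)) S) * (q - card S) ^ l None"
      by (simp add: card_cartesian_product card_funcsetE)
  qed
  finally show ?thesis .
qed

section \<open>Sums of indicators and the chromatic polynomial as a polynomial\<close>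

lemma sum_of_bool:
  assumes "finite A"
  shows "(\<Sum>x\<in>A. of_bool (P x)) = (of_nat (card {x\<in>A. P x}) :: 'a :: comm_semiring_1)"
  using assms by (simp add: of_bool_def sum.If_cases Int_def)

lemma prod_of_bool:
  assumes "finite A"
  shows "(\<Prod>x\<in>A. of_bool (P x)) = (of_bool (\<forall>x\<in>A. P x) :: 'a :: comm_semiring_1)"
  using assms by (induction A) auto

lemma sum_Pow_card:
  assumes "finite A"
  shows "(\<Sum>S\<in>Pow A. f (card S)) = (\<Sum>k\<le>card A. of_nat (card A choose k) * (f k :: 'a :: comm_semiring_1))"
proof -
  have "(\<Sum>S\<in>Pow A. f (card S)) = (\<Sum>k\<le>card A. \<Sum>S\<in>{S\<in>Pow A. card S = k}. f (card S))"
    using assms by (intro sum.group[symmetric]) (auto intro: card_mono)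
  also have "\<dots> = (\<Sum>k\<le>card A. of_nat (card A choose k) * f k)"
  proof (rule sum.cong[OF refl])
    fix k
    have "(\<Sum>S\<in>{S\<in>Pow A. card S = k}. f (card S)) = (\<Sum>S\<in>{S. S \<subseteq> A \<and> card S = k}. f k)"
      by (rule sum.cong) auto
    then show "(\<Sum>S\<in>{S\<in>Pow A. card S = k}. f (card S)) = of_nat (card A choose k) * f k"
      using n_subsets[OF assms, of k] by simp
  qed
  finally show ?thesis .
qed

lemma poly_eq_if_eq_at_nats:
  fixes P Q :: "real poly"
  assumes "\<And>k::nat. poly P (real k) = poly Q (real k)"
  shows "P = Q"
proof (rule ccontr)
  assume "P \<noteq> Q"
  then have "finite {x. poly (P - Q) x = 0}" by (intro poly_roots_finite) simp
  moreover have "range real \<subseteq> {x. poly (P - Q) x = 0}" using assms by auto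
  ultimately have "finite (range real)" by (rule rev_finite_subset)
  then show False using finite_imageD[of real UNIV] by (simp add: inj_on_def)
qed

text \<open>\<open>chromatic_poly\<close> is a definite description. A polynomial is determined by
  its values at the naturals, so any polynomial with the right values is the described one.\<close>

lemma chromatic_poly_eqI:
  assumes "\<And>k::nat. poly P (real k) = real (card (proper_colorings V E k))"
  shows "chromatic_poly V E = P"
  unfolding chromatic_poly_def
  by (rule the_equality) (simp_all add: assms poly_eq_if_eq_at_nats)

text \<open>Only the number k of colours met on the first p - 1 parts matters, which groups the sum
  over S by binomial coefficients. These parts have M vertices, so k \<le> M whatever q is, and the
  right-hand side is a polynomial in q; this is what permits the evaluation at -s.\<close>

lemma poly_chromatic_poly_multipartite:
  fixes l :: "'m::finite option \<Rightarrow> nat"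
  defines "mu \<equiv> \<lambda>j. l (Some j)"
  shows "poly (chromatic_poly (multipartite_verts l) (multipartite_edges l)) x =
    (\<Sum>k\<le>(\<Sum>j\<in>UNIV. mu j). (x gchoose k) * (x - real k) ^ l None * real (card (onto_colorings mu {..<k})))"
proof -
  define M where "M = (\<Sum>j\<in>UNIV. mu j)"
  define b where "b = (\<lambda>k. smult (1 / fact k) (\<Prod>i=0..<k. [:- real i, 1:]))"
  have b: "poly (b k) y = y gchoose k" for k y
    by (simp add: b_def poly_prod gbinomial_prod_rev)
  define P where "P = (\<Sum>k\<le>M. b k * [:- real k, 1:] ^ l None * [:real (card (onto_colorings mu {..<k})):])"
  have P: "poly P y = (\<Sum>k\<le>M. (y gchoose k) * (y - real k) ^ l None * real (card (onto_colorings mu {..<k})))" for y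
    by (simp add: P_def poly_sum b mult_ac)
  have "chromatic_poly (multipartite_verts l) (multipartite_edges l) = P"
  proof (rule chromatic_poly_eqI)
    fix q :: nat
    let ?f = "\<lambda>k. real (card (onto_colorings mu {..<k}) * (q - k) ^ l None)"
    have "real (card (proper_colorings (multipartite_verts l) (multipartite_edges l) q)) = (\<Sum>S\<in>Pow {..<q}. ?f (card S))"
      unfolding card_proper_colorings_split of_nat_sum mu_def[symmetric]
    proof (rule sum.cong[OF refl])
      fix S assume "S \<in> Pow {..<q}"
      then have "card (onto_colorings mu S) = card (onto_colorings mu {..<card S})"
        by (intro card_onto_colorings_cong) (auto intro: finite_subset)
      then show "real (card (onto_colorings mu S) * (q - card S) ^ l None) =
        real (card (onto_colorings mu {..<card S}) * (q - card S) ^ l None)" by simp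
    qed
    also have "\<dots> = (\<Sum>k\<le>q. real (q choose k) * ?f k)"
      by (subst sum_Pow_card) auto
    \<comment> \<open>The ranges k \<le> q and k \<le> M meet in \<open>max q M\<close>: the
      binomial coefficient vanishes for k > q, and no colouring of M vertices is onto k > M
      colours.\<close>
    also have "\<dots> = (\<Sum>k\<le>max q M. real (q choose k) * ?f k)"
      by (rule sum.mono_neutral_left) auto
    also have "\<dots> = (\<Sum>k\<le>M. real (q choose k) * ?f k)"
      by (rule sum.mono_neutral_right) (auto simp: M_def onto_colorings_empty_if_too_many)
    also have "\<dots> = poly P (real q)"
      unfolding P
    proof (rule sum.cong[OF refl])
      fix k
      \<comment> \<open>For k > q the truncated difference q - k and the real one disagree, but the
        binomial coefficient is 0 on both sides.\<close>
      show "real (q choose k) * ?f k = (real q gchoose k) * (real q - real k) ^ l None * real (card (onto_colorings mu {..<k}))"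
        by (cases "k \<le> q") (auto simp: binomial_gbinomial[symmetric] of_nat_diff binomial_eq_0)
    qed
    finally show "poly P (real q) = real (card (proper_colorings (multipartite_verts l) (multipartite_edges l) q))" by simp
  qed
  then show ?thesis using P by (simp add: M_def)
qed

text \<open>Each colour receives a label: \<open>Some j\<close> confines it to part j,
  \<open>None\<close> forbids it. A colour that occurs admits exactly one label if it stays in one
  part, and none otherwise. A colour that does not occur admits all p labels, whose weights 1 (p - 1
  times) and -(p - 1) cancel. Hence the product over the colours is the indicator of a proper onto
  colouring. The expansion is that of the power (sum of (e^(y_j) - 1))^k, with the same index set as
  in \<open>c_fps_power_nth\<close>.\<close>

lemma card_onto_colorings:
  fixes mu :: "'m::finite \<Rightarrow> nat"
  shows "real (card (onto_colorings mu {..<k})) =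
    (\<Sum>\<phi>\<in>{..<k} \<rightarrow>\<^sub>E (UNIV :: 'm option set). (\<Prod>a<k. case \<phi> a of None \<Rightarrow> - real CARD('m) | Some j \<Rightarrow> 1) *
       (\<Prod>j\<in>UNIV. real (card {a. a < k \<and> \<phi> a = Some j}) ^ mu j))"
proof -
  let ?V = "multipartite_verts mu"
  let ?wt = "\<lambda>v::'m option. case v of None \<Rightarrow> - real CARD('m) | Some j \<Rightarrow> 1"
  let ?ok = "\<lambda>c a (v::'m option). \<forall>u\<in>?V. c u = a \<longrightarrow> v = Some (fst u)"
  let ?c = "?V \<rightarrow>\<^sub>E {..<k}"
  have fin: "finite ?c" by (intro finite_PiE finite_multipartite_verts) auto
  have colour: "(\<Sum>v\<in>UNIV. ?wt v * of_bool (?ok c a v)) =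
      of_bool ((\<exists>u\<in>?V. c u = a) \<and> (\<forall>u\<in>?V. \<forall>v\<in>?V. c u = a \<and> c v = a \<longrightarrow> fst u = fst v))" for c :: "'m \<times> nat \<Rightarrow> nat" and a
  proof (cases "\<exists>u\<in>?V. c u = a")
    case False
    then have "?ok c a v" for v by blast
    then have "(\<Sum>v\<in>UNIV. ?wt v * of_bool (?ok c a v)) = (\<Sum>v\<in>UNIV. ?wt v)" by simp
    also have "\<dots> = 0" by (simp add: UNIV_option_conv sum.reindex)
    finally show ?thesis using False by simp
  next
    case True
    then obtain u where u: "u \<in> ?V" "c u = a" by auto
    define Z where "Z \<longleftrightarrow> (\<forall>u\<in>?V. \<forall>v\<in>?V. c u = a \<and> c v = a \<longrightarrow> fst u = fst v)"
    have RHS: "((\<exists>u\<in>?V. c u = a) \<and> (\<forall>u\<in>?V. \<forall>v\<in>?V. c u = a \<and> c v = a \<longrightarrow> fst u = fst v)) \<longleftrightarrow> Z"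
      unfolding Z_def using True by blast
    show ?thesis unfolding RHS
    proof (cases "\<forall>u\<in>?V. \<forall>v\<in>?V. c u = a \<and> c v = a \<longrightarrow> fst u = fst v")
      case t: True
      then have "?ok c a v \<longleftrightarrow> v = Some (fst u)" for v using u by metis
      then have "(\<Sum>v\<in>UNIV. ?wt v * of_bool (?ok c a v)) = (\<Sum>v\<in>UNIV. if v = Some (fst u) then 1 else 0)"
        by (intro sum.cong) auto
      then have "(\<Sum>v\<in>UNIV. ?wt v * of_bool (?ok c a v)) = 1" by simp
      moreover have Z unfolding Z_def by (rule t)
      ultimately show "(\<Sum>v\<in>UNIV. ?wt v * of_bool (?ok c a v)) = of_bool Z" by simp
    next
      case f: False
      then have no: "?ok c a v = False" for v by (metis option.inject)
      have "(\<Sum>v\<in>UNIV. ?wt v * of_bool (?ok c a v)) = 0"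
        unfolding no by simp
      moreover have "\<not> Z" unfolding Z_def by (rule f)
      ultimately show "(\<Sum>v\<in>UNIV. ?wt v * of_bool (?ok c a v)) = of_bool Z" by simp
    qed
  qed
  have "real (card (onto_colorings mu {..<k})) = (\<Sum>c\<in>?c. of_bool (c ` ?V = {..<k} \<and>
       (\<forall>u\<in>?V. \<forall>v\<in>?V. fst u \<noteq> fst v \<longrightarrow> c u \<noteq> c v)))"
    unfolding onto_colorings_def by (rule sum_of_bool[OF fin, symmetric])
  also have "\<dots> = (\<Sum>c\<in>?c. \<Prod>a<k. \<Sum>v\<in>UNIV. ?wt v * of_bool (?ok c a v))"
  proof (rule sum.cong[OF refl])
    fix c assume c: "c \<in> ?c"
    have "(\<Prod>a<k. \<Sum>v\<in>UNIV. ?wt v * of_bool (?ok c a v)) =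
       of_bool (\<forall>a\<in>{..<k}. (\<exists>u\<in>?V. c u = a) \<and> (\<forall>u\<in>?V. \<forall>v\<in>?V. c u = a \<and> c v = a \<longrightarrow> fst u = fst v))"
      unfolding colour by (rule prod_of_bool) simp
    also have "(\<forall>a\<in>{..<k}. (\<exists>u\<in>?V. c u = a) \<and> (\<forall>u\<in>?V. \<forall>v\<in>?V. c u = a \<and> c v = a \<longrightarrow> fst u = fst v)) \<longleftrightarrow>
      c ` ?V = {..<k} \<and> (\<forall>u\<in>?V. \<forall>v\<in>?V. fst u \<noteq> fst v \<longrightarrow> c u \<noteq> c v)"
    proof (intro iffI conjI)
      assume L: "\<forall>a\<in>{..<k}. (\<exists>u\<in>?V. c u = a) \<and> (\<forall>u\<in>?V. \<forall>v\<in>?V. c u = a \<and> c v = a \<longrightarrow> fst u = fst v)"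
      have cV: "c v \<in> {..<k}" if "v \<in> ?V" for v using c that by auto
      show "c ` ?V = {..<k}"
      proof (rule antisym)
        show "c ` ?V \<subseteq> {..<k}" using cV by (rule image_subsetI)
        show "{..<k} \<subseteq> c ` ?V"
        proof
          fix a assume "a \<in> {..<k}"
          from bspec[OF L this] have "\<exists>u\<in>?V. c u = a" by (rule conjunct1)
          then show "a \<in> c ` ?V" by (elim bexE) (simp add: rev_image_eqI)
        qed
      qed
      show "\<forall>u\<in>?V. \<forall>v\<in>?V. fst u \<noteq> fst v \<longrightarrow> c u \<noteq> c v"
      proof (intro ballI impI notI)
        fix u v assume uv: "u \<in> ?V" "v \<in> ?V" "fst u \<noteq> fst v" "c u = c v"
        have "\<forall>u'\<in>?V. \<forall>v'\<in>?V. c u' = c u \<and> c v' = c u \<longrightarrow> fst u' = fst v'"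
          using bspec[OF L cV[OF uv(1)]] by (rule conjunct2)
        from this[THEN bspec, OF uv(1), THEN bspec, OF uv(2)] show False using uv(3,4) by simp
      qed
    next
      assume R: "c ` ?V = {..<k} \<and> (\<forall>u\<in>?V. \<forall>v\<in>?V. fst u \<noteq> fst v \<longrightarrow> c u \<noteq> c v)"
      show "\<forall>a\<in>{..<k}. (\<exists>u\<in>?V. c u = a) \<and> (\<forall>u\<in>?V. \<forall>v\<in>?V. c u = a \<and> c v = a \<longrightarrow> fst u = fst v)"
      proof (intro ballI conjI impI)
        fix a assume "a \<in> {..<k}"
        then have "a \<in> c ` ?V" using R by simp
        then show "\<exists>u\<in>?V. c u = a" by blast
      next
        fix a u v assume "u \<in> ?V" "v \<in> ?V" "c u = a \<and> c v = a"
        then show "fst u = fst v" using R by metis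
      qed
    qed
    finally show "of_bool (c ` ?V = {..<k} \<and> (\<forall>u\<in>?V. \<forall>v\<in>?V. fst u \<noteq> fst v \<longrightarrow> c u \<noteq> c v)) =
      (\<Prod>a<k. \<Sum>v\<in>UNIV. ?wt v * of_bool (?ok c a v))" by simp
  qed
  also have "\<dots> = (\<Sum>c\<in>?c. \<Sum>\<phi>\<in>{..<k} \<rightarrow>\<^sub>E UNIV. \<Prod>a<k. ?wt (\<phi> a) * of_bool (?ok c a (\<phi> a)))"
    by (intro sum.cong refl prod_sum_PiE) auto
  also have "\<dots> = (\<Sum>\<phi>\<in>{..<k} \<rightarrow>\<^sub>E UNIV. (\<Prod>a<k. ?wt (\<phi> a)) * (\<Sum>c\<in>?c. \<Prod>a<k. of_bool (?ok c a (\<phi> a))))"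
    by (subst sum.swap) (simp add: prod.distrib sum_distrib_left)
  also have "\<dots> = (\<Sum>\<phi>\<in>{..<k} \<rightarrow>\<^sub>E UNIV. (\<Prod>a<k. ?wt (\<phi> a)) * (\<Prod>j\<in>UNIV. real (card {a. a < k \<and> \<phi> a = Some j}) ^ mu j))"
  proof (intro sum.cong refl arg_cong2[of _ _ _ _ "(*)"])
    fix \<phi> :: "nat \<Rightarrow> 'm option"
    have "(\<Sum>c\<in>?c. \<Prod>a<k. of_bool (?ok c a (\<phi> a))) = (\<Sum>c\<in>?c. of_bool (\<forall>a\<in>{..<k}. ?ok c a (\<phi> a)) :: real)"
      by (intro sum.cong refl prod_of_bool) simp
    also have "\<dots> = real (card {c\<in>?c. \<forall>a\<in>{..<k}. ?ok c a (\<phi> a)})"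
      by (rule sum_of_bool[OF fin])
    \<comment> \<open>For fixed labels the admissible colourings form a product: a vertex of part j
      chooses freely among the colours labelled \<open>Some j\<close>.\<close>
    also have "{c\<in>?c. \<forall>a\<in>{..<k}. ?ok c a (\<phi> a)} = (\<Pi>\<^sub>E u\<in>?V. {a. a < k \<and> \<phi> a = Some (fst u)})"
      unfolding set_eq_iff mem_Collect_eq PiE_iff lessThan_iff by blast
    also have "card \<dots> = (\<Prod>u\<in>?V. card {a. a < k \<and> \<phi> a = Some (fst u)})"
      by (rule card_PiE[OF finite_multipartite_verts])
    also have "\<dots> = (\<Prod>j\<in>UNIV. \<Prod>t<mu j. card {a. a < k \<and> \<phi> a = Some j})"
      unfolding multipartite_verts_def by (subst prod.Sigma) (auto simp: case_prod_unfold)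
    finally show "(\<Sum>c\<in>?c. \<Prod>a<k. of_bool (?ok c a (\<phi> a))) = (\<Prod>j\<in>UNIV. real (card {a. a < k \<and> \<phi> a = Some j}) ^ mu j)"
      by simp
  qed
  finally show ?thesis .
qed

section \<open>The Tutte polynomial\<close>

definition simple_graph :: "'v set \<Rightarrow> 'v set set \<Rightarrow> bool" where
  "simple_graph V E \<longleftrightarrow> finite V \<and> finite E \<and> (\<forall>e\<in>E. \<exists>u v. e = {u, v} \<and> u \<in> V \<and> v \<in> V \<and> u \<noteq> v)"

lemma simple_graph_subset: "simple_graph V E \<Longrightarrow> A \<subseteq> E \<Longrightarrow> simple_graph V A"
  by (auto simp: simple_graph_def intro: finite_subset)

lemma equiv_reach: "equiv V (reach V E)"
proof (rule equivI)
  have "sym {(u, v). {u, v} \<in> E}" by (auto simp: sym_def insert_commute)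
  then have "sym ({(u, v). {u, v} \<in> E}\<^sup>*)" by (rule sym_rtrancl)
  then show "sym (reach V E)" by (auto simp: reach_def sym_def)
  show "trans (reach V E)" by (auto simp: reach_def trans_def)
qed (auto simp: reach_def refl_on_def)

section \<open>Whitney's subgraph expansion\<close>

lemma quotient_eq_class:
  assumes R: "equiv V R" and "X \<in> V // R" and t: "t \<in> X"
  shows "R `` {t} = X"
proof -
  obtain x where x: "X = R `` {x}" using assms(2) by (rule quotientE)
  then have "(x, t) \<in> R" using t by simp
  from equiv_class_eq[OF R this] show ?thesis using x by simp
qed

text \<open>Constancy on edges propagates along paths, so such a colouring is the same as an
  arbitrary colouring of the set of components.\<close>

lemma card_colorings_constant_on_edges:
  assumes G: "simple_graph V A"
  shows "card {c \<in> V \<rightarrow>\<^sub>E {..<q::nat}. \<forall>e\<in>A. c constant_on e} = q ^ num_components V A"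
proof -
  let ?R = "reach V A"
  let ?C = "{c \<in> V \<rightarrow>\<^sub>E {..<q}. \<forall>e\<in>A. c constant_on e}"
  have R: "equiv V ?R" by (rule equiv_reach)
  have finV: "finite V" using G by (simp add: simple_graph_def)
  have finQ: "finite (V // ?R)" using finV by (rule finite_quotient) (auto simp: reach_def)
  have const: "c x = c y" if c: "c \<in> ?C" and xy: "(x, y) \<in> ?R" for c x y
  proof -
    have "(x, y) \<in> {(u, v). {u, v} \<in> A}\<^sup>*" using xy by (simp add: reach_def)
    then show ?thesis
    proof induction
      case (step y z)
      then have "{y, z} \<in> A" by simp
      then have "c constant_on {y, z}" using c by blast
      then have "c y = c z" by (auto simp: constant_on_def)
      then show ?case using step by simp
    qed simp
  qed
  have "bij_betw (\<lambda>f. \<lambda>v\<in>V. f (?R `` {v})) ((V // ?R) \<rightarrow>\<^sub>E {..<q}) ?C"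
  proof (rule bij_betw_byWitness[where f' = "\<lambda>c. \<lambda>X\<in>V // ?R. c (SOME x. x \<in> X)"])
    show "\<forall>f\<in>(V // ?R) \<rightarrow>\<^sub>E {..<q}. (\<lambda>X\<in>V // ?R. (\<lambda>v\<in>V. f (?R `` {v})) (SOME x. x \<in> X)) = f"
    proof
      fix f assume f: "f \<in> (V // ?R) \<rightarrow>\<^sub>E {..<q}"
      show "(\<lambda>X\<in>V // ?R. (\<lambda>v\<in>V. f (?R `` {v})) (SOME x. x \<in> X)) = f"
      proof (rule PiE_ext[of _ "V // ?R" "\<lambda>_. UNIV"])
        fix X assume X: "X \<in> V // ?R"
        then obtain x where "x \<in> X" using R by (metis ex_in_conv in_quotient_imp_non_empty)
        then have s: "(SOME x. x \<in> X) \<in> X" by (rule someI)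
        then have "(SOME x. x \<in> X) \<in> V" using X R by (meson in_quotient_imp_subset subsetD)
        moreover have "?R `` {SOME x. x \<in> X} = X"
          by (rule quotient_eq_class[OF R X s])
        ultimately show "(\<lambda>X\<in>V // ?R. (\<lambda>v\<in>V. f (?R `` {v})) (SOME x. x \<in> X)) X = f X" using X by simp
      qed (use f in auto)
    qed
    show "\<forall>c\<in>?C. (\<lambda>v\<in>V. (\<lambda>X\<in>V // ?R. c (SOME x. x \<in> X)) (?R `` {v})) = c"
    proof
      fix c assume c: "c \<in> ?C"
      show "(\<lambda>v\<in>V. (\<lambda>X\<in>V // ?R. c (SOME x. x \<in> X)) (?R `` {v})) = c"
      proof (rule PiE_ext[of _ V "\<lambda>_. UNIV"])
        fix v assume v: "v \<in> V"
        have "v \<in> ?R `` {v}" by (rule equiv_class_self[OF R v])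
        then have "(SOME x. x \<in> ?R `` {v}) \<in> ?R `` {v}" by (rule someI)
        then have "c (SOME x. x \<in> ?R `` {v}) = c v" using const[OF c] by simp
        then show "(\<lambda>v\<in>V. (\<lambda>X\<in>V // ?R. c (SOME x. x \<in> X)) (?R `` {v})) v = c v"
          using v by (simp add: quotientI)
      qed (use c in auto)
    qed
    show "(\<lambda>f. \<lambda>v\<in>V. f (?R `` {v})) ` ((V // ?R) \<rightarrow>\<^sub>E {..<q}) \<subseteq> ?C"
    proof
      fix c assume "c \<in> (\<lambda>f. \<lambda>v\<in>V. f (?R `` {v})) ` ((V // ?R) \<rightarrow>\<^sub>E {..<q})"
      then obtain f where f: "f \<in> (V // ?R) \<rightarrow>\<^sub>E {..<q}" and c: "c = (\<lambda>v\<in>V. f (?R `` {v}))" by blast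
      have "c \<in> V \<rightarrow>\<^sub>E {..<q}"
      proof (rule PiE_I)
        fix v assume "v \<in> V"
        then show "c v \<in> {..<q}" using f by (auto simp: c quotientI intro!: PiE_mem[of f "V // ?R" "\<lambda>_. {..<q}", simplified])
      qed (simp add: c)
      moreover have "c constant_on e" if eA: "e \<in> A" for e
      proof -
        obtain u v where e: "e = {u, v}" "u \<in> V" "v \<in> V" using G eA by (auto simp: simple_graph_def)
        then have "(u, v) \<in> ?R" using eA by (auto simp: reach_def)
        then have "?R `` {u} = ?R `` {v}" using R by (simp add: equiv_class_eq_iff)
        then have "c u = c v" using e by (simp add: c)
        then show ?thesis using e by (auto simp: constant_on_def)
      qed
      ultimately show "c \<in> ?C" by blast
    qed
    show "(\<lambda>c. \<lambda>X\<in>V // ?R. c (SOME x. x \<in> X)) ` ?C \<subseteq> (V // ?R) \<rightarrow>\<^sub>E {..<q}"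
    proof
      fix f assume "f \<in> (\<lambda>c. \<lambda>X\<in>V // ?R. c (SOME x. x \<in> X)) ` ?C"
      then obtain c where c: "c \<in> ?C" and f: "f = (\<lambda>X\<in>V // ?R. c (SOME x. x \<in> X))" by blast
      show "f \<in> (V // ?R) \<rightarrow>\<^sub>E {..<q}"
      proof (rule PiE_I)
        fix X assume X: "X \<in> V // ?R"
        then obtain x where "x \<in> X" using R by (metis ex_in_conv in_quotient_imp_non_empty)
        then have s: "(SOME x. x \<in> X) \<in> X" by (rule someI)
        then have "(SOME x. x \<in> X) \<in> V" using X R by (meson in_quotient_imp_subset subsetD)
        then show "f X \<in> {..<q}" using c X by (auto simp: f)
      qed (simp add: f)
    qed
  qed
  then have "card ((V // ?R) \<rightarrow>\<^sub>E {..<q}) = card ?C" by (rule bij_betw_same_card)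
  then show ?thesis using finQ by (simp add: num_components_def card_funcsetE)
qed

text \<open>Inclusion-exclusion: the product of 1 - [e is monochromatic] over all edges is expanded
  over the subsets A, and the colourings that are monochromatic on A are counted by
  components.\<close>

lemma card_proper_colorings_subgraphs:
  assumes G: "simple_graph V E"
  shows "real (card (proper_colorings V E q)) = (\<Sum>A\<in>Pow E. (-1) ^ card A * real q ^ num_components V A)"
proof -
  let ?m = "\<lambda>c e. c constant_on e"
  let ?F = "V \<rightarrow>\<^sub>E {..<q}"
  have finV: "finite V" and finE: "finite E" using G by (auto simp: simple_graph_def)
  have finF: "finite ?F" using finV by (intro finite_PiE) auto
  have proper: "(\<forall>u v. {u, v} \<in> E \<longrightarrow> c u \<noteq> c v) \<longleftrightarrow> (\<forall>e\<in>E. \<not> ?m c e)" for c :: "'a \<Rightarrow> nat"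
  proof
    assume L: "\<forall>u v. {u, v} \<in> E \<longrightarrow> c u \<noteq> c v"
    show "\<forall>e\<in>E. \<not> ?m c e"
    proof
      fix e assume e: "e \<in> E"
      then obtain u v where "e = {u, v}" using G by (auto simp: simple_graph_def)
      moreover from this have "c u \<noteq> c v" using L e by blast
      ultimately show "\<not> ?m c e" by (auto simp: constant_on_def)
    qed
  next
    assume R: "\<forall>e\<in>E. \<not> ?m c e"
    show "\<forall>u v. {u, v} \<in> E \<longrightarrow> c u \<noteq> c v"
    proof (intro allI impI notI)
      fix u v assume "{u, v} \<in> E" "c u = c v"
      moreover have "c constant_on {u, v}" if "c u = c v" using that by (auto simp: constant_on_def)
      ultimately show False using R by blast
    qed
  qed
  have "real (card (proper_colorings V E q)) = (\<Sum>c\<in>?F. of_bool (\<forall>e\<in>E. \<not> ?m c e))"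
    unfolding proper_colorings_def proper by (rule sum_of_bool[OF finF, symmetric])
  also have "\<dots> = (\<Sum>c\<in>?F. \<Sum>A\<in>Pow E. (-1) ^ card A * of_bool (\<forall>e\<in>A. ?m c e))"
  proof (rule sum.cong[OF refl])
    fix c :: "'a \<Rightarrow> nat"
    have "of_bool (\<forall>e\<in>E. \<not> ?m c e) = (\<Prod>e\<in>E. 1 - of_bool (?m c e) :: real)"
      unfolding prod_of_bool[OF finE, symmetric] by (simp only: of_bool_not_iff)
    also have "\<dots> = (\<Sum>A\<in>Pow E. (-1) ^ card A * (\<Prod>e\<in>A. of_bool (?m c e)))"
      using finE by (subst prod_diff_conv_sum) auto
    also have "\<dots> = (\<Sum>A\<in>Pow E. (-1) ^ card A * of_bool (\<forall>e\<in>A. ?m c e))"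
    proof (rule sum.cong[OF refl])
      fix A assume "A \<in> Pow E"
      then have "finite A" using finE by (auto intro: finite_subset)
      then have "(\<Prod>e\<in>A. of_bool (?m c e) :: real) = of_bool (\<forall>e\<in>A. ?m c e)"
        by (rule prod_of_bool)
      then show "(-1) ^ card A * (\<Prod>e\<in>A. of_bool (?m c e) :: real) = (-1) ^ card A * of_bool (\<forall>e\<in>A. ?m c e)"
        by simp
    qed
    finally show "of_bool (\<forall>e\<in>E. \<not> ?m c e) = (\<Sum>A\<in>Pow E. (-1) ^ card A * (of_bool (\<forall>e\<in>A. ?m c e) :: real))" .
  qed
  also have "\<dots> = (\<Sum>A\<in>Pow E. (-1) ^ card A * (\<Sum>c\<in>?F. of_bool (\<forall>e\<in>A. ?m c e)))"
    by (subst sum.swap) (simp add: sum_distrib_left)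
  also have "\<dots> = (\<Sum>A\<in>Pow E. (-1) ^ card A * real q ^ num_components V A)"
  proof (rule sum.cong[OF refl])
    fix A assume "A \<in> Pow E"
    then have "real (card {c \<in> ?F. \<forall>e\<in>A. ?m c e}) = real q ^ num_components V A"
      using card_colorings_constant_on_edges[of V A q] simple_graph_subset[OF G, of A] by simp
    then show "(-1) ^ card A * (\<Sum>c\<in>?F. of_bool (\<forall>e\<in>A. ?m c e)) = (-1) ^ card A * real q ^ num_components V A"
      by (simp only: sum_of_bool[OF finF])
  qed
  finally show ?thesis .
qed

section \<open>Component counts and ranks of subgraphs\<close>

text \<open>Induction along the path: a step over the new edge passes through u and v, so either the
  new edge is dispensable or both ends reach u or v in the old graph.\<close>

lemma reach_insert:
  assumes "(x, y) \<in> reach V (insert {u, v} A)" and "u \<in> V" "v \<in> V" and G: "\<And>e. e \<in> A \<Longrightarrow> e \<subseteq> V"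
  shows "(x, y) \<in> reach V A \<or>
    ((x, u) \<in> reach V A \<or> (x, v) \<in> reach V A) \<and> ((y, u) \<in> reach V A \<or> (y, v) \<in> reach V A)"
proof -
  let ?R = "reach V A"
  have R: "equiv V ?R" by (rule equiv_reach)
  then have sym: "sym ?R" and tr: "trans ?R" by (auto simp: equiv_def)
  have refl: "(a, a) \<in> ?R" if "a \<in> V" for a using that by (simp add: reach_def)
  have x: "x \<in> V" using assms(1) by (auto simp: reach_def)
  have "(x, y) \<in> {(a, b). {a, b} \<in> insert {u, v} A}\<^sup>*" using assms(1) by (simp add: reach_def)
  then show ?thesis
  proof induction
    case base
    then show ?case using refl x by simp
  next
    case (step y z)
    have "{y, z} = {u, v} \<or> (y, z) \<in> ?R"
      using step.hyps(2) G by (auto simp: reach_def)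
    then show ?case
    proof
      assume "(y, z) \<in> ?R"
      then show ?thesis using step.IH sym tr by (meson symD transD)
    next
      assume "{y, z} = {u, v}"
      then have "y = u \<and> z = v \<or> y = v \<and> z = u" by (auto simp: doubleton_eq_iff)
      then show ?thesis using step.IH refl[OF \<open>u \<in> V\<close>] refl[OF \<open>v \<in> V\<close>] by blast
    qed
  qed
qed

text \<open>The new edge can only merge the classes of u and v. Once the class of v is left out,
  sending an old class to the new class containing it is injective; the omitted class accounts for
  the \<open>Suc\<close>.\<close>

lemma num_components_insert:
  assumes "finite V" and "u \<in> V" "v \<in> V" and G: "\<And>e. e \<in> A \<Longrightarrow> e \<subseteq> V"
  shows "num_components V A \<le> Suc (num_components V (insert {u, v} A))"
proof -
  let ?R = "reach V A" and ?R' = "reach V (insert {u, v} A)"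
  have R: "equiv V ?R" and R': "equiv V ?R'" by (rule equiv_reach)+
  have sub: "?R \<subseteq> ?R'"
  proof -
    have "{(a, b). {a, b} \<in> A} \<subseteq> {(a, b). {a, b} \<in> insert {u, v} A}" by auto
    from rtrancl_mono[OF this] show ?thesis by (auto simp: reach_def)
  qed
  have finQ: "finite (V // ?R)" "finite (V // ?R')"
    using \<open>finite V\<close> by (auto intro!: finite_quotient simp: reach_def)
  let ?g = "\<lambda>X. ?R' `` X"
  have g: "?g (?R `` {x}) = ?R' `` {x}" if "x \<in> V" for x
  proof -
    have "(x, x) \<in> ?R" using R that by (auto simp: equiv_def refl_on_def)
    moreover have "trans ?R'" using R' by (simp add: equiv_def)
    ultimately show ?thesis using sub by (auto dest: transD)
  qed
  have "card (V // ?R - {?R `` {v}}) \<le> card (V // ?R')"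
  proof (rule card_inj_on_le[where f = ?g])
    show "inj_on ?g (V // ?R - {?R `` {v}})"
    proof (rule inj_onI)
      fix X Y assume X: "X \<in> V // ?R - {?R `` {v}}" and Y: "Y \<in> V // ?R - {?R `` {v}}" and eq: "?g X = ?g Y"
      obtain x y where x: "x \<in> V" "X = ?R `` {x}" and y: "y \<in> V" "Y = ?R `` {y}"
        using X Y by (auto elim!: quotientE)
      have "?R' `` {x} = ?R' `` {y}" using eq g x y by simp
      then have "(x, y) \<in> ?R'" using R' x y by (simp add: eq_equiv_class)
      then have "(x, y) \<in> ?R \<or> ((x, u) \<in> ?R \<or> (x, v) \<in> ?R) \<and> ((y, u) \<in> ?R \<or> (y, v) \<in> ?R)"
        using reach_insert assms by metis
      moreover have "(x, v) \<notin> ?R" "(y, v) \<notin> ?R" using X Y x y R by (auto simp: equiv_class_eq_iff)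
      ultimately have "(x, y) \<in> ?R" using R by (meson equiv_def symD transD)
      then show "X = Y" using R x y by (simp add: equiv_class_eq_iff)
    qed
    show "?g ` (V // ?R - {?R `` {v}}) \<subseteq> V // ?R'"
      using g by (auto elim!: quotientE intro: quotientI)
    show "finite (V // ?R')" by (rule finQ)
  qed
  moreover have "card (V // ?R - {?R `` {v}}) = card (V // ?R) - 1"
    using finQ \<open>v \<in> V\<close> by (intro card_Diff_singleton) (auto intro: quotientI)
  ultimately show ?thesis by (simp add: num_components_def)
qed

lemma num_components_le:
  assumes "finite V"
  shows "num_components V A \<le> card V"
proof -
  have "V // reach V A = (\<lambda>x. reach V A `` {x}) ` V" by (auto simp: quotient_def)
  then show ?thesis using assms by (simp add: num_components_def card_image_le)
qed

lemma num_components_pos: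
  assumes "finite V" "V \<noteq> {}"
  shows "num_components V A > 0"
proof -
  have "V // reach V A = (\<lambda>x. reach V A `` {x}) ` V" by (auto simp: quotient_def)
  then show ?thesis using assms by (simp add: num_components_def card_gt_0_iff)
qed

text \<open>Each edge lowers the number of components by at most one, starting from card V. Together
  with \<open>num_components_le\<close> this shows that \<open>graph_rank\<close> and the nullity
  exponent in \<open>tutte\<close> are not truncated.\<close>

lemma card_le_num_components_plus_card:
  assumes "simple_graph V A"
  shows "card V \<le> num_components V A + card A"
proof -
  have fin: "finite V" using assms by (simp add: simple_graph_def)
  have "finite A" using assms by (simp add: simple_graph_def)
  then show ?thesis using assms
  proof (induction A)
    case empty
    have "reach V {} = Id_on V" by (auto simp: reach_def)
    then have "V // reach V {} = (\<lambda>x. {x}) ` V" by (auto simp: quotient_def)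
    then have "num_components V {} = card V" by (simp add: num_components_def card_image)
    then show ?case by simp
  next
    case (insert e A)
    obtain u v where e: "e = {u, v}" "u \<in> V" "v \<in> V" using insert.prems by (auto simp: simple_graph_def)
    have A: "simple_graph V A" using insert.prems by (auto intro: simple_graph_subset)
    then have "\<And>e. e \<in> A \<Longrightarrow> e \<subseteq> V" by (auto simp: simple_graph_def)
    then have "num_components V A \<le> Suc (num_components V (insert e A))"
      unfolding e(1) using num_components_insert[OF fin e(2,3)] by blast
    then show ?case using insert.IH[OF A] insert.hyps by simp
  qed
qed

lemma num_components_connected:
  assumes "connected_graph V E" shows "num_components V E = 1"
proof -
  have "reach V E = V \<times> V" and "V \<noteq> {}" using assms by (auto simp: connected_graph_def reach_def)
  then have "V // reach V E = {V}" by (auto simp: quotient_def)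
  then show ?thesis by (simp add: num_components_def)
qed

text \<open>The subgraph expansion and the rank expansion agree term by term. As E is connected, the
  first exponent is k - 1 for a subgraph with k components, and the factor s completes it to s^k; at
  y = 0 the nullity contributes only a sign.\<close>

lemma chromatic_poly_tutte:
  assumes G: "simple_graph V E" and C: "connected_graph V E"
  shows "(-1) ^ card V * poly (chromatic_poly V E) (- s) = s * tutte V E (1 + s) 0"
proof -
  have fin: "finite V" "finite E" using G by (auto simp: simple_graph_def)
  have V: "V \<noteq> {}" using C by (simp add: connected_graph_def)
  define P :: "real poly" where "P = (\<Sum>A\<in>Pow E. [:(-1) ^ card A:] * [:0, 1:] ^ num_components V A)"
  have P: "poly P x = (\<Sum>A\<in>Pow E. (-1) ^ card A * x ^ num_components V A)" for x
    by (simp add: P_def poly_sum)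
  have "chromatic_poly V E = P"
    by (rule chromatic_poly_eqI) (simp add: P card_proper_colorings_subgraphs[OF G])
  then have "(-1) ^ card V * poly (chromatic_poly V E) (- s) =
    (\<Sum>A\<in>Pow E. (-1) ^ card V * ((-1) ^ card A * (- s) ^ num_components V A))"
    by (simp add: P sum_distrib_left)
  also have "\<dots> = (\<Sum>A\<in>Pow E. s * ((1 + s - 1) ^ (graph_rank V E - graph_rank V A) * (0 - 1) ^ (card A - graph_rank V A)))"
  proof (rule sum.cong[OF refl])
    fix A assume "A \<in> Pow E"
    then have A: "simple_graph V A" using G by (auto intro: simple_graph_subset)
    define k where "k = num_components V A"
    have k: "0 < k" "k \<le> card V" "card V \<le> k + card A"
      using num_components_pos[OF fin(1) V] num_components_le[OF fin(1)] card_le_num_components_plus_card[OF A]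
      by (simp_all add: k_def)
    have e1: "Suc (graph_rank V E - graph_rank V A) = k"
      using k num_components_connected[OF C] by (simp add: graph_rank_def k_def[symmetric])
    \<comment> \<open>The exponent of the sign on the left and the nullity differ by 2 card V, hence
      have the same parity.\<close>
    have e2: "card V + card A + k = (card A - graph_rank V A) + 2 * card V"
      using k by (simp add: graph_rank_def k_def[symmetric])
    have "(-1) ^ card V * ((-1) ^ card A * (- s) ^ k) = ((-1) ^ (card V + card A + k) :: real) * s ^ k"
      by (subst power_minus) (simp add: power_add)
    also have "\<dots> = (-1) ^ (card A - graph_rank V A) * s ^ Suc (graph_rank V E - graph_rank V A)"
      unfolding e2 e1 by (simp add: power_add)
    finally show "(-1) ^ card V * ((-1) ^ card A * (- s) ^ num_components V A) =
      s * ((1 + s - 1) ^ (graph_rank V E - graph_rank V A) * (0 - 1) ^ (card A - graph_rank V A))"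
      by (simp add: k_def)
  qed
  also have "\<dots> = s * tutte V E (1 + s) 0"
    by (simp add: tutte_def sum_distrib_left)
  finally show ?thesis .
qed

lemma simple_graph_multipartite:
  "simple_graph (multipartite_verts l) (multipartite_edges (l :: 'i::finite \<Rightarrow> nat))"
proof -
  let ?V = "multipartite_verts l"
  have fin: "finite ?V" by (simp add: multipartite_verts_def)
  have "multipartite_edges l \<subseteq> Pow ?V" by (auto simp: multipartite_edges_def)
  then have "finite (multipartite_edges l)" using fin by (meson finite_Pow_iff finite_subset)
  then show ?thesis using fin by (fastforce simp: simple_graph_def multipartite_edges_def)
qed

section \<open>Coefficient extraction on the torus\<close>

text \<open>Lebesgue measure on vectors is the image of a product measure indexed by basis vectors.
  The factors are moved to that index set through the inverse of \<open>axis\<close>, after which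
  Fubini's theorem for finite products applies.\<close>

lemma prod_integral_vec:
  fixes f :: "'m::finite \<Rightarrow> real \<Rightarrow> 'a::{real_normed_field,banach,second_countable_topology}"
  assumes f: "\<And>j. integrable lborel (f j)"
  shows "integrable lborel (\<lambda>x::real^'m. \<Prod>j\<in>UNIV. f j (x $ j))" (is ?int)
    and "(\<integral>x. (\<Prod>j\<in>UNIV. f j (x $ j)) \<partial>(lborel :: (real^'m) measure)) = (\<Prod>j\<in>UNIV. integral\<^sup>L lborel (f j))" (is ?eq)
proof -
  interpret product_sigma_finite "\<lambda>b::real^'m. lborel :: real measure" ..
  let ?ax = "\<lambda>j::'m. axis j (1::real)"
  have inj: "inj ?ax" by (auto simp: inj_on_def axis_eq_axis)
  have Basis: "(Basis :: (real^'m) set) = range ?ax" by (auto simp: Basis_vec_def)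
  define g where "g = (\<lambda>b. f (the_inv ?ax b))"
  have g: "g (?ax j) = f j" for j by (simp add: g_def the_inv_f_f[OF inj])
  have gi: "b \<in> Basis \<Longrightarrow> integrable lborel (g b)" for b using f by (simp add: g_def)
  let ?P = "Pi\<^sub>M (Basis :: (real^'m) set) (\<lambda>b. lborel :: real measure)"
  let ?T = "\<lambda>x::(real^'m) \<Rightarrow> real. \<Sum>b\<in>Basis. x b *\<^sub>R b"
  have axj: "?ax i $ j = (if i = j then 1 else 0)" for i j by (simp add: axis_def)
  have T: "?T x $ j = x (?ax j)" for x j
  proof -
    have "?T x $ j = (\<Sum>i\<in>UNIV. if i = j then x (?ax i) else 0)"
      unfolding Basis by (subst sum.reindex[OF inj]) (simp add: axj if_distrib[of "(*) _"] cong: if_cong)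
    then show ?thesis by simp
  qed
  have eq: "(\<Prod>j\<in>UNIV. f j (?T x $ j)) = (\<Prod>b\<in>Basis. g b (x b))" for x
    unfolding T by (simp add: Basis prod.reindex[OF inj] g)
  have fm[measurable]: "f j \<in> borel_measurable borel" for j using borel_measurable_integrable[OF f[of j]] by simp
  have meas: "(\<lambda>x::real^'m. \<Prod>j\<in>UNIV. f j (x $ j)) \<in> borel_measurable borel" by measurable
  have Tm: "?T \<in> measurable ?P borel" by measurable
  have vol: "(lborel :: (real^'m) measure) = distr ?P borel ?T" by (rule lborel_eq)
  have int: "integrable ?P (\<lambda>x. \<Prod>b\<in>Basis. g b (x b))"
    by (rule product_integrable_prod) (auto intro: gi)
  show ?int using int unfolding vol integrable_distr_eq[OF Tm meas] eq .
  have "(\<integral>x. (\<Prod>j\<in>UNIV. f j (x $ j)) \<partial>(lborel :: (real^'m) measure)) = (\<integral>x. (\<Prod>b\<in>Basis. g b (x b)) \<partial>?P)"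
    unfolding vol integral_distr[OF Tm meas] eq ..
  also have "\<dots> = (\<Prod>b\<in>Basis. integral\<^sup>L lborel (g b))"
    by (rule product_integral_prod) (auto intro: gi)
  also have "\<dots> = (\<Prod>j\<in>UNIV. integral\<^sup>L lborel (f j))"
    unfolding Basis by (subst prod.reindex[OF inj]) (simp add: g)
  finally show ?eq .
qed

section \<open>Fourier orthogonality on the torus\<close>

definition torus_box :: "(real^'m::finite) set" where
  "torus_box = cbox (\<chi> i. - pi) (\<chi> i. pi)"

text \<open>The exponents are integers because the induction in
  \<open>set_integral_phase_power\<close> lowers one of them by 1 and may take it below 0.\<close>

definition phase :: "('m::finite \<Rightarrow> int) \<Rightarrow> real^'m \<Rightarrow> complex" where
  "phase \<mu> \<theta> = cis (- (\<Sum>j\<in>UNIV. of_int (\<mu> j) * \<theta> $ j))"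

lemma phase_eq_prod: "phase \<mu> \<theta> = (\<Prod>j\<in>UNIV. cis (- of_int (\<mu> j) * \<theta> $ j))"
proof -
  have "(\<Prod>j\<in>A. cis (- of_int (\<mu> j) * \<theta> $ j)) = cis (- (\<Sum>j\<in>A. of_int (\<mu> j) * \<theta> $ j))" if "finite A" for A
    using that by induction (auto simp: cis_mult algebra_simps)
  then show ?thesis by (simp add: phase_def)
qed

lemma continuous_on_phase [continuous_intros]: "continuous_on S (phase \<mu>)"
  unfolding phase_def[abs_def] by (intro continuous_intros)

lemma integral_cis_period:
  "(LINT t:{-pi..pi}|lborel. cis (of_int k * t)) = (if k = 0 then 2 * of_real pi else 0)"
  "set_integrable lborel {-pi..pi} (\<lambda>t. cis (of_int k * t))"
proof -
  show "set_integrable lborel {-pi..pi} (\<lambda>t. cis (of_int k * t))"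
    unfolding set_integrable_def
    by (intro borel_integrable_compact) (auto intro!: continuous_intros)
  show "(LINT t:{-pi..pi}|lborel. cis (of_int k * t)) = (if k = 0 then 2 * of_real pi else 0)"
  proof (cases "k = 0")
    case True
    then show ?thesis by (simp add: set_integral_const scaleR_conv_of_real)
  next
    case False
    have "((\<lambda>t. cis (of_int k * t) / (\<i> * of_int k)) has_vector_derivative cis (of_int k * t)) (at t within {-pi..pi})" for t
    proof -
      have "((\<lambda>z. exp (\<i> * of_int k * z) / (\<i> * of_int k)) has_field_derivative exp (\<i> * of_int k * of_real t)) (at (of_real t))"
        using False by (auto intro!: derivative_eq_intros)
      from has_vector_derivative_real_field[OF this] show ?thesis
        by (simp add: cis_conv_exp mult_ac)
    qed
    then have "has_bochner_integral lborel (\<lambda>t. indicator {-pi..pi} t *\<^sub>R cis (of_int k * t))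
        (cis (of_int k * pi) / (\<i> * of_int k) - cis (of_int k * (- pi)) / (\<i> * of_int k))"
      by (intro has_bochner_integral_FTC_Icc) (auto intro!: continuous_intros)
    moreover have "cis (of_int k * pi) = cis (of_int k * (- pi))"
      by (auto simp: complex_eq_iff sin_times_pi_eq_0)
    ultimately show ?thesis using False
      by (simp add: set_lebesgue_integral_def has_bochner_integral_integral_eq)
  qed
qed

lemma indicator_torus_box: "indicator torus_box x = (\<Prod>j\<in>UNIV. indicator {-pi..pi} (x $ j) :: real)"
  by (auto simp: torus_box_def mem_box_cart indicator_def prod.If_cases)

lemma set_integral_phase:
  fixes \<mu> :: "'m::finite \<Rightarrow> int"
  shows "(LINT \<theta>:torus_box|lborel. phase \<mu> \<theta>) = (if \<forall>j. \<mu> j = 0 then (2 * of_real pi) ^ CARD('m) else 0)"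
proof -
  have "(LINT \<theta>:torus_box|lborel. phase \<mu> \<theta>) =
     (\<integral>\<theta>. (\<Prod>j\<in>UNIV. indicator {-pi..pi} (\<theta> $ j) *\<^sub>R cis (of_int (- \<mu> j) * \<theta> $ j)) \<partial>lborel)"
    unfolding set_lebesgue_integral_def indicator_torus_box phase_eq_prod
    by (simp add: scaleR_conv_of_real prod.distrib)
  also have "\<dots> = (\<Prod>j\<in>UNIV. LINT t:{-pi..pi}|lborel. cis (of_int (- \<mu> j) * t))"
    unfolding set_lebesgue_integral_def
    by (rule prod_integral_vec) (rule integral_cis_period(2)[unfolded set_integrable_def])
  also have "\<dots> = (if \<forall>j. \<mu> j = 0 then (2 * of_real pi) ^ CARD('m) else 0)"
    unfolding integral_cis_period(1) by auto
  finally show ?thesis .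
qed

lemma set_integrable_torus_box:
  fixes f :: "real^'m::finite \<Rightarrow> complex"
  shows "continuous_on torus_box f \<Longrightarrow> set_integrable lborel torus_box f"
  unfolding set_integrable_def torus_box_def by (rule borel_integrable_compact) auto

lemma set_integral_sum_mult:
  fixes g :: "'i \<Rightarrow> real^'m::finite \<Rightarrow> complex"
  assumes "\<And>i. i \<in> I \<Longrightarrow> continuous_on torus_box (g i)"
  shows "(LINT \<theta>:torus_box|lborel. \<Sum>i\<in>I. a i * g i \<theta>) = (\<Sum>i\<in>I. a i * (LINT \<theta>:torus_box|lborel. g i \<theta>))"
proof -
  have "(LINT \<theta>:torus_box|lborel. \<Sum>i\<in>I. a i * g i \<theta>) =
    (\<integral>\<theta>. (\<Sum>i\<in>I. a i * (indicator torus_box \<theta> *\<^sub>R g i \<theta>)) \<partial>lborel)"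
    by (simp add: set_lebesgue_integral_def scaleR_sum_right)
  also have "\<dots> = (\<Sum>i\<in>I. \<integral>\<theta>. a i * (indicator torus_box \<theta> *\<^sub>R g i \<theta>) \<partial>lborel)"
    using set_integrable_torus_box[OF assms]
    by (intro Bochner_Integration.integral_sum integrable_mult_right) (simp add: set_integrable_def)
  finally show ?thesis by (simp only: integral_mult_right_zero set_lebesgue_integral_def)
qed

text \<open>The Fourier coefficient of a power of a linear form is a multinomial coefficient. The
  induction peels off one factor, whose k-th summand removes 1 from the k-th exponent of the
  phase.\<close>

lemma set_integral_phase_power:
  fixes v :: "'m::finite \<Rightarrow> complex" and \<mu> :: "'m \<Rightarrow> int"
  shows "(LINT \<theta>:torus_box|lborel. phase \<mu> \<theta> * (\<Sum>j\<in>UNIV. v j * cis (\<theta> $ j)) ^ M) =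
    (if (\<forall>j. \<mu> j \<ge> 0) \<and> (\<Sum>j\<in>UNIV. \<mu> j) = int M
     then (2 * of_real pi) ^ CARD('m) * fact M * (\<Prod>j\<in>UNIV. v j ^ nat (\<mu> j) / fact (nat (\<mu> j))) else 0)"
proof (induction M arbitrary: \<mu>)
  case 0
  have "(\<forall>j. \<mu> j \<ge> 0) \<and> (\<Sum>j\<in>UNIV. \<mu> j) = 0 \<longleftrightarrow> (\<forall>j. \<mu> j = 0)"
    using sum_nonneg_eq_0_iff[of UNIV \<mu>] by auto
  then show ?case by (simp add: set_integral_phase)
next
  case (Suc M)
  define R where "R = (\<lambda>(M::nat) \<mu>. if (\<forall>j. \<mu> j \<ge> 0) \<and> (\<Sum>j\<in>UNIV. \<mu> j) = int M
     then (2 * of_real pi) ^ CARD('m) * fact M * (\<Prod>j\<in>UNIV. v j ^ nat (\<mu> j) / fact (nat (\<mu> j))) else (0::complex))"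
  define D where "D = (\<lambda>k. \<mu>(k := \<mu> k - 1))"
  have ph: "phase \<mu> \<theta> * cis (\<theta> $ k) = phase (D k) \<theta>" for k \<theta>
  proof -
    have "(\<Sum>j\<in>UNIV. of_int (D k j) * \<theta> $ j) = (\<Sum>j\<in>UNIV. of_int (\<mu> j) * \<theta> $ j - (if j = k then \<theta> $ k else 0))"
      by (rule sum.cong) (auto simp: D_def algebra_simps)
    then show ?thesis by (simp add: phase_def cis_mult sum_subtractf)
  qed
  have sumD: "(\<Sum>j\<in>UNIV. D k j) = (\<Sum>j\<in>UNIV. \<mu> j) - 1" for k
  proof -
    have "(\<Sum>j\<in>UNIV. D k j) = (\<Sum>j\<in>UNIV. \<mu> j - (if j = k then 1 else 0))"
      by (rule sum.cong) (auto simp: D_def)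
    then show ?thesis by (simp add: sum_subtractf)
  qed
  let ?S = "\<lambda>\<theta>::real^'m. \<Sum>j\<in>UNIV. v j * cis (\<theta> $ j)"
  have "(LINT \<theta>:torus_box|lborel. phase \<mu> \<theta> * ?S \<theta> ^ Suc M) =
      (LINT \<theta>:torus_box|lborel. (\<Sum>k\<in>UNIV. v k * (phase (D k) \<theta> * ?S \<theta> ^ M)))"
    by (rule arg_cong[where f = "set_lebesgue_integral lborel torus_box"])
       (auto simp: fun_eq_iff ph[symmetric] sum_distrib_left sum_distrib_right mult_ac)
  also have "\<dots> = (\<Sum>k\<in>UNIV. v k * R M (D k))"
    by (subst set_integral_sum_mult) (auto simp: R_def Suc.IH intro!: continuous_intros)
  also have "\<dots> = R (Suc M) \<mu>"
  proof (cases "(\<forall>j. \<mu> j \<ge> 0) \<and> (\<Sum>j\<in>UNIV. \<mu> j) = int (Suc M)")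
    case True
    let ?Q = "\<Prod>j\<in>UNIV. v j ^ nat (\<mu> j) / fact (nat (\<mu> j))"
    \<comment> \<open>Every k yields the same product weighted by \<mu> k, and the weights add up to
      M + 1, completing \<open>fact M\<close> to \<open>fact (Suc M)\<close>. If \<mu> k = 0, the
      lowered exponent is negative and the term is 0.\<close>
    have "v k * R M (D k) = (2 * of_real pi) ^ CARD('m) * fact M * ?Q * of_int (\<mu> k)" for k
    proof (cases "\<mu> k = 0")
      case t: True
      then have "D k k < 0" by (simp add: D_def)
      then have "\<not> (\<forall>j. D k j \<ge> 0)" by (metis not_le)
      then have "R M (D k) = 0" by (simp only: R_def simp_thms if_False)
      then show ?thesis using t by simp
    next
      case f: False
      then have pos: "\<mu> k > 0" using True by (metis order_le_less)
      then obtain n where n: "\<mu> k = int (Suc n)" by (metis gr0_implies_Suc zero_less_imp_eq_int)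
      have "\<forall>j. D k j \<ge> 0" using True pos by (auto simp: D_def)
      then have "R M (D k) = (2 * of_real pi) ^ CARD('m) * fact M * (\<Prod>j\<in>UNIV. v j ^ nat (D k j) / fact (nat (D k j)))"
        using True sumD by (simp add: R_def)
      also have "(\<Prod>j\<in>UNIV. v j ^ nat (D k j) / fact (nat (D k j))) =
          v k ^ n / fact n * (\<Prod>j\<in>UNIV-{k}. v j ^ nat (\<mu> j) / fact (nat (\<mu> j)))"
        by (subst prod.remove[of _ k]) (auto simp: D_def n intro!: prod.cong)
      finally have "v k * R M (D k) = (2 * of_real pi) ^ CARD('m) * fact M *
          ((v k ^ Suc n / fact (Suc n) * (\<Prod>j\<in>UNIV-{k}. v j ^ nat (\<mu> j) / fact (nat (\<mu> j)))) * of_nat (Suc n))"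
        by (simp add: field_simps del: of_nat_Suc)
      also have "v k ^ Suc n / fact (Suc n) * (\<Prod>j\<in>UNIV-{k}. v j ^ nat (\<mu> j) / fact (nat (\<mu> j))) = ?Q"
        by (subst (2) prod.remove[of _ k]) (auto simp: n nat_int_add[symmetric] simp del: of_nat_Suc)
      finally show ?thesis by (simp add: n del: of_nat_Suc)
    qed
    then have "(\<Sum>k\<in>UNIV. v k * R M (D k)) = (2 * of_real pi) ^ CARD('m) * fact M * ?Q * of_int (\<Sum>k\<in>UNIV. \<mu> k)"
      by (simp add: sum_distrib_left)
    then show ?thesis using True by (simp add: R_def mult_ac del: of_nat_Suc)
  next
    case False
    have "R M (D k) = 0" for k
    proof (rule ccontr)
      assume "R M (D k) \<noteq> 0"
      then have *: "\<forall>j. D k j \<ge> 0" "(\<Sum>j\<in>UNIV. D k j) = int M" by (auto simp: R_def split: if_splits)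
      have "\<mu> j \<ge> 0" for j using spec[OF *(1), of j] by (auto simp: D_def split: if_splits)
      then show False using False *(2) sumD[of k] by simp
    qed
    moreover have "R (Suc M) \<mu> = 0" using False by (auto simp: R_def)
    ultimately show ?thesis by simp
  qed
  finally show ?case by (simp add: R_def)
qed

section \<open>Homogeneous components in the first p - 1 variables\<close>

text \<open>The Taylor series in the scaling variable \<zeta> of c(\<zeta> w); its coefficient of
  \<zeta>^M is the homogeneous component of c of degree M.\<close>

definition c_fps :: "complex^'m::finite \<Rightarrow> complex fps" where
  "c_fps w = (\<Sum>j\<in>UNIV. 1 - fps_exp (- (w $ j)))"

definition rot :: "real^'m::finite \<Rightarrow> real^'m \<Rightarrow> complex^'m" where
  "rot \<rho> \<theta> = (\<chi> j. of_real (\<rho> $ j) * cis (\<theta> $ j))"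

text \<open>Each of the k factors is a sum of p terms, the constant p - 1 and p - 1 negated
  exponentials. Expanding the product indexes it by the label functions \<phi> of
  \<open>card_onto_colorings\<close>, so that both can be compared label by label.\<close>

lemma c_fps_power_nth:
  fixes w :: "complex^'m::finite"
  shows "fps_nth (c_fps w ^ k) M =
    (\<Sum>\<phi>\<in>{..<k} \<rightarrow>\<^sub>E (UNIV :: 'm option set). (\<Prod>a<k. case \<phi> a of None \<Rightarrow> of_nat CARD('m) | Some j \<Rightarrow> - 1) *
       (- (\<Sum>j\<in>UNIV. of_nat (card {a. a < k \<and> \<phi> a = Some j}) * w $ j)) ^ M / fact M)"
proof -
  let ?t = "\<lambda>v. case v of None \<Rightarrow> fps_const (of_nat CARD('m)) | Some j \<Rightarrow> - fps_exp (- (w $ j))"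
  let ?wt = "\<lambda>v::'m option. case v of None \<Rightarrow> of_nat CARD('m) | Some j \<Rightarrow> (- 1 :: complex)"
  let ?e = "\<lambda>v. case v of None \<Rightarrow> 0 | Some j \<Rightarrow> - (w $ j)"
  have c: "c_fps w = (\<Sum>v\<in>UNIV. ?t v)"
    by (simp add: c_fps_def UNIV_option_conv sum.reindex sum_subtractf sum_negf fps_of_nat)
  have pr: "(\<Prod>a<k. ?t (\<phi> a)) = fps_const (\<Prod>a<k. ?wt (\<phi> a)) * fps_exp (\<Sum>a<k. ?e (\<phi> a))" for \<phi>
  proof (induction k)
    case (Suc k)
    have "?t (\<phi> k) = fps_const (?wt (\<phi> k)) * fps_exp (?e (\<phi> k))"
      by (cases "\<phi> k") (auto simp: fps_const_neg[symmetric] simp del: fps_const_neg)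
    then show ?case using Suc
      by (simp add: fps_exp_add_mult mult_ac fps_const_mult[symmetric] del: fps_const_mult)
  qed simp
  have e: "(\<Sum>a<k. ?e (\<phi> a)) = - (\<Sum>j\<in>UNIV. of_nat (card {a. a < k \<and> \<phi> a = Some j}) * w $ j)" for \<phi>
  proof -
    have "(\<Sum>a<k. ?e (\<phi> a)) = (\<Sum>a<k. \<Sum>j\<in>UNIV. if \<phi> a = Some j then - (w $ j) else 0)"
      by (intro sum.cong refl) (auto split: option.split)
    also have "\<dots> = (\<Sum>j\<in>UNIV. \<Sum>a<k. if \<phi> a = Some j then - (w $ j) else 0)" by (rule sum.swap)
    also have "\<dots> = (\<Sum>j\<in>UNIV. - (of_nat (card {a. a < k \<and> \<phi> a = Some j}) * w $ j))"
      by (intro sum.cong refl) (simp add: sum.If_cases Int_def)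
    finally show ?thesis by (simp add: sum_negf)
  qed
  have "c_fps w ^ k = (\<Prod>a<k. \<Sum>v\<in>UNIV. ?t v)" by (simp add: c)
  also have "\<dots> = (\<Sum>\<phi>\<in>{..<k} \<rightarrow>\<^sub>E UNIV. \<Prod>a<k. ?t (\<phi> a))" by (rule prod_sum_PiE) auto
  finally show ?thesis by (simp add: pr e fps_sum_nth)
qed

lemma continuous_on_c_fps_nth [continuous_intros]:
  "continuous_on S (\<lambda>w. fps_nth (c_fps w ^ k) M)"
  unfolding c_fps_power_nth by (intro continuous_intros) auto

lemma continuous_on_rot [continuous_intros]: "continuous_on S (rot \<rho>)"
  unfolding rot_def[abs_def] by (intro continuous_intros)

text \<open>For fixed labels \<phi> the coefficient is the M-th power of a linear form in w, and the
  phase extracts from it the term of \<phi> in \<open>card_onto_colorings\<close>. The sign arises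
  because onto colourings are generated by (sum of (e^(y_j) - 1))^k, with y = -w. The coefficient is
  homogeneous of degree M, so it vanishes against the phase in every other degree.\<close>

lemma set_integral_c_fps_power_nth:
  fixes mu :: "'m::finite \<Rightarrow> nat" and \<rho> :: "real^'m"
  shows "(LINT \<theta>:torus_box|lborel. phase (\<lambda>j. int (mu j)) \<theta> * fps_nth (c_fps (rot \<rho> \<theta>) ^ k) M) =
    (if M = (\<Sum>j\<in>UNIV. mu j) then (2 * of_real pi) ^ CARD('m) * (\<Prod>j\<in>UNIV. of_real (\<rho> $ j) ^ mu j / fact (mu j)) *
      ((-1) ^ (k + M) * of_nat (card (onto_colorings mu {..<k}))) else 0)"
proof -
  let ?\<Phi> = "{..<k} \<rightarrow>\<^sub>E (UNIV :: 'm option set)"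
  let ?n = "\<lambda>\<phi> j. card {a. a < k \<and> \<phi> a = Some j}"
  let ?w = "\<lambda>\<phi>. (\<Prod>a<k. case \<phi> a of None \<Rightarrow> of_nat CARD('m) | Some j \<Rightarrow> (- 1 :: complex))"
  have w: "?w \<phi> = (-1) ^ k * of_real (\<Prod>a<k. case \<phi> a of None \<Rightarrow> - real CARD('m) | Some (j::'m) \<Rightarrow> 1)" for \<phi>
    by (induction k) (auto split: option.split)
  let ?S = "\<lambda>\<phi> (\<theta>::real^'m). \<Sum>j\<in>UNIV. (of_nat (?n \<phi> j) * of_real (\<rho> $ j)) * cis (\<theta> $ j)"
  let ?ph = "phase (\<lambda>j. int (mu j))"
  have "(LINT \<theta>:torus_box|lborel. ?ph \<theta> * fps_nth (c_fps (rot \<rho> \<theta>) ^ k) M) =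
    (LINT \<theta>:torus_box|lborel. \<Sum>\<phi>\<in>?\<Phi>. ?w \<phi> * (-1) ^ M / fact M * (?ph \<theta> * ?S \<phi> \<theta> ^ M))"
    unfolding c_fps_power_nth rot_def
    by (rule arg_cong[where f = "set_lebesgue_integral lborel torus_box"])
       (auto simp: fun_eq_iff sum_distrib_left mult_ac power_minus[of "sum _ _"] intro!: sum.cong)
  also have "\<dots> = (\<Sum>\<phi>\<in>?\<Phi>. ?w \<phi> * (-1) ^ M / fact M * (LINT \<theta>:torus_box|lborel. ?ph \<theta> * ?S \<phi> \<theta> ^ M))"
    by (subst set_integral_sum_mult) (auto intro!: continuous_intros)
  also have "\<dots> = (if M = (\<Sum>j\<in>UNIV. mu j) then (\<Sum>\<phi>\<in>?\<Phi>. ?w \<phi> * (-1) ^ M / fact M * ((2 * of_real pi) ^ CARD('m) * fact M *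
      (\<Prod>j\<in>UNIV. (of_nat (?n \<phi> j) * of_real (\<rho> $ j)) ^ mu j / fact (mu j)))) else 0)"
    unfolding set_integral_phase_power by (auto simp: of_nat_sum[symmetric] simp del: of_nat_sum)
  also have "(\<Sum>\<phi>\<in>?\<Phi>. ?w \<phi> * (-1) ^ M / fact M * ((2 * of_real pi) ^ CARD('m) * fact M *
      (\<Prod>j\<in>UNIV. (of_nat (?n \<phi> j) * of_real (\<rho> $ j)) ^ mu j / fact (mu j)))) =
     (2 * of_real pi) ^ CARD('m) * (\<Prod>j\<in>UNIV. of_real (\<rho> $ j) ^ mu j / fact (mu j)) *
      ((-1) ^ (k + M) * of_real (real (card (onto_colorings mu {..<k}))))"
    unfolding card_onto_colorings of_real_sum sum_distrib_left w
    by (intro sum.cong refl) (simp add: power_add prod.distrib power_mult_distrib prod_dividef mult_ac)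
  finally show ?thesis by simp
qed

text \<open>The coefficient of \<zeta>^M z^n in F(\<zeta> w, z)^(-s), obtained from F = e^(-z) (1 -
  e^z c) by the binomial series. The sum may stop at M: c has no constant term in \<zeta>, so c^k
  starts in degree k.\<close>

definition x_coeff :: "real \<Rightarrow> nat \<Rightarrow> nat \<Rightarrow> complex^'m::finite \<Rightarrow> complex" where
  "x_coeff s n M w =
     (\<Sum>k\<le>M. of_real (pochhammer s k / fact k * ((s + real k) ^ n / fact n)) * fps_nth (c_fps w ^ k) M)"

lemma continuous_on_x_coeff [continuous_intros]: "continuous_on S (x_coeff s n M)"
  unfolding x_coeff_def[abs_def] by (intro continuous_intros)

text \<open>Reciprocity at -s: \<open>- s gchoose k\<close> is (-1)^k
  \<open>pochhammer s k / fact k\<close>, and (-s - k)^n is (-1)^n (s + k)^n. The signs combine with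
  that of the onto colourings to (-1)^N, and the sums over k match term by term.\<close>

lemma set_integral_x_coeff:
  fixes l :: "'m::finite option \<Rightarrow> nat" and \<rho> :: "real^'m"
  defines "mu \<equiv> \<lambda>j. l (Some j)"
  shows "(LINT \<theta>:torus_box|lborel. phase (\<lambda>j. int (mu j)) \<theta> * x_coeff s (l None) M (rot \<rho> \<theta>)) =
    (if M = (\<Sum>j\<in>UNIV. mu j) then of_real ((2 * pi) ^ CARD('m) * (\<Prod>j\<in>UNIV. \<rho> $ j ^ mu j) / (\<Prod>i\<in>UNIV. fact (l i)) *
      ((-1) ^ (\<Sum>i\<in>UNIV. l i) * poly (chromatic_poly (multipartite_verts l) (multipartite_edges l)) (- s))) else 0)"
proof -
  let ?n = "l None"
  let ?ph = "phase (\<lambda>j. int (mu j))"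
  let ?c = "\<lambda>k. of_real (pochhammer s k / fact k * ((s + real k) ^ ?n / fact ?n)) :: complex"
  have "(LINT \<theta>:torus_box|lborel. ?ph \<theta> * x_coeff s ?n M (rot \<rho> \<theta>)) =
    (LINT \<theta>:torus_box|lborel. \<Sum>k\<le>M. ?c k * (?ph \<theta> * fps_nth (c_fps (rot \<rho> \<theta>) ^ k) M))"
    unfolding x_coeff_def
    by (rule arg_cong[where f = "set_lebesgue_integral lborel torus_box"])
       (auto simp: fun_eq_iff sum_distrib_left mult_ac)
  also have "\<dots> = (\<Sum>k\<le>M. ?c k * (LINT \<theta>:torus_box|lborel. ?ph \<theta> * fps_nth (c_fps (rot \<rho> \<theta>) ^ k) M))"
    by (subst set_integral_sum_mult)
       (auto intro!: continuous_intros continuous_on_compose2[OF continuous_on_c_fps_nth continuous_on_rot])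
  also have "\<dots> = (if M = (\<Sum>j\<in>UNIV. mu j) then of_real ((2 * pi) ^ CARD('m) * (\<Prod>j\<in>UNIV. \<rho> $ j ^ mu j) / (\<Prod>i\<in>UNIV. fact (l i)) *
      ((-1) ^ (\<Sum>i\<in>UNIV. l i) * poly (chromatic_poly (multipartite_verts l) (multipartite_edges l)) (- s))) else 0)"
  proof (cases "M = (\<Sum>j\<in>UNIV. mu j)")
    case True
    have pr: "(\<Prod>i\<in>UNIV. fact (l i)) = fact ?n * (\<Prod>j\<in>UNIV. fact (mu j) :: real)"
      by (simp add: UNIV_option_conv prod.reindex mu_def)
    have su: "(\<Sum>i\<in>UNIV. l i) = ?n + M"
      using True by (simp add: UNIV_option_conv sum.reindex mu_def)
    have summand: "pochhammer s k / fact k * ((s + real k) ^ ?n / fact ?n) * ((2 * pi) ^ CARD('m) *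
        (\<Prod>j\<in>UNIV. \<rho> $ j ^ mu j / fact (mu j)) * ((-1) ^ (k + M) * real (card (onto_colorings mu {..<k})))) =
      (2 * pi) ^ CARD('m) * (\<Prod>j\<in>UNIV. \<rho> $ j ^ mu j) / (fact ?n * (\<Prod>j\<in>UNIV. fact (mu j))) *
      ((-1) ^ (?n + M) * ((- s gchoose k) * (- s - real k) ^ ?n * real (card (onto_colorings mu {..<k}))))" for k
    proof -
      have "(- s - real k) ^ ?n = (-1) ^ ?n * (s + real k) ^ ?n"
        by (subst power_mult_distrib[symmetric]) simp
      moreover have "(-1) ^ ?n * (-1) ^ ?n = (1::real)" by (simp add: power_mult_distrib[symmetric])
      ultimately show ?thesis
        by (simp add: gbinomial_pochhammer power_add prod_dividef field_simps)
    qed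
    have "(\<Sum>k\<le>M. ?c k * (LINT \<theta>:torus_box|lborel. ?ph \<theta> * fps_nth (c_fps (rot \<rho> \<theta>) ^ k) M)) =
      of_real (\<Sum>k\<le>M. pochhammer s k / fact k * ((s + real k) ^ ?n / fact ?n) * ((2 * pi) ^ CARD('m) *
        (\<Prod>j\<in>UNIV. \<rho> $ j ^ mu j / fact (mu j)) * ((-1) ^ (k + M) * real (card (onto_colorings mu {..<k})))))"
      unfolding set_integral_c_fps_power_nth using True by (simp add: mult_ac)
    also have "\<dots> = of_real ((2 * pi) ^ CARD('m) * (\<Prod>j\<in>UNIV. \<rho> $ j ^ mu j) / (fact ?n * (\<Prod>j\<in>UNIV. fact (mu j))) *
      ((-1) ^ (?n + M) * poly (chromatic_poly (multipartite_verts l) (multipartite_edges l)) (- s)))"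
      unfolding summand poly_chromatic_poly_multipartite mu_def[symmetric] True[symmetric] sum_distrib_left ..
    finally show ?thesis unfolding pr su using True by simp
  qed (simp add: set_integral_c_fps_power_nth)
  finally show ?thesis .
qed

section \<open>Coefficient bounds\<close>

definition c_fun :: "complex^'m::finite \<Rightarrow> complex" where
  "c_fun w = (\<Sum>j\<in>UNIV. 1 - exp (- (w $ j)))"

lemma c_fun_has_fps_expansion: "(\<lambda>\<zeta>. c_fun (\<zeta> *s w)) has_fps_expansion c_fps w"
proof -
  have "(\<lambda>\<zeta>. \<Sum>j\<in>UNIV. 1 - exp ((- (w $ j)) * \<zeta>)) has_fps_expansion (\<Sum>j\<in>UNIV. 1 - fps_exp (- (w $ j)))"
    by (intro fps_expansion_intros)
  then show ?thesis by (simp add: c_fun_def c_fps_def mult.commute)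
qed

lemma c_fps_nth_0: "fps_nth (c_fps w) 0 = 0"
  by (simp add: c_fps_def fps_sum_nth)

lemma c_fun_0 [simp]: "c_fun 0 = 0"
  by (simp add: c_fun_def)

lemma continuous_on_c_fun [continuous_intros]:
  "continuous_on S f \<Longrightarrow> continuous_on S (\<lambda>x. c_fun (f x))"
  unfolding c_fun_def by (intro continuous_intros)

lemma c_fun_scale_holomorphic: "(\<lambda>\<zeta>. c_fun (\<zeta> *s w)) holomorphic_on S"
  unfolding c_fun_def vector_smult_component by (intro holomorphic_intros)

text \<open>The values lie in the discrete set of multiples of 2 pi i, so a continuous function on a
  connected set cannot leave the value 0. This is the device by which two branches of a logarithm
  are identified below.\<close>

lemma continuous_exp_eq_1_imp_0:
  fixes f :: "'a::topological_space \<Rightarrow> complex"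
  assumes "connected S" "continuous_on S f" "\<And>x. x \<in> S \<Longrightarrow> exp (f x) = 1" and a: "a \<in> S" "f a = 0" and x: "x \<in> S"
  shows "f x = 0"
proof -
  have "f constant_on S"
  proof (rule continuous_discrete_range_constant[OF assms(1,2)])
    fix x assume x: "x \<in> S"
    show "\<exists>e>0. \<forall>y. y \<in> S \<and> f y \<noteq> f x \<longrightarrow> e \<le> norm (f y - f x)"
    proof (intro exI conjI allI impI)
      show "(1::real) > 0" by simp
      fix y assume y: "y \<in> S \<and> f y \<noteq> f x"
      have "exp (f y - f x) = 1" using assms(3)[OF x] assms(3)[of y] y by (simp add: exp_diff)
      then obtain n :: int where n: "Re (f y - f x) = 0" "Im (f y - f x) = of_int (2 * n) * pi"
        by (auto simp: exp_eq_1)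
      have "n \<noteq> 0" using n y by (auto simp: complex_eq_iff)
      then have "\<bar>n\<bar> \<ge> 1" by simp
      then have "\<bar>real_of_int n\<bar> \<ge> 1" by linarith
      then have "1 * 2 \<le> \<bar>real_of_int n\<bar> * pi" using pi_gt3 by (intro mult_mono) auto
      moreover have "\<bar>Im (f y - f x)\<bar> = 2 * (\<bar>real_of_int n\<bar> * pi)" using n by (simp add: abs_mult)
      ultimately have "1 \<le> \<bar>Im (f y - f x)\<bar>" by linarith
      also have "\<dots> \<le> norm (f y - f x)" by (rule abs_Im_le_cmod)
      finally show "1 \<le> norm (f y - f x)" .
    qed
  qed
  then show ?thesis using a x by (auto simp: constant_on_def)
qed

section \<open>Branches of the power along rays\<close>

text \<open>The coefficient of \<zeta>^M in F(\<zeta> w, z)^(-s), as an entire function of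
  z.\<close>

definition v_coeff :: "real \<Rightarrow> nat \<Rightarrow> complex^'m::finite \<Rightarrow> complex \<Rightarrow> complex" where
  "v_coeff s M w z =
     (\<Sum>k\<le>M. of_real (pochhammer s k / fact k) * exp (of_real (s + real k) * z) * fps_nth (c_fps w ^ k) M)"

lemma v_coeff_has_fps_expansion:
  "v_coeff s M w has_fps_expansion Abs_fps (\<lambda>n. x_coeff s n M w)"
proof -
  let ?F = "\<Sum>k\<le>M. fps_const (of_real (pochhammer s k / fact k) * fps_nth (c_fps w ^ k) M) * fps_exp (of_real (s + real k))"
  have "(\<lambda>z. \<Sum>k\<le>M. (of_real (pochhammer s k / fact k) * fps_nth (c_fps w ^ k) M) * exp (of_real (s + real k) * z))
      has_fps_expansion ?F"
    by (intro fps_expansion_intros)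
  moreover have "?F = Abs_fps (\<lambda>n. x_coeff s n M w)"
    by (auto simp: fps_eq_iff fps_sum_nth x_coeff_def intro!: sum.cong)
  ultimately show ?thesis by (simp add: v_coeff_def[abs_def] mult_ac)
qed

lemma v_coeff_holomorphic: "v_coeff s M w holomorphic_on S"
  unfolding v_coeff_def[abs_def] by (intro holomorphic_intros)

text \<open>The function 1 - e^z c(\<zeta> w) has no zero on the disc, so it has a holomorphic
  logarithm L there, and exp (s z - s L) is a branch of F(\<zeta> w, z)^(-s) even where the
  principal power would jump. The normalisation L 0 = 0 makes it agree with the binomial series near
  0, which identifies its Taylor coefficients with \<open>v_coeff\<close>. Its modulus is the same
  for every branch, since s is real.\<close>

lemma ray_log_power:
  fixes w :: "complex^'m::finite"
  assumes \<rho>: "\<rho> > 1" and nz: "\<And>\<zeta>. cmod \<zeta> < \<rho> \<Longrightarrow> exp (- z) \<noteq> c_fun (\<zeta> *s w)"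
  obtains L where "L holomorphic_on ball 0 \<rho>" "L 0 = 0"
    "\<And>\<zeta>. \<zeta> \<in> ball 0 \<rho> \<Longrightarrow> exp (L \<zeta>) = 1 - exp z * c_fun (\<zeta> *s w)"
    "\<And>M. v_coeff s M w z = (deriv ^^ M) (\<lambda>\<zeta>. exp (of_real s * z - of_real s * L \<zeta>)) 0 / fact M"
    "\<And>\<zeta>. \<zeta> \<in> ball 0 \<rho> \<Longrightarrow> cmod (exp (of_real s * z - of_real s * L \<zeta>)) = cmod (exp (- z) - c_fun (\<zeta> *s w)) powr (- s)"
proof -
  let ?f = "\<lambda>\<zeta>. 1 - exp z * c_fun (\<zeta> *s w)"
  have hf: "?f holomorphic_on S" for S by (intro holomorphic_intros c_fun_scale_holomorphic)
  have fnz: "?f \<zeta> \<noteq> 0" if "\<zeta> \<in> ball 0 \<rho>" for \<zeta>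
  proof
    assume "?f \<zeta> = 0"
    then have "exp (- z) = exp (- z) * (exp z * c_fun (\<zeta> *s w))" by simp
    also have "\<dots> = c_fun (\<zeta> *s w)" by (simp add: exp_minus)
    finally show False using nz[of \<zeta>] that by simp
  qed
  obtain L0 where L0: "L0 holomorphic_on ball 0 \<rho>" "\<And>\<zeta>. \<zeta> \<in> ball 0 \<rho> \<Longrightarrow> ?f \<zeta> = exp (L0 \<zeta>)"
    by (rule contractible_imp_holomorphic_log[OF hf, of "ball 0 \<rho>"]) (use fnz in \<open>auto intro: convex_imp_contractible\<close>)
  define L where "L = (\<lambda>\<zeta>. L0 \<zeta> - L0 0)"
  have "exp (L0 0) = 1" using L0(2)[of 0] \<rho> by simp
  then have L1: "exp (L \<zeta>) = ?f \<zeta>" if "\<zeta> \<in> ball 0 \<rho>" for \<zeta>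
    using L0(2)[OF that] by (simp add: L_def exp_diff)
  have Lh: "L holomorphic_on ball 0 \<rho>" unfolding L_def by (intro holomorphic_intros L0)
  have L00: "L 0 = 0" by (simp add: L_def)
  have Lc: "continuous_on (ball 0 \<rho>) L" by (rule holomorphic_on_imp_continuous_on[OF Lh])
  let ?G = "\<lambda>\<zeta>. exp (of_real s * z - of_real s * L \<zeta>)"
  have coeff: "v_coeff s M w z = (deriv ^^ M) ?G 0 / fact M" for M
  proof -
    have "(\<lambda>\<zeta>. - exp z * c_fun (\<zeta> *s w)) has_fps_expansion fps_const (- exp z) * c_fps w"
      by (intro fps_expansion_intros c_fun_has_fps_expansion)
    from has_fps_expansion_compose[OF has_fps_expansion_binomial_complex[of "- of_real s"] this]
    have 1: "(\<lambda>\<zeta>. (1 + - exp z * c_fun (\<zeta> *s w)) powr (- of_real s)) has_fps_expansion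
        (fps_binomial (- of_real s) oo (fps_const (- exp z) * c_fps w))"
      by (simp add: c_fps_nth_0 o_def)
    \<comment> \<open>Close to \<zeta> = 0 the imaginary part of L is below pi in modulus, so L is
      the principal logarithm and the branch is the principal power.\<close>
    have 2: "eventually (\<lambda>\<zeta>. (1 + - exp z * c_fun (\<zeta> *s w)) powr (- of_real s) = exp (- of_real s * L \<zeta>)) (nhds 0)"
    proof -
      have "eventually (\<lambda>\<zeta>. \<bar>Im (L \<zeta>)\<bar> < pi) (nhds 0)"
      proof -
        have "isCont L 0" using Lc \<rho> by (simp add: continuous_on_eq_continuous_at)
        then have "isCont (\<lambda>\<zeta>. \<bar>Im (L \<zeta>)\<bar>) 0" by (intro continuous_rabs isCont_Im)
        then have "((\<lambda>\<zeta>. \<bar>Im (L \<zeta>)\<bar>) \<longlongrightarrow> 0) (nhds 0)"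
          using L00 tendsto_at_iff_tendsto_nhds[of "\<lambda>\<zeta>. \<bar>Im (L \<zeta>)\<bar>" 0] by (simp add: isCont_def)
        then show ?thesis by (rule order_tendstoD) simp
      qed
      moreover have "eventually (\<lambda>\<zeta>. \<zeta> \<in> ball 0 \<rho>) (nhds 0)"
        using \<rho> by (intro eventually_nhds_in_open) auto
      ultimately show ?thesis
      proof eventually_elim
        case (elim \<zeta>)
        have "Ln (?f \<zeta>) = L \<zeta>" unfolding L1[OF elim(2), symmetric] using elim(1) by (intro Ln_exp) auto
        then show ?case using fnz[OF elim(2)] by (simp add: powr_def)
      qed
    qed
    have 3: "(\<lambda>\<zeta>. exp (- of_real s * L \<zeta>)) has_fps_expansion (fps_binomial (- of_real s) oo (fps_const (- exp z) * c_fps w))"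
      using has_fps_expansion_cong[OF 2 refl] 1 by blast
    have "(\<lambda>\<zeta>. exp (of_real s * z) * exp (- of_real s * L \<zeta>)) has_fps_expansion
        (fps_const (exp (of_real s * z)) * (fps_binomial (- of_real s) oo (fps_const (- exp z) * c_fps w)))"
      by (intro fps_expansion_intros 3)
    moreover have "exp (of_real s * z) * exp (- of_real s * L \<zeta>) = ?G \<zeta>" for \<zeta>
      by (simp add: exp_diff exp_minus field_simps)
    ultimately have "?G has_fps_expansion
        (fps_const (exp (of_real s * z)) * (fps_binomial (- of_real s) oo (fps_const (- exp z) * c_fps w)))" by simp
    from fps_nth_fps_expansion[OF this, of M]
    have "(deriv ^^ M) ?G 0 / fact M = exp (of_real s * z) *
        (\<Sum>k\<le>M. (- of_real s gchoose k) * fps_nth ((fps_const (- exp z) * c_fps w) ^ k) M)"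
      by (simp add: fps_compose_nth atLeast0AtMost)
    also have "\<dots> = v_coeff s M w z"
      unfolding v_coeff_def sum_distrib_left
    proof (intro sum.cong refl)
      fix k
      have "(fps_const (- exp z) * c_fps w) ^ k = fps_const ((- exp z) ^ k) * c_fps w ^ k"
        by (simp add: power_mult_distrib fps_const_power)
      moreover have "(- exp z) ^ k = (-1) ^ k * exp (of_nat k * z)"
        by (subst power_minus) (simp add: exp_of_nat_mult)
      moreover have "(- of_real s gchoose k) = (-1) ^ k * (of_real (pochhammer s k / fact k) :: complex)"
        by (simp add: gbinomial_pochhammer pochhammer_of_real)
      moreover have "exp (of_real s * z) * exp (of_nat k * z) = exp (of_real (s + real k) * z)"
        by (simp add: exp_add[symmetric] algebra_simps)
      moreover have "(-1) ^ k * (-1) ^ k = (1::complex)" by (simp add: power_mult_distrib[symmetric])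
      ultimately show "exp (of_real s * z) * ((- of_real s gchoose k) * fps_nth ((fps_const (- exp z) * c_fps w) ^ k) M) =
        of_real (pochhammer s k / fact k) * exp (of_real (s + real k) * z) * fps_nth (c_fps w ^ k) M"
        by (simp add: mult_ac)
    qed
    finally show ?thesis ..
  qed
  have norm: "cmod (?G \<zeta>) = cmod (exp (- z) - c_fun (\<zeta> *s w)) powr (- s)" if \<zeta>: "\<zeta> \<in> ball 0 \<rho>" for \<zeta>
  proof -
    have "exp (- z) - c_fun (\<zeta> *s w) = exp (- z) * ?f \<zeta>" by (simp add: algebra_simps exp_minus)
    also have "\<dots> = exp (L \<zeta> - z)" using L1[OF \<zeta>] by (simp add: exp_diff exp_minus field_simps)
    finally have "cmod (exp (- z) - c_fun (\<zeta> *s w)) powr (- s) = exp (Re (L \<zeta> - z)) powr (- s)" by simp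
    also have "\<dots> = exp (- s * Re (L \<zeta> - z))" by (simp add: powr_def)
    also have "\<dots> = cmod (?G \<zeta>)" by (simp add: algebra_simps)
    finally show ?thesis ..
  qed
  show thesis by (rule that[OF Lh L00 L1 coeff norm])
qed

lemma power_neg_antimono: "0 < b \<Longrightarrow> b \<le> x \<Longrightarrow> 0 < s \<Longrightarrow> x powr (- s) \<le> b powr (- s)" for b x s :: real
  by (rule powr_mono2') auto

text \<open>Cauchy's inequality on the circle of radius \<rho>; the larger radius \<rho>' makes the
  branch holomorphic beyond that circle. Since -s < 0, a lower bound for |F| is an upper bound for
  the branch.\<close>

lemma v_coeff_bound:
  fixes w :: "complex^'m::finite"
  assumes s: "s > 0" and \<rho>: "\<rho>' > \<rho>" "\<rho> > 1" and b: "b > 0"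
    and nz: "\<And>\<zeta>. cmod \<zeta> < \<rho>' \<Longrightarrow> exp (- z) \<noteq> c_fun (\<zeta> *s w)"
    and lb: "\<And>\<zeta>. cmod \<zeta> \<le> \<rho> \<Longrightarrow> b \<le> cmod (exp (- z) - c_fun (\<zeta> *s w))"
  shows "cmod (v_coeff s M w z) \<le> b powr (- s) / \<rho> ^ M"
proof -
  have "\<rho>' > 1" using \<rho> by simp
  obtain L where L: "L holomorphic_on ball 0 \<rho>'"
    "\<And>M. v_coeff s M w z = (deriv ^^ M) (\<lambda>\<zeta>. exp (of_real s * z - of_real s * L \<zeta>)) 0 / fact M"
    "\<And>\<zeta>. \<zeta> \<in> ball 0 \<rho>' \<Longrightarrow> cmod (exp (of_real s * z - of_real s * L \<zeta>)) = cmod (exp (- z) - c_fun (\<zeta> *s w)) powr (- s)"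
    by (rule ray_log_power[OF \<open>\<rho>' > 1\<close> nz, where s = s]) auto
  let ?G = "\<lambda>\<zeta>. exp (of_real s * z - of_real s * L \<zeta>)"
  have hol: "?G holomorphic_on ball 0 \<rho>'" by (intro holomorphic_intros L)
  have "cmod ((deriv ^^ M) ?G 0) \<le> fact M * (b powr (- s)) / \<rho> ^ M"
  proof (rule Cauchy_inequality)
    show "?G holomorphic_on ball 0 \<rho>" using \<rho> by (intro holomorphic_on_subset[OF hol]) auto
    show "continuous_on (cball 0 \<rho>) ?G"
      using \<rho> by (intro holomorphic_on_imp_continuous_on holomorphic_on_subset[OF hol]) auto
    show "0 < \<rho>" using \<rho> by simp
    fix \<zeta> assume "cmod (0 - \<zeta>) = \<rho>"
    then have \<zeta>: "cmod \<zeta> = \<rho>" by simp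
    then show "cmod (?G \<zeta>) \<le> b powr (- s)"
      using L(3)[of \<zeta>] \<rho> lb[of \<zeta>] b s by (simp add: power_neg_antimono)
  qed
  then show ?thesis unfolding L(2) by (simp add: norm_divide field_simps)
qed

text \<open>The zeros with |\<zeta>| \<le> 2 form a compact set, on which |\<zeta>| attains a
  minimum; by hypothesis it exceeds 1. The number 2 serves only to make the set compact.\<close>

lemma nonvanishing_beyond_unit_disc:
  fixes K :: "(complex^'m::finite) set"
  assumes K: "compact K"
    and nz: "\<And>w \<zeta> z. w \<in> K \<Longrightarrow> cmod \<zeta> \<le> 1 \<Longrightarrow> cmod z \<le> R \<Longrightarrow> exp (- z) \<noteq> c_fun (\<zeta> *s w)"
  obtains \<rho> where "\<rho> > 1"
    "\<And>w \<zeta> z. w \<in> K \<Longrightarrow> cmod \<zeta> < \<rho> \<Longrightarrow> cmod z \<le> R \<Longrightarrow> exp (- z) \<noteq> c_fun (\<zeta> *s w)"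
proof -
  let ?g = "\<lambda>(w, \<zeta>, z). exp (- z) - c_fun (\<zeta> *s w)"
  let ?T = "K \<times> cball (0::complex) 2 \<times> cball (0::complex) R"
  define Z where "Z = {x \<in> ?T. ?g x = 0}"
  have cont: "continuous_on ?T ?g"
    unfolding case_prod_unfold by (intro continuous_intros) (auto simp: vector_scalar_mult_def intro!: continuous_intros)
  have T: "compact ?T" using K by (intro compact_Times) auto
  have "closedin (top_of_set ?T) Z" unfolding Z_def by (rule continuous_closedin_preimage_constant[OF cont])
  then have Zc: "compact Z" using T by (rule closedin_compact[rotated])
  show thesis
  proof (cases "Z = {}")
    case True
    show thesis
    proof (rule that[of 2])
      fix w \<zeta> z assume "w \<in> K" "cmod \<zeta> < 2" "cmod z \<le> R"
      then have "(w, \<zeta>, z) \<in> ?T" by auto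
      then show "exp (- z) \<noteq> c_fun (\<zeta> *s w)" using True by (auto simp: Z_def)
    qed simp
  next
    case False
    have "continuous_on Z (\<lambda>x. cmod (fst (snd x)))" by (intro continuous_intros)
    from continuous_attains_inf[OF Zc False this]
    obtain x0 where x0: "x0 \<in> Z" "\<And>x. x \<in> Z \<Longrightarrow> cmod (fst (snd x0)) \<le> cmod (fst (snd x))" by blast
    obtain w0 \<zeta>0 z0 where x0e: "x0 = (w0, \<zeta>0, z0)" by (cases x0)
    have "cmod \<zeta>0 > 1" using x0(1) nz[of w0 \<zeta>0 z0] by (auto simp: Z_def x0e not_less[symmetric])
    show thesis
    proof (rule that[of "min 2 (cmod \<zeta>0)"])
      show "min 2 (cmod \<zeta>0) > 1" using \<open>cmod \<zeta>0 > 1\<close> by simp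
      fix w \<zeta> z assume a: "w \<in> K" "cmod \<zeta> < min 2 (cmod \<zeta>0)" "cmod z \<le> R"
      show "exp (- z) \<noteq> c_fun (\<zeta> *s w)"
      proof
        assume "exp (- z) = c_fun (\<zeta> *s w)"
        then have "(w, \<zeta>, z) \<in> Z" using a by (auto simp: Z_def)
        from x0(2)[OF this] show False using a by (simp add: x0e)
      qed
    qed
  qed
qed

text \<open>Cauchy's inequality in \<zeta> on a circle of radius above 1, then in z on the circle of
  radius R. The gain \<rho>^M is what makes the sum over all M converge.\<close>

lemma x_coeff_bound:
  fixes K :: "(complex^'m::finite) set"
  assumes s: "s > 0" and K: "compact K" and R: "R > 0"
    and nz: "\<And>w \<zeta> z. w \<in> K \<Longrightarrow> cmod \<zeta> \<le> 1 \<Longrightarrow> cmod z \<le> R \<Longrightarrow> exp (- z) \<noteq> c_fun (\<zeta> *s w)"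
  obtains C \<rho> where "C \<ge> 0" "\<rho> > 1"
    "\<And>w n M. w \<in> K \<Longrightarrow> cmod (x_coeff s n M w) \<le> C / (\<rho> ^ M * R ^ n)"
    "\<And>w \<zeta> z. w \<in> K \<Longrightarrow> cmod \<zeta> < \<rho> \<Longrightarrow> cmod z \<le> R \<Longrightarrow> exp (- z) \<noteq> c_fun (\<zeta> *s w)"
proof -
  obtain \<rho>' where \<rho>': "\<rho>' > 1"
    and nz': "\<And>w \<zeta> z. w \<in> K \<Longrightarrow> cmod \<zeta> < \<rho>' \<Longrightarrow> cmod z \<le> R \<Longrightarrow> exp (- z) \<noteq> c_fun (\<zeta> *s w)"
    by (rule nonvanishing_beyond_unit_disc[OF K nz]) auto
  \<comment> \<open>A radius strictly between 1 and \<rho>', so that the closed disc is still free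
    of zeros and |F| is bounded below on it.\<close>
  define \<rho> where "\<rho> = (1 + \<rho>') / 2"
  have \<rho>: "\<rho> > 1" "\<rho> < \<rho>'" using \<rho>' by (auto simp: \<rho>_def)
  let ?g = "\<lambda>(w, \<zeta>, z). cmod (exp (- z) - c_fun (\<zeta> *s w))"
  let ?T = "K \<times> cball (0::complex) \<rho> \<times> cball (0::complex) R"
  have cont: "continuous_on ?T ?g"
    unfolding case_prod_unfold by (intro continuous_intros) (auto simp: vector_scalar_mult_def intro!: continuous_intros)
  have T: "compact ?T" using K by (intro compact_Times) auto
  have "\<exists>b>0. \<forall>x\<in>?T. b \<le> ?g x"
  proof (cases "?T = {}")
    case True
    then show ?thesis by (intro exI[of _ 1]) auto
  next
    case False
    from continuous_attains_inf[OF T False cont] obtain x0 where x0: "x0 \<in> ?T" "\<forall>x\<in>?T. ?g x0 \<le> ?g x" by blast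
    have "?g x0 > 0" using x0(1) nz' \<rho> by force
    then show ?thesis using x0 by blast
  qed
  then obtain b where b: "b > 0" "\<And>x. x \<in> ?T \<Longrightarrow> b \<le> ?g x" by blast
  define C where "C = b powr (- s)"
  have v: "cmod (v_coeff s M w z) \<le> C / \<rho> ^ M" if "w \<in> K" "cmod z \<le> R" for w z M
    unfolding C_def using that b(2)[of "(w, _, z)"]
    by (intro v_coeff_bound[OF s \<rho>(2,1) b(1)] nz') auto
  have x: "cmod (x_coeff s n M w) \<le> C / (\<rho> ^ M * R ^ n)" if w: "w \<in> K" for w n M
  proof -
    have "cmod ((deriv ^^ n) (v_coeff s M w) 0) \<le> fact n * (C / \<rho> ^ M) / R ^ n"
      by (rule Cauchy_inequality)
         (auto intro!: v_coeff_holomorphic holomorphic_on_imp_continuous_on R v[OF w])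
    then have "cmod ((deriv ^^ n) (v_coeff s M w) 0) / fact n \<le> fact n * (C / \<rho> ^ M) / R ^ n / fact n"
      by (rule divide_right_mono) simp
    moreover have "x_coeff s n M w = (deriv ^^ n) (v_coeff s M w) 0 / fact n"
      using fps_nth_fps_expansion[OF v_coeff_has_fps_expansion, of s M w n] by simp
    ultimately show ?thesis by (simp add: norm_divide)
  qed
  show thesis
  proof (rule that[of C \<rho>])
    show "C \<ge> 0" by (simp add: C_def)
    show "\<And>w \<zeta> z. w \<in> K \<Longrightarrow> cmod \<zeta> < \<rho> \<Longrightarrow> cmod z \<le> R \<Longrightarrow> exp (- z) \<noteq> c_fun (\<zeta> *s w)"
      using nz' \<rho> by force
  qed (use \<rho> x in auto)
qed

section \<open>Summation over the degree\<close>

text \<open>The expansion in \<zeta> evaluated at \<zeta> = 1: the coefficient of z^n in the branch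
  of F(w, z)^(-s) that is continued from the origin along the ray through w.\<close>

definition X_coeff :: "real \<Rightarrow> nat \<Rightarrow> complex^'m::finite \<Rightarrow> complex" where
  "X_coeff s n w = (\<Sum>M. x_coeff s n M w)"

lemma geometric_summable: "\<rho> > 1 \<Longrightarrow> summable (\<lambda>M. C / (\<rho> ^ M * D))" for \<rho> C D :: real
proof -
  assume "\<rho> > 1"
  then have "summable (\<lambda>M. (C / D) * (1 / \<rho>) ^ M)" by (intro summable_mult summable_geometric) auto
  then show ?thesis by (simp add: power_divide mult.commute)
qed

lemma X_coeff_bound:
  assumes C: "C \<ge> 0" and \<rho>: "\<rho> > 1" and R: "R > 0" and x: "\<And>M. cmod (x_coeff s n M w) \<le> C / (\<rho> ^ M * R ^ n)"
  shows "summable (\<lambda>M. x_coeff s n M w)" "cmod (X_coeff s n w) \<le> (\<Sum>M. C / \<rho> ^ M) / R ^ n"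
proof -
  have S: "summable (\<lambda>M. C / (\<rho> ^ M * R ^ n))" by (rule geometric_summable[OF \<rho>])
  have S1: "summable (\<lambda>M. C / \<rho> ^ M)" using geometric_summable[OF \<rho>, of C 1] by simp
  show "summable (\<lambda>M. x_coeff s n M w)" by (rule summable_comparison_test'[OF S]) (use x in auto)
  have "cmod (X_coeff s n w) \<le> (\<Sum>M. C / (\<rho> ^ M * R ^ n))"
    unfolding X_coeff_def by (rule norm_suminf_le[OF x S])
  also have "\<dots> = (\<Sum>M. C / \<rho> ^ M) / R ^ n"
    using suminf_divide[OF S1, of "R ^ n"] by simp
  finally show "cmod (X_coeff s n w) \<le> (\<Sum>M. C / \<rho> ^ M) / R ^ n" .
qed

lemma v_coeff_sums_x_coeff: "(\<lambda>n. x_coeff s n M w * z ^ n) sums v_coeff s M w z"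
proof -
  have "(\<lambda>n. (deriv ^^ n) (v_coeff s M w) 0 / fact n * (z - 0) ^ n) sums v_coeff s M w z"
    by (rule holomorphic_power_series[where r = "cmod z + 1"]) (auto intro: v_coeff_holomorphic)
  moreover have "x_coeff s n M w = (deriv ^^ n) (v_coeff s M w) 0 / fact n" for n
    using fps_nth_fps_expansion[OF v_coeff_has_fps_expansion, of s M w n] by simp
  ultimately show ?thesis by simp
qed

text \<open>The geometric majorant makes the double family absolutely summable, so both orders of
  summation give the same value.\<close>

lemma double_series_swap:
  fixes f :: "nat \<Rightarrow> nat \<Rightarrow> complex"
  assumes bound: "\<And>m n. cmod (f m n) \<le> C * p ^ m * q ^ n" and p: "0 \<le> p" "p < 1" and q: "0 \<le> q" "q < 1"
    and r: "\<And>m. (\<lambda>n. f m n) sums a m" and c: "\<And>n. (\<lambda>m. f m n) sums b n" and a: "a sums t"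
  shows "b sums t"
proof -
  have pq: "summable (\<lambda>m. p ^ m)" "summable (\<lambda>n. q ^ n)" using p q by (auto intro!: summable_geometric)
  have g: "(\<lambda>(m, n). C * p ^ m * q ^ n) summable_on UNIV \<times> UNIV"
  proof -
    have "(\<lambda>x. p ^ fst x * q ^ snd x) summable_on (UNIV :: nat set) \<times> (UNIV :: nat set)"
    proof (rule summable_on_SigmaI)
      fix m :: nat
      have "(\<lambda>n. q ^ n) summable_on UNIV" using pq(2) q by (simp add: summable_on_UNIV_nonneg_real_iff)
      then show "((\<lambda>n. p ^ fst (m, n) * q ^ snd (m, n)) has_sum (p ^ m * infsum (\<lambda>n. q ^ n) UNIV)) UNIV"
        by (auto intro!: has_sum_cmult_right)
    next
      have "(\<lambda>m. p ^ m) summable_on UNIV" using pq(1) p by (simp add: summable_on_UNIV_nonneg_real_iff)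
      then show "(\<lambda>m. p ^ m * infsum (\<lambda>n. q ^ n) UNIV) summable_on UNIV" by (rule summable_on_cmult_left)
    qed (use p q in auto)
    then have "(\<lambda>x. C * (p ^ fst x * q ^ snd x)) summable_on (UNIV :: nat set) \<times> (UNIV :: nat set)"
      by (rule summable_on_cmult_right)
    then show ?thesis by (simp add: case_prod_unfold mult.assoc)
  qed
  have abs: "(\<lambda>x. norm ((\<lambda>(m, n). f m n) x)) summable_on UNIV \<times> UNIV"
    by (rule Infinite_Sum.abs_summable_on_comparison_test'[OF g]) (use bound in auto)
  have row: "(\<lambda>n. f m n) summable_on UNIV" for m
  proof (rule norm_summable_imp_summable_on, rule summable_comparison_test')
    show "summable (\<lambda>n. C * p ^ m * q ^ n)" using pq by (intro summable_mult)
  qed (use bound in auto)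
  have col: "(\<lambda>m. f m n) summable_on UNIV" for n
  proof (rule norm_summable_imp_summable_on, rule summable_comparison_test')
    show "summable (\<lambda>m. C * p ^ m * q ^ n)" using pq by (intro summable_mult summable_mult2)
  qed (use bound in auto)
  have ri: "infsum (\<lambda>n. f m n) UNIV = a m" for m
    using r[of m] has_sum_imp_sums[OF has_sum_infsum[OF row[of m]]] sums_unique2 by blast
  have ci: "infsum (\<lambda>m. f m n) UNIV = b n" for n
    using c[of n] has_sum_imp_sums[OF has_sum_infsum[OF col[of n]]] sums_unique2 by blast
  have sm: "(\<lambda>(m, n). f m n) summable_on UNIV \<times> UNIV" by (rule Infinite_Sum.abs_summable_summable[OF abs])
  have sm': "(\<lambda>(n, m). f m n) summable_on UNIV \<times> UNIV"
    using sm by (subst summable_on_swap) (auto simp: case_prod_unfold)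
  have as: "a summable_on UNIV" using summable_on_Sigma_banach[OF sm] unfolding ri .
  have bs: "b summable_on UNIV" using summable_on_Sigma_banach[OF sm'] unfolding ci .
  have "infsum a UNIV = infsum b UNIV" using infsum_swap_banach[OF sm] unfolding ri ci .
  moreover have "infsum a UNIV = t"
    using a has_sum_imp_sums[OF has_sum_infsum[OF as]] sums_unique2 by blast
  ultimately show ?thesis using has_sum_imp_sums[OF has_sum_infsum[OF bs]] by simp
qed

text \<open>Summing over n first gives \<open>v_coeff\<close>, and then summing over M gives the
  branch at \<zeta> = 1, which lies inside the disc because \<rho> > 1. The logarithm L is chosen
  for each z separately; for general w it is the modulus of the sum that is known
  explicitly.\<close>

lemma X_coeff_sums:
  fixes w :: "complex^'m::finite"
  assumes C: "C \<ge> 0" and \<rho>: "\<rho> > 1" and R: "R > 0"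
    and x: "\<And>n M. cmod (x_coeff s n M w) \<le> C / (\<rho> ^ M * R ^ n)"
    and nz: "\<And>\<zeta> z. cmod \<zeta> < \<rho> \<Longrightarrow> cmod z \<le> R \<Longrightarrow> exp (- z) \<noteq> c_fun (\<zeta> *s w)"
    and z: "cmod z < R"
  obtains L where "L holomorphic_on ball 0 \<rho>" "L 0 = 0"
    "\<And>\<zeta>. \<zeta> \<in> ball 0 \<rho> \<Longrightarrow> exp (L \<zeta>) = 1 - exp z * c_fun (\<zeta> *s w)"
    "cmod (exp (of_real s * z - of_real s * L 1)) = cmod (exp (- z) - c_fun w) powr (- s)"
    "(\<lambda>n. X_coeff s n w * z ^ n) sums exp (of_real s * z - of_real s * L 1)"
proof -
  obtain L where L: "L holomorphic_on ball 0 \<rho>" "L 0 = 0"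
    "\<And>\<zeta>. \<zeta> \<in> ball 0 \<rho> \<Longrightarrow> exp (L \<zeta>) = 1 - exp z * c_fun (\<zeta> *s w)"
    "\<And>M. v_coeff s M w z = (deriv ^^ M) (\<lambda>\<zeta>. exp (of_real s * z - of_real s * L \<zeta>)) 0 / fact M"
    "\<And>\<zeta>. \<zeta> \<in> ball 0 \<rho> \<Longrightarrow> cmod (exp (of_real s * z - of_real s * L \<zeta>)) = cmod (exp (- z) - c_fun (\<zeta> *s w)) powr (- s)"
    by (rule ray_log_power[OF \<rho>, of z w s]) (use nz z in auto)
  let ?G = "\<lambda>\<zeta>. exp (of_real s * z - of_real s * L \<zeta>)"
  have "(\<lambda>M. (deriv ^^ M) ?G 0 / fact M * (1 - 0) ^ M) sums ?G 1"
    by (rule holomorphic_power_series[where r = \<rho>]) (use \<rho> in \<open>auto intro!: holomorphic_intros L\<close>)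
  then have vG: "(\<lambda>M. v_coeff s M w z) sums ?G 1" by (simp add: L(4))
  have "(\<lambda>n. X_coeff s n w * z ^ n) sums ?G 1"
  proof (rule double_series_swap[where f = "\<lambda>M n. x_coeff s n M w * z ^ n" and C = C and p = "1 / \<rho>" and q = "cmod z / R"])
    fix M n
    show "cmod (x_coeff s n M w * z ^ n) \<le> C * (1 / \<rho>) ^ M * (cmod z / R) ^ n"
      using mult_right_mono[OF x[of n M], of "cmod z ^ n"] by (simp add: norm_mult norm_power power_divide field_simps)
    show "(\<lambda>n. x_coeff s n M w * z ^ n) sums v_coeff s M w z" by (rule v_coeff_sums_x_coeff)
    show "(\<lambda>M. x_coeff s n M w * z ^ n) sums (X_coeff s n w * z ^ n)"
      unfolding X_coeff_def by (intro sums_mult2 summable_sums X_coeff_bound(1)[OF C \<rho> R x])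
  qed (use \<rho> z R vG in auto)
  then show thesis using L(5)[of 1] \<rho> by (intro that[of L] L) auto
qed

text \<open>Under the hypothesis \<open>small\<close>, 1 - e^z c(t w) stays in the right half-plane
  for t from 0 to 1. Hence the continued logarithm arrives at the principal one, and the generating
  function is an explicit principal power.\<close>

lemma X_coeff_expansion:
  fixes w :: "complex^'m::finite"
  assumes C: "C \<ge> 0" and \<rho>: "\<rho> > 1" and R: "R > 0"
    and x: "\<And>n M. cmod (x_coeff s n M w) \<le> C / (\<rho> ^ M * R ^ n)"
    and nz: "\<And>\<zeta> z. cmod \<zeta> < \<rho> \<Longrightarrow> cmod z \<le> R \<Longrightarrow> exp (- z) \<noteq> c_fun (\<zeta> *s w)"
    and small: "\<And>t z. 0 \<le> t \<Longrightarrow> t \<le> 1 \<Longrightarrow> cmod z < R \<Longrightarrow> cmod (exp z * c_fun (of_real t *s w)) < 1"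
  shows "(\<lambda>z. exp (of_real s * z) * (1 - exp z * c_fun w) powr (- of_real s)) has_fps_expansion Abs_fps (\<lambda>n. X_coeff s n w)"
proof (rule has_fps_expansionI)
  have ev: "eventually (\<lambda>z::complex. z \<in> ball 0 R) (nhds 0)" using R by (intro eventually_nhds_in_open) auto
  show "eventually (\<lambda>z. (\<lambda>n. fps_nth (Abs_fps (\<lambda>n. X_coeff s n w)) n * z ^ n) sums
      (exp (of_real s * z) * (1 - exp z * c_fun w) powr (- of_real s))) (nhds 0)"
    using ev
  proof eventually_elim
    case (elim z)
    then have z: "cmod z < R" by simp
    obtain L where L: "L holomorphic_on ball 0 \<rho>" "L 0 = 0"
      "\<And>\<zeta>. \<zeta> \<in> ball 0 \<rho> \<Longrightarrow> exp (L \<zeta>) = 1 - exp z * c_fun (\<zeta> *s w)"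
      and sums: "(\<lambda>n. X_coeff s n w * z ^ n) sums exp (of_real s * z - of_real s * L 1)"
      by (rule X_coeff_sums[OF C \<rho> R x nz z]) auto
    have "L (of_real 1) - Ln (1 - exp z * c_fun (of_real 1 *s w)) = 0"
    proof (rule continuous_exp_eq_1_imp_0[where S = "{0..1::real}" and a = 0 and
          f = "\<lambda>t. L (of_real t) - Ln (1 - exp z * c_fun (of_real t *s w))"])
      have Re: "Re (1 - exp z * c_fun (of_real t *s w)) > 0" if "t \<in> {0..1}" for t
        using small[of t z] that z complex_Re_le_cmod[of "exp z * c_fun (of_real t *s w)"] by simp
      have cL: "continuous_on {0..1} (\<lambda>t::real. L (of_real t))"
        by (rule continuous_on_compose2[OF holomorphic_on_imp_continuous_on[OF L(1)]])
           (use \<rho> in \<open>auto intro!: continuous_intros\<close>)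
      show "continuous_on {0..1} (\<lambda>t. L (of_real t) - Ln (1 - exp z * c_fun (of_real t *s w)))"
      proof (intro continuous_intros cL)
        show "continuous_on {0..1} (\<lambda>t. of_real t *s w)" by (auto simp: vector_scalar_mult_def intro!: continuous_intros)
        fix t :: real assume "t \<in> {0..1}"
        then show "1 - exp z * c_fun (of_real t *s w) \<notin> \<real>\<^sub>\<le>\<^sub>0"
          using Re[of t] by (auto simp: complex_nonpos_Reals_iff)
      qed
      fix t :: real assume t: "t \<in> {0..1}"
      have "1 - exp z * c_fun (of_real t *s w) \<noteq> 0" using Re[OF t] by (metis less_irrefl zero_complex.simps(1))
      moreover have "complex_of_real t \<in> ball 0 \<rho>" using t \<rho> by auto
      ultimately show "exp (L (of_real t) - Ln (1 - exp z * c_fun (of_real t *s w))) = 1"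
        using L(3)[of "of_real t"] by (simp add: exp_diff)
    qed (use L(2) in auto)
    then have L1: "L 1 = Ln (1 - exp z * c_fun w)" by simp
    have "1 - exp z * c_fun w \<noteq> 0" using small[of 1 z] z by auto
    then have "exp (of_real s * z - of_real s * L 1) = exp (of_real s * z) * (1 - exp z * c_fun w) powr (- of_real s)"
      by (simp add: L1 powr_def exp_diff exp_minus field_simps)
    then show ?case using sums by simp
  qed
qed

text \<open>
  Outside a neighbourhood of the critical point the sum over \<open>M\<close> and a branch of the power
  on the larger disc have the same modulus near \<open>0\<close>, so they differ by a unimodular constant.
\<close>

lemma X_coeff_far_bound:
  fixes w :: "complex^'m::finite"
  assumes C: "C \<ge> 0" and \<rho>: "\<rho> > 1" and R0: "R0 > 0" and s: "s > 0"
    and x: "\<And>n M. cmod (x_coeff s n M w) \<le> C / (\<rho> ^ M * R0 ^ n)"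
    and nz: "\<And>\<zeta> z. cmod \<zeta> < \<rho> \<Longrightarrow> cmod z \<le> R0 \<Longrightarrow> exp (- z) \<noteq> c_fun (\<zeta> *s w)"
    and R: "R0 \<le> R" "R < R1" and far: "\<And>z. cmod z < R1 \<Longrightarrow> exp (- z) \<noteq> c_fun w"
    and b: "b > 0" "\<And>z. cmod z \<le> R \<Longrightarrow> b \<le> cmod (exp (- z) - c_fun w)"
  shows "cmod (X_coeff s n w) \<le> b powr (- s) / R ^ n"
proof -
  let ?g = "\<lambda>z. exp (- z) - c_fun w"
  have Rp: "R > 0" "R1 > 0" using R R0 by auto
  obtain l where l: "l holomorphic_on ball 0 R1" "\<And>z. z \<in> ball 0 R1 \<Longrightarrow> ?g z = exp (l z)"
    by (rule contractible_imp_holomorphic_log[of ?g "ball 0 R1"])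
       (use far in \<open>auto intro!: convex_imp_contractible holomorphic_intros\<close>)
  define E where "E = (\<lambda>z. exp (- of_real s * l z))"
  have E: "E holomorphic_on ball 0 R1" unfolding E_def by (intro holomorphic_intros l)
  have normE: "cmod (E z) = cmod (?g z) powr (- s)" if "z \<in> ball 0 R1" for z
  proof -
    have "cmod (?g z) = exp (Re (l z))" using l(2)[OF that] by simp
    then show ?thesis by (simp add: E_def powr_def)
  qed
  define V where "V = (\<lambda>z. \<Sum>n. X_coeff s n w * z ^ n)"
  have V: "(\<lambda>n. X_coeff s n w * z ^ n) sums V z" "cmod (V z) = cmod (?g z) powr (- s)" if z: "cmod z < R0" for z
  proof -
    obtain L where L: "cmod (exp (of_real s * z - of_real s * L 1)) = cmod (?g z) powr (- s)"
      "(\<lambda>n. X_coeff s n w * z ^ n) sums exp (of_real s * z - of_real s * L 1)"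
      by (rule X_coeff_sums[OF C \<rho> R0 x nz z]) auto
    have "V z = exp (of_real s * z - of_real s * L 1)" unfolding V_def using L(2) by (simp add: sums_iff)
    then show "(\<lambda>n. X_coeff s n w * z ^ n) sums V z" "cmod (V z) = cmod (?g z) powr (- s)" using L by auto
  qed
  have Vh: "V holomorphic_on ball 0 R0"
    by (rule power_series_holomorphic[where a = "\<lambda>n. X_coeff s n w"]) (use V(1) in auto)
  have in1: "z \<in> ball 0 R1" if "z \<in> ball 0 R0" for z :: complex using that R by auto
  have E0: "E z \<noteq> 0" for z by (simp add: E_def)
  have Qn: "cmod (V z / E z) = 1" if "z \<in> ball 0 R0" for z
  proof -
    have "cmod (V z) = cmod (E z)" using V(2)[of z] normE[OF in1[OF that]] that by simp
    then show ?thesis using E0[of z] by (simp add: norm_divide)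
  qed
  have "(\<lambda>z. V z / E z) constant_on ball 0 R0"
  proof (rule maximum_modulus_principle[where U = "ball 0 R0" and \<xi> = 0])
    show "(\<lambda>z. V z / E z) holomorphic_on ball 0 R0"
      using R by (intro holomorphic_intros Vh holomorphic_on_subset[OF E]) (auto simp: E0)
    show "\<And>z. z \<in> ball 0 R0 \<Longrightarrow> cmod (V z / E z) \<le> cmod (V 0 / E 0)" using Qn R0 by simp
  qed (use R0 in auto)
  then obtain k where k: "\<And>z. z \<in> ball 0 R0 \<Longrightarrow> V z / E z = k" by (auto simp: constant_on_def)
  have nk: "cmod k = 1" using Qn[of 0] k[of 0] R0 by simp
  have VE: "V z = k * E z" if "z \<in> ball 0 R0" for z using k[OF that] E0[of z] by (simp add: field_simps)
  have "V has_fps_expansion Abs_fps (\<lambda>n. X_coeff s n w)"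
  proof (rule has_fps_expansionI)
    have "eventually (\<lambda>z::complex. z \<in> ball 0 R0) (nhds 0)" using R0 by (intro eventually_nhds_in_open) auto
    then show "eventually (\<lambda>z. (\<lambda>n. fps_nth (Abs_fps (\<lambda>n. X_coeff s n w)) n * z ^ n) sums V z) (nhds 0)"
      by eventually_elim (use V(1) in simp)
  qed
  from fps_nth_fps_expansion[OF this, of n] have "X_coeff s n w = (deriv ^^ n) V 0 / fact n" by simp
  \<comment> \<open>The series V is controlled only for |z| < R0, but E is holomorphic on the disc
    of radius R1. Equal germs at 0 have equal derivatives, and Cauchy's inequality applied to E
    reaches the radius R.\<close>
  also have "(deriv ^^ n) V 0 = (deriv ^^ n) (\<lambda>z. k * E z) 0"
  proof (rule higher_deriv_cong_ev)
    have "eventually (\<lambda>z::complex. z \<in> ball 0 R0) (nhds 0)" using R0 by (intro eventually_nhds_in_open) auto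
    then show "eventually (\<lambda>z. V z = k * E z) (nhds 0)" by eventually_elim (rule VE)
  qed simp
  also have "cmod ((deriv ^^ n) (\<lambda>z. k * E z) 0 / fact n) \<le> fact n * b powr (- s) / R ^ n / fact n"
    unfolding norm_divide
  proof (intro divide_mono)
    show "cmod ((deriv ^^ n) (\<lambda>z. k * E z) 0) \<le> fact n * b powr (- s) / R ^ n"
    proof (rule Cauchy_inequality)
      show "(\<lambda>z. k * E z) holomorphic_on ball 0 R"
        using R by (intro holomorphic_intros holomorphic_on_subset[OF E]) auto
      show "continuous_on (cball 0 R) (\<lambda>z. k * E z)"
        using R by (intro holomorphic_on_imp_continuous_on holomorphic_intros holomorphic_on_subset[OF E]) auto
      fix z assume "cmod (0 - z) = R"
      then have z: "z \<in> ball 0 R1" "cmod z \<le> R" using R by auto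
      show "cmod (k * E z) \<le> b powr (- s)"
        using normE[OF z(1)] b(2)[OF z(2)] b(1) s nk by (simp add: norm_mult power_neg_antimono)
    qed (use Rp in auto)
  qed (use Rp in auto)
  finally show ?thesis by simp
qed

section \<open>Singularity analysis at an algebraic branch point\<close>

text \<open>The coefficient of z^n in (1 - z)^(-s).\<close>

definition bin_coeff :: "real \<Rightarrow> nat \<Rightarrow> real" where
  "bin_coeff s n = pochhammer s n / fact n"

lemma bin_coeff_asymp:
  "(\<lambda>n. bin_coeff s n * real n powr (1 - s)) \<longlonglongrightarrow> 1 / Gamma s"
proof -
  have "(\<lambda>n. ((- s) gchoose n) / ((-1)^n / exp ((- s + 1) * of_real (ln (real n))))) \<longlonglongrightarrow> inverse (Gamma (- (- s)))"
    by (rule gbinomial_asymptotic)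
  moreover have "eventually (\<lambda>n. ((- s) gchoose n) / ((-1)^n / exp ((- s + 1) * of_real (ln (real n)))) =
      bin_coeff s n * real n powr (1 - s)) sequentially"
    using eventually_gt_at_top[of 0]
  proof eventually_elim
    case (elim n)
    have "(-1) ^ n * (-1) ^ n = (1::real)" by (simp add: power_mult_distrib[symmetric])
    then show ?case using elim by (simp add: gbinomial_pochhammer bin_coeff_def powr_def field_simps)
  qed
  ultimately show ?thesis by (simp add: tendsto_cong inverse_eq_divide)
qed

text \<open>The shifted weight is positive at n = 0 as well, where \<open>0 powr (1 - s)\<close> is
  0. Convergent sequences are bounded, so this form bounds \<open>bin_coeff s n\<close> for every
  n.\<close>

lemma bin_coeff_asymp_Suc:
  "(\<lambda>n. bin_coeff s n * (real n + 1) powr (1 - s)) \<longlonglongrightarrow> 1 / Gamma s"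
proof -
  have "(\<lambda>n. ((real n + 1) / real n) powr (1 - s)) \<longlonglongrightarrow> 1" by real_asymp
  from tendsto_mult[OF bin_coeff_asymp this]
  have "(\<lambda>n. bin_coeff s n * real n powr (1 - s) * ((real n + 1) / real n) powr (1 - s)) \<longlonglongrightarrow> 1 / Gamma s" by simp
  moreover have "eventually (\<lambda>n. bin_coeff s n * real n powr (1 - s) * ((real n + 1) / real n) powr (1 - s) =
      bin_coeff s n * (real n + 1) powr (1 - s)) sequentially"
    using eventually_gt_at_top[of 0] by eventually_elim (simp add: powr_divide)
  ultimately show ?thesis by (simp add: tendsto_cong)
qed

section \<open>Local factorisation at the branch point\<close>

definition unit_quot :: "complex \<Rightarrow> complex" where
  "unit_quot u = (if u = 0 then 1 else (1 - exp (- u)) / u)"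

lemma unit_quot_holomorphic: "unit_quot holomorphic_on S"
proof -
  have d: "deriv (\<lambda>u::complex. - exp (- u)) 0 = 1"
    by (rule DERIV_imp_deriv) (auto intro!: derivative_eq_intros)
  have "(\<lambda>z. if z = 0 then deriv (\<lambda>u::complex. - exp (- u)) 0 else (- exp (- z) - - exp (- 0)) / (z - 0)) holomorphic_on UNIV"
    by (rule pole_lemma) (auto intro!: holomorphic_intros)
  also have "(\<lambda>z. if z = 0 then deriv (\<lambda>u::complex. - exp (- u)) 0 else (- exp (- z) - - exp (- 0)) / (z - 0)) = unit_quot"
    unfolding d by (auto simp: unit_quot_def fun_eq_iff)
  finally show ?thesis by (rule holomorphic_on_subset) auto
qed

text \<open>The zeros are 2 pi i n with n \<noteq> 0; by Pythagoras their distance from the real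
  point a is at least sqrt (a^2 + 4 pi^2).\<close>

lemma unit_quot_nonzero:
  assumes "dist u (of_real a) < sqrt (a\<^sup>2 + 4 * pi\<^sup>2)" shows "unit_quot u \<noteq> 0"
proof
  assume "unit_quot u = 0"
  then have "u \<noteq> 0" "exp (- u) = 1" by (auto simp: unit_quot_def split: if_splits)
  then obtain n :: int where n: "Re u = 0" "Im (- u) = of_int (2 * n) * pi" by (auto simp: exp_eq_1)
  have "n \<noteq> 0" using n \<open>u \<noteq> 0\<close> by (auto simp: complex_eq_iff)
  then have "1 \<le> n\<^sup>2" by (simp add: zero_less_power2 int_one_le_iff_zero_less)
  then have "1 \<le> (real_of_int n)\<^sup>2" by (metis of_int_1_le_iff of_int_power)
  then have "4 * pi\<^sup>2 * 1 \<le> 4 * pi\<^sup>2 * (real_of_int n)\<^sup>2" by (intro mult_left_mono) auto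
  moreover have "(Im u)\<^sup>2 = 4 * pi\<^sup>2 * (real_of_int n)\<^sup>2"
  proof -
    have "(Im u)\<^sup>2 = (Im (- u))\<^sup>2" by simp
    then show ?thesis unfolding n(2) by (simp add: power_mult_distrib)
  qed
  ultimately have "sqrt (a\<^sup>2 + 4 * pi\<^sup>2) \<le> sqrt ((Re u - a)\<^sup>2 + (Im u)\<^sup>2)"
    using n(1) by (intro real_sqrt_le_mono) (auto simp: power2_eq_square)
  also have "\<dots> = dist u (of_real a)" by (simp add: dist_norm cmod_def)
  finally show False using assms by simp
qed

text \<open>As 1 - e^(-u) is u times \<open>unit_quot u\<close>, the branch point u = 0 is carried
  by Ln u alone. The disc about a has radius larger than a, so it contains 0, and it avoids the
  zeros of \<open>unit_quot\<close>; the remaining logarithm l is therefore holomorphic across the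
  branch point.\<close>

lemma one_minus_exp_neg_log:
  fixes a :: real
  assumes a: "a > 0"
  defines "B \<equiv> ball (of_real a) (sqrt (a\<^sup>2 + 4 * pi\<^sup>2))"
  obtains l where "l holomorphic_on B" "l 0 = 0" 
    "\<And>u. u \<in> B \<Longrightarrow> Re u > 0 \<Longrightarrow> Ln (1 - exp (- u)) = Ln u + l u"
proof -
  have RR: "a < sqrt (a\<^sup>2 + 4 * pi\<^sup>2)" using a by (intro real_less_rsqrt) auto
  have seg: "complex_of_real t \<in> B" if "0 \<le> t" "t \<le> a" for t
  proof -
    have "dist (complex_of_real a) (of_real t) = \<bar>a - t\<bar>" by (metis dist_of_real dist_real_def)
    then show ?thesis using that RR by (simp add: B_def)
  qed
  have B0: "0 \<in> B" using seg[of 0] a by simp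
  have nz: "unit_quot u \<noteq> 0" if "u \<in> B" for u using that unit_quot_nonzero[of u a] by (simp add: B_def dist_commute)
  obtain l0 where l0: "l0 holomorphic_on B" "\<And>u. u \<in> B \<Longrightarrow> unit_quot u = exp (l0 u)"
    by (rule contractible_imp_holomorphic_log[OF unit_quot_holomorphic, of B])
       (use nz in \<open>auto simp: B_def intro: convex_imp_contractible\<close>)
  define l where "l = (\<lambda>u. l0 u - l0 0)"
  have "exp (l0 0) = 1" using l0(2)[OF B0] by (simp add: unit_quot_def)
  then have l1: "exp (l u) = unit_quot u" if "u \<in> B" for u using l0(2)[OF that] by (simp add: l_def exp_diff)
  have lh: "l holomorphic_on B" unfolding l_def by (intro holomorphic_intros l0)
  have lc: "continuous_on B l" by (rule holomorphic_on_imp_continuous_on[OF lh])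
  have l00: "l 0 = 0" by (simp add: l_def)
  have real_pos: "Im (unit_quot (of_real t)) = 0 \<and> Re (unit_quot (of_real t)) > 0" if "t \<ge> 0" for t
  proof (cases "t = 0")
    case False
    then have "unit_quot (of_real t) = of_real ((1 - exp (- t)) / t)" by (simp add: unit_quot_def exp_of_real[symmetric])
    then show ?thesis using that False by simp
  qed (simp add: unit_quot_def)
  \<comment> \<open>The normalisation of l is at 0, while the comparison of principal logarithms on
    the half-disc starts at a. On the segment between them \<open>unit_quot\<close> is real and
    positive, which transports the value.\<close>
  have la: "l (of_real a) - Ln (unit_quot (of_real a)) = 0"
  proof (rule continuous_exp_eq_1_imp_0[where S = "{0..a}" and a = 0 and f = "\<lambda>t. l (of_real t) - Ln (unit_quot (of_real t))"])
    show "continuous_on {0..a} (\<lambda>t. l (of_real t) - Ln (unit_quot (of_real t)))"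
    proof (intro continuous_intros)
      show "continuous_on {0..a} (\<lambda>t. l (of_real t))"
        by (rule continuous_on_compose2[OF lc]) (auto intro!: continuous_intros seg)
      show "continuous_on {0..a} (\<lambda>t. unit_quot (of_real t))"
        by (rule continuous_on_compose2[OF holomorphic_on_imp_continuous_on[OF unit_quot_holomorphic[of UNIV]]])
           (auto intro!: continuous_intros)
      fix t assume "t \<in> {0..a}"
      then show "unit_quot (of_real t) \<notin> \<real>\<^sub>\<le>\<^sub>0" using real_pos[of t] by (auto simp: complex_nonpos_Reals_iff)
    qed
    fix t assume "t \<in> {0..a}"
    then show "exp (l (of_real t) - Ln (unit_quot (of_real t))) = 1"
      using l1[OF seg] nz[OF seg] by (simp add: exp_diff)
  qed (use a l00 in \<open>auto simp: unit_quot_def\<close>)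
  show thesis
  proof (rule that[OF lh l00])
    fix u assume u: "u \<in> B" "Re u > 0"
    let ?S = "B \<inter> {u. Re u > 0}"
    have small: "Re (1 - exp (- u)) > 0" if "Re u > 0" for u
    proof -
      have "Re (exp (- u)) \<le> cmod (exp (- u))" by (rule complex_Re_le_cmod)
      also have "\<dots> < 1" using that by simp
      finally show ?thesis by simp
    qed
    have "Ln (1 - exp (- u)) - Ln u - l u = 0"
    proof (rule continuous_exp_eq_1_imp_0[where S = ?S and a = "of_real a" and f = "\<lambda>u. Ln (1 - exp (- u)) - Ln u - l u"])
      show "connected ?S" unfolding B_def by (intro convex_connected convex_Int convex_ball convex_halfspace_Re_gt)
      show "continuous_on ?S (\<lambda>u. Ln (1 - exp (- u)) - Ln u - l u)"
      proof (intro continuous_intros continuous_on_subset[OF lc])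
        fix u assume u: "u \<in> ?S"
        show "1 - exp (- u) \<notin> \<real>\<^sub>\<le>\<^sub>0" using small[of u] u by (auto simp: complex_nonpos_Reals_iff)
        show "u \<notin> \<real>\<^sub>\<le>\<^sub>0" using u by (auto simp: complex_nonpos_Reals_iff)
      qed auto
      fix u assume u: "u \<in> ?S"
      have "1 - exp (- u) \<noteq> 0" using small[of u] u by (metis Int_Collect less_irrefl zero_complex.simps(1))
      moreover have "u \<noteq> 0" using u by auto
      ultimately show "exp (Ln (1 - exp (- u)) - Ln u - l u) = 1"
        using l1[of u] u by (simp add: exp_diff unit_quot_def)
    next
      have e: "exp (- complex_of_real a) = of_real (exp (- a))" by (simp add: exp_of_real[symmetric])
      have "1 - exp (- complex_of_real a) = of_real (1 - exp (- a))" unfolding e by simp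
      moreover have "1 - exp (- a) > 0" using a by simp
      ultimately have "Ln (1 - exp (- complex_of_real a)) = of_real (ln (1 - exp (- a)))"
        by (simp only: Ln_of_real)
      moreover have "unit_quot (of_real a) = of_real ((1 - exp (- a)) / a)" using a by (simp add: unit_quot_def e)
      then have "Ln (unit_quot (of_real a)) = of_real (ln ((1 - exp (- a)) / a))"
        using a by (simp only: Ln_of_real zero_less_divide_iff diff_gt_0_iff_gt exp_less_one_iff neg_less_0_iff_less simp_thms)
      ultimately show "Ln (1 - exp (- complex_of_real a)) - Ln (of_real a) - l (of_real a) = 0"
        using la a by (simp add: Ln_of_real ln_div)
    qed (use u a seg[of a] in auto)
    then show "Ln (1 - exp (- u)) = Ln u + l u" by (simp add: algebra_simps)
  qed
qed

text \<open>In u = h - z the function is e^(sh) u^(-s) A(u), where A(u) = exp (- s u - s l(u)) is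
  holomorphic around 0, and u = h (1 - z/h) splits off h^(-s). Multiplying two power series in z
  yields an exact convolution in place of a contour integral, which reduces uniformity in h to
  bounds on the terms.\<close>

lemma algebraic_singularity_coeffs:
  fixes a s :: real
  assumes a: "a > 0"
  obtains A where "A holomorphic_on ball (of_real a) (sqrt (a\<^sup>2 + 4 * pi\<^sup>2))" "A 0 = 1"
    "\<And>h Y n. h \<in> ball (of_real a) (sqrt (a\<^sup>2 + 4 * pi\<^sup>2)) \<Longrightarrow> Re h > 0 \<Longrightarrow> 
      (\<lambda>z. exp (of_real s * z) * (1 - exp z * exp (- h)) powr (- of_real s)) has_fps_expansion Y \<Longrightarrow>
      fps_nth Y n * h ^ n = exp (of_real s * h) * h powr (- of_real s) *
        (\<Sum>j\<le>n. ((- h) ^ j * (deriv ^^ j) A h / fact j) * of_real (bin_coeff s (n - j)))"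
proof -
  let ?B = "ball (complex_of_real a) (sqrt (a\<^sup>2 + 4 * pi\<^sup>2))"
  obtain l where l: "l holomorphic_on ?B" "l 0 = 0" 
    "\<And>u. u \<in> ?B \<Longrightarrow> Re u > 0 \<Longrightarrow> Ln (1 - exp (- u)) = Ln u + l u"
    by (rule one_minus_exp_neg_log[OF a]) auto
  define A where "A = (\<lambda>u. exp (- of_real s * u - of_real s * l u))"
  have Ah: "A holomorphic_on ?B" unfolding A_def by (intro holomorphic_intros l)
  show thesis
  proof (rule that[OF Ah])
    show "A 0 = 1" by (simp add: A_def l)
    fix h Y n
    assume h: "h \<in> ?B" "Re h > 0"
      and Y: "(\<lambda>z. exp (of_real s * z) * (1 - exp z * exp (- h)) powr (- of_real s)) has_fps_expansion Y"
    have h0: "h \<noteq> 0" using h by auto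
    let ?K = "exp (of_real s * h) * h powr (- of_real s)"
    \<comment> \<open>On this neighbourhood of 0, h - z stays in the disc, and h - z and 1 - z/h
      both lie in the right half-plane; with Re h > 0 the principal logarithms then add without a
      jump.\<close>
    let ?T = "{z. h - z \<in> ?B} \<inter> {z. Re z < Re h} \<inter> {z. Re (1 + - (1 / h) * z) > 0}"
    have "open {z. h - z \<in> ?B}"
    proof -
      have "{z. h - z \<in> ?B} = ball (h - of_real a) (sqrt (a\<^sup>2 + 4 * pi\<^sup>2))"
        by (auto simp: dist_norm norm_minus_commute algebra_simps)
      then show ?thesis by simp
    qed
    then have "open ?T" by (intro open_Int open_Collect_less continuous_intros) auto
    then have "eventually (\<lambda>z. z \<in> ?T) (nhds 0)" using h by (intro eventually_nhds_in_open) auto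
    then have ev: "eventually (\<lambda>z. exp (of_real s * z) * (1 - exp z * exp (- h)) powr (- of_real s) =
        ?K * ((1 + - (1 / h) * z) powr (- of_real s) * A (- 1 * z + h))) (nhds 0)"
    proof eventually_elim
      case (elim z)
      define u where "u = h - z"
      have u: "u \<in> ?B" "Re u > 0" and v: "Re (1 + - (1 / h) * z) > 0" using elim by (auto simp: u_def)
      define y where "y = 1 + - (1 / h) * z"
      have uy: "u = h * y" using h0 by (simp add: u_def y_def field_simps)
      have y0: "Re y > 0" "y \<noteq> 0" using v unfolding y_def by auto
      have "Ln u = Ln h + Ln y"
        unfolding uy using Re_Ln_pos_lt_imp[OF h(2)] Re_Ln_pos_lt_imp[OF y0(1)] h0 y0
        by (intro Ln_times_simple) auto
      then have Ln: "Ln (1 - exp (- u)) = Ln h + Ln y + l u" using l(3)[OF u] by simp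
      have e: "exp z * exp (- h) = exp (- u)" by (simp add: u_def exp_diff exp_minus field_simps)
      have "Re (exp (- u)) \<le> cmod (exp (- u))" by (rule complex_Re_le_cmod)
      also have "\<dots> < 1" using u by simp
      finally have "1 - exp (- u) \<noteq> 0" by auto
      then have "exp (of_real s * z) * (1 - exp z * exp (- h)) powr (- of_real s) =
        exp (of_real s * z - of_real s * (Ln h + Ln y + l u))"
        unfolding e by (simp only: powr_def if_False Ln mult_exp_exp) simp
      also have "of_real s * z - of_real s * (Ln h + Ln y + l u) =
        of_real s * h + (- of_real s) * Ln h + ((- of_real s) * Ln y + (- of_real s * u - of_real s * l u))"
        by (simp add: u_def algebra_simps)
      also have "exp \<dots> = ?K * (y powr (- of_real s) * A u)"
        using h0 y0 by (simp only: exp_add A_def powr_def if_False)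
      finally show ?case by (simp add: y_def u_def)
    qed
    define d where "d = (\<lambda>j. (deriv ^^ j) (\<lambda>z. A (- 1 * z + h)) 0 / fact j)"
    have hol: "(\<lambda>z. A (- 1 * z + h)) holomorphic_on {z. h - z \<in> ?B}"
      by (rule holomorphic_on_compose_gen[OF _ Ah, unfolded o_def]) (auto intro!: holomorphic_intros)
    have dexp: "(\<lambda>z. A (- 1 * z + h)) has_fps_expansion fps_expansion (\<lambda>z. A (- 1 * z + h)) 0"
      by (rule has_fps_expansion_fps_expansion[OF \<open>open {z. h - z \<in> ?B}\<close> _ hol]) (use h in auto)
    have "(\<lambda>z. - (1 / h) * z) has_fps_expansion fps_const (- (1 / h)) * fps_X"
      by (intro fps_expansion_intros)
    from has_fps_expansion_compose[OF has_fps_expansion_binomial_complex[of "- of_real s"] this]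
    have pexp: "(\<lambda>z. (1 + - (1 / h) * z) powr (- of_real s)) has_fps_expansion
       Abs_fps (\<lambda>n. (- (1 / h)) ^ n * fps_nth (fps_binomial (- of_real s)) n)"
      unfolding fps_compose_linear by (simp add: o_def)
    have "(\<lambda>z. ?K * ((1 + - (1 / h) * z) powr (- of_real s) * A (- 1 * z + h))) has_fps_expansion
       fps_const ?K * (Abs_fps (\<lambda>n. (- (1 / h)) ^ n * fps_nth (fps_binomial (- of_real s)) n) *
         fps_expansion (\<lambda>z. A (- 1 * z + h)) 0)" (is "_ has_fps_expansion ?R")
      by (intro has_fps_expansion_mult has_fps_expansion_const pexp dexp)
    with has_fps_expansion_cong[OF ev refl] have "(\<lambda>z. exp (of_real s * z) * (1 - exp z * exp (- h)) powr (- of_real s)) has_fps_expansion ?R"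
      by blast
    with Y have YR: "Y = ?R" by (rule fps_expansion_unique_complex)
    have "fps_nth Y n * h ^ n = ?K * (\<Sum>i=0..n. ((- (1 / h)) ^ i * (- of_real s gchoose i)) * d (n - i)) * h ^ n"
      unfolding YR fps_mult_left_const_nth unfolding fps_mult_nth fps_nth_Abs_fps fps_expansion_def d_def
      by (simp only: fps_binomial_nth)
    also have "(\<Sum>i=0..n. ((- (1 / h)) ^ i * (- of_real s gchoose i)) * d (n - i)) =
        (\<Sum>j\<le>n. ((- (1 / h)) ^ (n - j) * (- of_real s gchoose (n - j))) * d j)"
      unfolding atLeast0AtMost by (rule sum.reindex_bij_witness[of _ "\<lambda>j. n - j" "\<lambda>i. n - i"]) auto
    also have "?K * \<dots> * h ^ n = ?K * (\<Sum>j\<le>n. ((- h) ^ j * (deriv ^^ j) A h / fact j) * of_real (bin_coeff s (n - j)))"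
      unfolding sum_distrib_left sum_distrib_right
    proof (intro sum.cong refl)
      fix j assume "j \<in> {..n}"
      then have hn: "h ^ n = h ^ (n - j) * h ^ j" by (simp add: power_add[symmetric])
      have dj: "d j = (-1) ^ j * (deriv ^^ j) A h / fact j"
        unfolding d_def
        by (subst higher_deriv_compose_linear'[OF Ah \<open>open {z. h - z \<in> ?B}\<close>]) (use h in auto)
      have bj: "(- of_real s gchoose (n - j)) = (-1) ^ (n - j) * complex_of_real (bin_coeff s (n - j))"
        by (simp add: gbinomial_pochhammer pochhammer_of_real bin_coeff_def)
      have p1: "(- (1 / h)) ^ (n - j) * h ^ (n - j) * (-1) ^ (n - j) = 1"
        using h0 by (simp add: power_mult_distrib[symmetric])
      have p2: "(-1) ^ j * h ^ j = (- h) ^ j" by (simp add: power_mult_distrib[symmetric])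
      have "?K * (((- (1 / h)) ^ (n - j) * (- of_real s gchoose (n - j))) * d j) * h ^ n =
        ((- (1 / h)) ^ (n - j) * h ^ (n - j) * (-1) ^ (n - j)) * (?K * ((((-1) ^ j * h ^ j) * (deriv ^^ j) A h / fact j) * of_real (bin_coeff s (n - j))))"
        unfolding hn dj bj by (simp add: mult_ac)
      then show "?K * (((- (1 / h)) ^ (n - j) * (- of_real s gchoose (n - j))) * d j) * h ^ n =
        ?K * (((- h) ^ j * (deriv ^^ j) A h / fact j) * of_real (bin_coeff s (n - j)))"
        unfolding p1 p2 by simp
    qed
    finally show "fps_nth Y n * h ^ n = ?K * (\<Sum>j\<le>n. ((- h) ^ j * (deriv ^^ j) A h / fact j) * of_real (bin_coeff s (n - j)))" .
  qed
qed

section \<open>Uniform estimates by dominated summation\<close>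

text \<open>With x = n / (n - j + 1), both x and 1/x are at most 2 (j + 1), which handles both signs
  of t by a bound that is free of n.\<close>

lemma powr_ratio_bound:
  assumes "j \<le> n" "n > 0"
  shows "real n powr t * (real (n - j) + 1) powr (- t) \<le> (2 * (real j + 1)) powr \<bar>t\<bar>"
proof -
  define x where "x = real n / (real (n - j) + 1)"
  have x: "x > 0" using assms by (simp add: x_def)
  have "real n \<le> (real j + 1) * (real (n - j) + 1)"
  proof -
    have "real j * real j \<le> real j * real n" using assms by (intro mult_left_mono) auto
    then show ?thesis using assms by (simp add: algebra_simps of_nat_diff)
  qed
  then have "x \<le> real j + 1" by (simp add: x_def divide_le_eq)
  also have "real j + 1 \<le> 2 * (real j + 1)" by simp
  finally have x1: "x \<le> 2 * (real j + 1)" .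
  have "real (n - j) + 1 \<le> 2 * (real j + 1) * real n"
  proof -
    have "real (n - j) + 1 \<le> real n + real n" using assms by (auto simp: of_nat_diff)
    also have "\<dots> \<le> 2 * (real j + 1) * real n" by (simp add: algebra_simps)
    finally show ?thesis .
  qed
  then have x2: "1 / x \<le> 2 * (real j + 1)" using assms by (simp add: x_def divide_le_eq)
  have "real n powr t * (real (n - j) + 1) powr (- t) = x powr t"
    using assms by (simp add: x_def powr_divide powr_minus field_simps)
  also have "\<dots> \<le> (2 * (real j + 1)) powr \<bar>t\<bar>"
  proof (cases "t \<ge> 0")
    case True
    then show ?thesis using x x1 by (auto intro: powr_mono2)
  next
    case False
    have "x powr t = (1 / x) powr (- t)" using x by (simp add: powr_minus powr_divide)
    also have "\<dots> \<le> (2 * (real j + 1)) powr (- t)" using False x x2 by (intro powr_mono2) auto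
    finally show ?thesis using False by simp
  qed
  finally show ?thesis .
qed

lemma summable_poly_geometric:
  fixes q t :: real
  assumes "0 \<le> q" "q < 1"
  shows "summable (\<lambda>j. q ^ j * (2 * (real j + 1)) powr t)"
proof (cases "q = 0")
  case True
  show ?thesis by (rule summable_finite[of "{0}"]) (auto simp: True)
next
  case False
  then have q: "0 < q" "q < 1" using assms by auto
  define p where "p = (1 + q) / 2"
  have p: "q < p" "0 < p" "p < 1" using q by (auto simp: p_def)
  have "(\<lambda>j. (real j + 2) / (real j + 1)) \<longlonglongrightarrow> 1" by real_asymp
  from tendsto_powr[OF this tendsto_const[of t]]
  have "(\<lambda>j. ((real j + 2) / (real j + 1)) powr t) \<longlonglongrightarrow> 1" by simp
  then have "eventually (\<lambda>j. ((real j + 2) / (real j + 1)) powr t < p / q) sequentially"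
    by (rule order_tendstoD) (use p q in auto)
  then obtain N where N: "\<And>j. j \<ge> N \<Longrightarrow> ((real j + 2) / (real j + 1)) powr t < p / q"
    by (auto simp: eventually_sequentially)
  show ?thesis
  proof (rule summable_ratio_test[OF p(3)])
    fix j assume j: "j \<ge> N"
    have "2 * (real (Suc j) + 1) = (2 * (real j + 1)) * ((real j + 2) / (real j + 1))" by (simp add: field_simps)
    then have "(2 * (real (Suc j) + 1)) powr t = (2 * (real j + 1)) powr t * ((real j + 2) / (real j + 1)) powr t"
      by (simp only:) (rule powr_mult; simp)
    then have "q ^ Suc j * (2 * (real (Suc j) + 1)) powr t =
        q * ((real j + 2) / (real j + 1)) powr t * (q ^ j * (2 * (real j + 1)) powr t)"
      by (simp only: power_Suc mult_ac)
    also have "\<dots> \<le> q * (p / q) * (q ^ j * (2 * (real j + 1)) powr t)"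
      using N[OF j] q by (intro mult_right_mono mult_left_mono) auto
    finally show "norm (q ^ Suc j * (2 * (real (Suc j) + 1)) powr t) \<le> p * norm (q ^ j * (2 * (real j + 1)) powr t)"
      using q by simp
  qed
qed

text \<open>In the exact convolution the rescaled binomial weights tend to 1 / Gamma s for each j,
  while the Taylor terms of A decay geometrically, uniformly for h near a. Dominated summation
  leaves the Taylor series of A about a evaluated at the branch point 0, that is A 0 = 1.\<close>

lemma algebraic_singularity_asymptotics:
  fixes a s :: real
  assumes a: "a > 0"
  obtains \<delta> C where "\<delta> > 0" "\<delta> < a" "C \<ge> 0"
    "\<And>h Y n. cmod (h - of_real a) < \<delta> \<Longrightarrow> n > 0 \<Longrightarrow>
      (\<lambda>z. exp (of_real s * z) * (1 - exp z * exp (- h)) powr (- of_real s)) has_fps_expansion Y \<Longrightarrow>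
      cmod (fps_nth Y n * h ^ n) * real n powr (1 - s) \<le> C"
    "\<And>h Y n. h \<longlonglongrightarrow> of_real a \<Longrightarrow> filterlim n at_top sequentially \<Longrightarrow>
      (\<And>k. cmod (h k - of_real a) < \<delta>) \<Longrightarrow>
      (\<And>k. (\<lambda>z. exp (of_real s * z) * (1 - exp z * exp (- h k)) powr (- of_real s)) has_fps_expansion Y k) \<Longrightarrow>
      (\<lambda>k. fps_nth (Y k) (n k) * h k ^ n k * of_real (real (n k) powr (1 - s))) \<longlonglongrightarrow>
        of_real (exp (s * a) * a powr (- s) / Gamma s)"
proof -
  define R where "R = sqrt (a\<^sup>2 + 4 * pi\<^sup>2)"
  have R: "a < R" unfolding R_def using a by (intro real_less_rsqrt) auto
  obtain A where A: "A holomorphic_on ball (of_real a) R" "A 0 = 1"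
    and coeffs: "\<And>h Y n. h \<in> ball (of_real a) R \<Longrightarrow> Re h > 0 \<Longrightarrow> 
      (\<lambda>z. exp (of_real s * z) * (1 - exp z * exp (- h)) powr (- of_real s)) has_fps_expansion Y \<Longrightarrow>
      fps_nth Y n * h ^ n = exp (of_real s * h) * h powr (- of_real s) *
        (\<Sum>j\<le>n. ((- h) ^ j * (deriv ^^ j) A h / fact j) * of_real (bin_coeff s (n - j)))"
    unfolding R_def by (rule algebraic_singularity_coeffs[OF a, of s]) blast
  \<comment> \<open>The closed disc of radius a + 2\<delta> about h lies in that of radius a +
    3\<delta> about a, which lies in the disc of radius R because a + 4\<delta> \<le> R. As |h|
    \<le> a + \<delta>, Cauchy's inequality gives the terms the ratio q = (a + \<delta>) / (a +
    2\<delta>) < 1.\<close>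
  define \<delta> where "\<delta> = min (a / 2) ((R - a) / 4)"
  have \<delta>: "\<delta> > 0" "\<delta> \<le> a / 2" "a + 4 * \<delta> \<le> R" using a R by (auto simp: \<delta>_def min_def field_simps)
  have near: "h \<in> ball (of_real a) R" "Re h \<ge> a / 2" "cmod h \<le> a + \<delta>" "cmod h \<ge> a / 2" "h \<noteq> 0"
    if "cmod (h - of_real a) < \<delta>" for h
  proof -
    show "h \<in> ball (of_real a) R" using that \<delta> a by (simp add: dist_norm norm_minus_commute)
    have "\<bar>Re (h - of_real a)\<bar> \<le> cmod (h - of_real a)" by (rule abs_Re_le_cmod)
    then show re: "Re h \<ge> a / 2" using that \<delta> by simp
    have "cmod h \<le> cmod (h - of_real a) + cmod (of_real a)" by (metis diff_add_cancel norm_triangle_ineq)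
    then show "cmod h \<le> a + \<delta>" using that a by simp
    have "Re h \<le> cmod h" by (rule complex_Re_le_cmod)
    then show "cmod h \<ge> a / 2" using re by simp
    then show "h \<noteq> 0" using a by auto
  qed
  have "compact (cball (complex_of_real a) (a + 3 * \<delta>))" by simp
  moreover have "cball (complex_of_real a) (a + 3 * \<delta>) \<subseteq> ball (of_real a) R" using \<delta> by auto
  ultimately have "compact (A ` cball (complex_of_real a) (a + 3 * \<delta>))"
    using holomorphic_on_imp_continuous_on[OF A(1)] by (meson compact_continuous_image continuous_on_subset)
  then have "bounded (A ` cball (complex_of_real a) (a + 3 * \<delta>))" by (rule compact_imp_bounded)
  then obtain B where "B > 0" "\<forall>x\<in>A ` cball (complex_of_real a) (a + 3 * \<delta>). cmod x \<le> B"
    unfolding bounded_pos by blast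
  then have B: "B > 0" "\<And>u. u \<in> cball (of_real a) (a + 3 * \<delta>) \<Longrightarrow> cmod (A u) \<le> B" by simp_all
  define q where "q = (a + \<delta>) / (a + 2 * \<delta>)"
  have q: "0 \<le> q" "q < 1" using a \<delta> by (auto simp: q_def)
  define e where "e = (\<lambda>h j. (- h) ^ j * (deriv ^^ j) A h / fact j)"
  have e_bound: "cmod (e h j) \<le> B * q ^ j" if h: "cmod (h - of_real a) < \<delta>" for h j
  proof -
    have sub: "cball h (a + 2 * \<delta>) \<subseteq> cball (of_real a) (a + 3 * \<delta>)"
    proof
      fix x assume "x \<in> cball h (a + 2 * \<delta>)"
      then have "dist h x \<le> a + 2 * \<delta>" by simp
      moreover have "dist (of_real a) h < \<delta>" using h by (simp add: dist_norm norm_minus_commute)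
      ultimately show "x \<in> cball (of_real a) (a + 3 * \<delta>)"
        using dist_triangle[of "of_real a" x h] by simp
    qed
    have "cmod ((deriv ^^ j) A h) \<le> fact j * B / (a + 2 * \<delta>) ^ j"
    proof (rule Cauchy_inequality)
      have s2: "cball h (a + 2 * \<delta>) \<subseteq> ball (of_real a) R" using sub \<delta> by (force simp: subset_iff)
      then show "A holomorphic_on ball h (a + 2 * \<delta>)" using A(1) by (meson ball_subset_cball holomorphic_on_subset)
      show "continuous_on (cball h (a + 2 * \<delta>)) A"
        using holomorphic_on_imp_continuous_on[OF A(1)] s2 by (meson continuous_on_subset)
      show "0 < a + 2 * \<delta>" using a \<delta> by simp
      fix x assume "cmod (h - x) = a + 2 * \<delta>"
      then have "x \<in> cball h (a + 2 * \<delta>)" by (simp add: dist_norm)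
      then show "cmod (A x) \<le> B" using sub B(2) by blast
    qed
    then have "cmod ((deriv ^^ j) A h) / fact j \<le> fact j * B / (a + 2 * \<delta>) ^ j / fact j" by (rule divide_right_mono) simp
    then have d: "cmod ((deriv ^^ j) A h) / fact j \<le> B / (a + 2 * \<delta>) ^ j" by simp
    have "cmod (e h j) = cmod h ^ j * (cmod ((deriv ^^ j) A h) / fact j)"
      by (simp add: e_def norm_mult norm_divide norm_power)
    also have "\<dots> \<le> (a + \<delta>) ^ j * (B / (a + 2 * \<delta>) ^ j)"
      using near(3)[OF h] d a \<delta> by (intro mult_mono power_mono zero_le_power) auto
    also have "\<dots> = B * q ^ j" by (simp add: q_def power_divide)
    finally show ?thesis .
  qed
  have "Bseq (\<lambda>n. bin_coeff s n * (real n + 1) powr (1 - s))"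
    by (rule convergent_imp_Bseq[OF convergentI[OF bin_coeff_asymp_Suc]])
  then obtain D where D: "D > 0" "\<And>n. \<bar>bin_coeff s n * (real n + 1) powr (1 - s)\<bar> \<le> D"
    by (auto simp: Bseq_def)
  \<comment> \<open>Extended by 0 beyond j = n, so that the finite convolution becomes a series to
    which Tannery's theorem applies.\<close>
  define g where "g = (\<lambda>n j. if j \<le> n then bin_coeff s (n - j) * real n powr (1 - s) else 0)"
  have g_bound: "\<bar>g n j\<bar> \<le> D * (2 * (real j + 1)) powr \<bar>1 - s\<bar>" if "n > 0" for n j
  proof (cases "j \<le> n")
    case True
    have "g n j = (bin_coeff s (n - j) * (real (n - j) + 1) powr (1 - s)) * (real n powr (1 - s) * (real (n - j) + 1) powr (- (1 - s)))"
      using True by (simp add: g_def powr_add[symmetric])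
    then have "\<bar>g n j\<bar> = \<bar>bin_coeff s (n - j) * (real (n - j) + 1) powr (1 - s)\<bar> * (real n powr (1 - s) * (real (n - j) + 1) powr (- (1 - s)))"
      by (simp add: abs_mult)
    also have "\<dots> \<le> D * (2 * (real j + 1)) powr \<bar>1 - s\<bar>"
      using D powr_ratio_bound[OF True that, of "1 - s"] by (intro mult_mono) auto
    finally show ?thesis .
  qed (use D in \<open>auto simp: g_def\<close>)
  have g_lim: "(\<lambda>n. g n j) \<longlonglongrightarrow> 1 / Gamma s" for j
  proof -
    have "(\<lambda>n. bin_coeff s n * real n powr (1 - s) * ((real n + real j) / real n) powr (1 - s)) \<longlonglongrightarrow> 1 / Gamma s * 1"
      by (intro tendsto_mult bin_coeff_asymp) real_asymp
    moreover have "eventually (\<lambda>n. bin_coeff s n * real n powr (1 - s) * ((real n + real j) / real n) powr (1 - s) = g (n + j) j) sequentially"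
      using eventually_gt_at_top[of 0] by eventually_elim (simp add: g_def powr_divide)
    ultimately have "(\<lambda>n. g (n + j) j) \<longlonglongrightarrow> 1 / Gamma s" by (simp add: tendsto_cong)
    then show ?thesis by (rule LIMSEQ_offset)
  qed
  have sumM: "summable (\<lambda>j. B * q ^ j * (D * (2 * (real j + 1)) powr \<bar>1 - s\<bar>))"
    using summable_mult[OF summable_poly_geometric[OF q, of "\<bar>1 - s\<bar>"], of "B * D"] by (simp add: mult_ac)
  define S where "S = (\<Sum>j. B * q ^ j * (D * (2 * (real j + 1)) powr \<bar>1 - s\<bar>))"
  have term_bound: "cmod (e h j * of_real (g n j)) \<le> B * q ^ j * (D * (2 * (real j + 1)) powr \<bar>1 - s\<bar>)"
    if "cmod (h - of_real a) < \<delta>" "n > 0" for h n j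
    using mult_mono[OF e_bound[OF that(1), of j] g_bound[OF that(2), of j]] B q by (simp add: norm_mult)
  have formula: "fps_nth Y n * h ^ n * of_real (real n powr (1 - s)) =
      exp (of_real s * h) * h powr (- of_real s) * (\<Sum>j. e h j * of_real (g n j))"
    if h: "cmod (h - of_real a) < \<delta>" and
      Y: "(\<lambda>z. exp (of_real s * z) * (1 - exp z * exp (- h)) powr (- of_real s)) has_fps_expansion Y" for h Y n
  proof -
    have "(\<Sum>j. e h j * of_real (g n j)) = (\<Sum>j\<le>n. e h j * of_real (g n j))"
      by (rule suminf_finite) (auto simp: g_def)
    also have "\<dots> = (\<Sum>j\<le>n. e h j * of_real (bin_coeff s (n - j))) * of_real (real n powr (1 - s))"
      unfolding sum_distrib_right by (intro sum.cong refl) (simp add: g_def)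
    finally show ?thesis
      using coeffs[OF near(1)[OF h] _ Y, of n] near(2)[OF h] a by (simp add: e_def)
  qed
  \<comment> \<open>The number 2a + 2/a exceeds both |h| and 1/|h|, so its power |s| bounds |h|^(-s)
    for either sign of s.\<close>
  define KB where "KB = exp (\<bar>s\<bar> * (2 * a)) * (2 * a + 2 / a) powr \<bar>s\<bar>"
  have K_bound: "cmod (exp (of_real s * h) * h powr (- of_real s)) \<le> KB" if h: "cmod (h - of_real a) < \<delta>" for h
  proof -
    have c: "cmod h \<le> 2 * a" "cmod h \<ge> a / 2" using near[OF h] \<delta> a by auto
    have "Re (of_real s * h) \<le> cmod (of_real s * h)" by (rule complex_Re_le_cmod)
    also have "\<dots> \<le> \<bar>s\<bar> * (2 * a)" using c by (simp add: norm_mult mult_left_mono)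
    finally have 1: "cmod (exp (of_real s * h)) \<le> exp (\<bar>s\<bar> * (2 * a))" by simp
    have "cmod (h powr (- of_real s)) = cmod h powr (- s)" by (subst norm_powr_real_powr') auto
    also have "\<dots> \<le> (2 * a + 2 / a) powr \<bar>s\<bar>"
    proof (cases "s \<ge> 0")
      case True
      have hp: "0 < cmod h" using c a by linarith
      have "1 / cmod h \<le> 1 / (a / 2)" by (rule frac_le) (use c a in auto)
      then have "1 / cmod h \<le> 2 * a + 2 / a" using a by simp
      moreover have "cmod h powr (- s) = (1 / cmod h) powr s" using hp by (simp add: powr_minus powr_divide field_simps)
      ultimately show ?thesis using True hp by (auto intro: powr_mono2)
    next
      case False
      have "cmod h \<le> 2 * a + 2 / a" using c a by (simp add: add_increasing2)
      then show ?thesis using False by (auto intro: powr_mono2)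
    qed
    finally show ?thesis using 1 unfolding KB_def norm_mult by (intro mult_mono) auto
  qed
  have KB0: "KB \<ge> 0" by (simp add: KB_def)
  show thesis
  proof (rule that[of \<delta> "KB * S"])
    show "\<delta> > 0" "\<delta> < a" using \<delta> a by auto
    have "S \<ge> 0" unfolding S_def using B D q by (intro suminf_nonneg sumM) auto
    then show "KB * S \<ge> 0" using KB0 by simp
    fix h Y n
    assume h: "cmod (h - of_real a) < \<delta>" and n: "(n::nat) > 0"
      and Y: "(\<lambda>z. exp (of_real s * z) * (1 - exp z * exp (- h)) powr (- of_real s)) has_fps_expansion Y"
    have "cmod (fps_nth Y n * h ^ n) * real n powr (1 - s) = cmod (fps_nth Y n * h ^ n * of_real (real n powr (1 - s)))"
      by (simp add: norm_mult)
    also have "\<dots> = cmod (exp (of_real s * h) * h powr (- of_real s)) * cmod (\<Sum>j. e h j * of_real (g n j))"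
      unfolding formula[OF h Y] norm_mult ..
    also have "\<dots> \<le> KB * S"
      unfolding S_def using KB0
      by (intro mult_mono K_bound[OF h] norm_suminf_le[OF term_bound[OF h n] sumM]) auto
    finally show "cmod (fps_nth Y n * h ^ n) * real n powr (1 - s) \<le> KB * S" .
  next
    fix h :: "nat \<Rightarrow> complex" and Y and n :: "nat \<Rightarrow> nat"
    assume hlim: "h \<longlonglongrightarrow> of_real a" and n: "filterlim n at_top sequentially"
      and h: "\<And>k. cmod (h k - of_real a) < \<delta>"
      and Y: "\<And>k. (\<lambda>z. exp (of_real s * z) * (1 - exp z * exp (- h k)) powr (- of_real s)) has_fps_expansion Y k"
    have elim: "(\<lambda>k. e (h k) j) \<longlonglongrightarrow> e (of_real a) j" for j
    proof -
      have "(deriv ^^ j) A holomorphic_on ball (of_real a) R" using A(1) by (intro holomorphic_intros) auto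
      then have "isCont ((deriv ^^ j) A) (of_real a)"
        using a R continuous_on_eq_continuous_at[OF open_ball] holomorphic_on_imp_continuous_on
        by (metis centre_in_ball less_trans)
      then have "(\<lambda>k. (deriv ^^ j) A (h k)) \<longlonglongrightarrow> (deriv ^^ j) A (of_real a)" using hlim by (rule isCont_tendsto_compose)
      then show ?thesis unfolding e_def by (intro tendsto_intros hlim) auto
    qed
    have glim: "(\<lambda>k. g (n k) j) \<longlonglongrightarrow> 1 / Gamma s" for j
      by (rule filterlim_compose[OF g_lim n])
    have npos: "eventually (\<lambda>k. n k > 0) sequentially" by (rule eventually_compose_filterlim[OF eventually_gt_at_top n])
    have main: "(\<lambda>k. \<Sum>j. e (h k) j * of_real (g (n k) j)) \<longlonglongrightarrow> (\<Sum>j. e (of_real a) j * of_real (1 / Gamma s))"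
    proof (rule tannerys_theorem[THEN conjunct2, THEN conjunct2])
      show "((\<lambda>k. e (h k) j * of_real (g (n k) j)) \<longlongrightarrow> e (of_real a) j * of_real (1 / Gamma s)) sequentially" for j
        by (intro tendsto_intros elim glim)
      show "eventually (\<lambda>(j, k). norm (e (h k) j * of_real (g (n k) j)) \<le> B * q ^ j * (D * (2 * (real j + 1)) powr \<bar>1 - s\<bar>)) (at_top \<times>\<^sub>F sequentially)"
        using eventually_prodI[OF eventually_True npos, of at_top]
        by (rule eventually_mono) (simp only: case_prod_unfold, rule term_bound[OF h], simp)
    qed (use sumM in auto)
    \<comment> \<open>The Taylor series of A about a reaches the point 0 because a < R.\<close>
    have "(\<lambda>j. (deriv ^^ j) A (of_real a) / fact j * (0 - of_real a) ^ j) sums A 0"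
      by (rule holomorphic_power_series[OF A(1)]) (use a R in \<open>auto simp: dist_norm\<close>)
    then have "(\<lambda>j. e (of_real a) j) sums 1" by (simp add: e_def A(2) mult_ac)
    then have "(\<Sum>j. e (of_real a) j * of_real (1 / Gamma s)) = of_real (1 / Gamma s)"
      using sums_mult2[of "e (of_real a)" 1 "of_real (1 / Gamma s)"] by (simp add: sums_iff)
    with main have main': "(\<lambda>k. \<Sum>j. e (h k) j * of_real (g (n k) j)) \<longlonglongrightarrow> of_real (1 / Gamma s)" by simp
    have K: "(\<lambda>k. exp (of_real s * h k) * h k powr (- of_real s)) \<longlonglongrightarrow> exp (of_real s * of_real a) * of_real a powr (- of_real s)"
    proof (intro tendsto_mult tendsto_exp tendsto_const hlim)
      have "isCont (\<lambda>x. x powr (- complex_of_real s)) (of_real a)"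
        using a by (intro continuous_intros) (auto simp: complex_nonpos_Reals_iff)
      then show "(\<lambda>k. h k powr (- of_real s)) \<longlonglongrightarrow> of_real a powr (- of_real s)" using hlim by (rule isCont_tendsto_compose)
    qed
    have Ka: "exp (of_real s * of_real a) * of_real a powr (- of_real s) = complex_of_real (exp (s * a) * a powr (- s))"
      using a by (simp add: exp_of_real[symmetric] powr_of_real[symmetric])
    show "(\<lambda>k. fps_nth (Y k) (n k) * h k ^ n k * of_real (real (n k) powr (1 - s))) \<longlonglongrightarrow>
        of_real (exp (s * a) * a powr (- s) / Gamma s)"
      using tendsto_mult[OF K main'] unfolding formula[OF h Y] Ka by simp
  qed
qed

section \<open>Gaussian integrals\<close>

lemma nn_integral_diagonal:
  fixes c :: "'m::finite \<Rightarrow> real" and g :: "real^'m \<Rightarrow> ennreal"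
  assumes c: "\<And>i. c i \<noteq> 0" and g[measurable]: "g \<in> borel_measurable borel"
  shows "(\<integral>\<^sup>+x. g x \<partial>lborel) = ennreal \<bar>\<Prod>i\<in>UNIV. c i\<bar> * (\<integral>\<^sup>+x. g (\<chi> i. c i * x $ i) \<partial>lborel)"
proof -
  let ?ax = "\<lambda>j::'m. axis j (1::real)"
  have inj: "inj ?ax" by (auto simp: inj_on_def axis_eq_axis)
  have Basis: "(Basis :: (real^'m) set) = range ?ax" by (auto simp: Basis_vec_def)
  define d where "d = (\<lambda>b::real^'m. c (the_inv ?ax b))"
  have axj: "?ax i $ j = (if i = j then 1 else 0)" for i j by (simp add: axis_def)
  have d: "d (?ax j) = c j" for j by (simp add: d_def the_inv_f_f[OF inj])
  let ?T = "\<lambda>x::real^'m. 0 + (\<Sum>j\<in>Basis. (d j * (x \<bullet> j)) *\<^sub>R j)"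
  have T: "?T x = (\<chi> i. c i * x $ i)" for x
    unfolding Basis by (subst sum.reindex[OF inj])
      (simp add: vec_eq_iff d cart_eq_inner_axis[symmetric] axj if_distrib[of "(*) _"] cong: if_cong)
  have meas[measurable]: "?T \<in> borel \<rightarrow>\<^sub>M borel" by measurable
  have "(lborel :: (real^'m) measure) = density (distr lborel borel ?T) (\<lambda>_. (\<Prod>j\<in>Basis. \<bar>d j\<bar>))"
    by (rule lborel_affine_euclidean) (auto simp: Basis d c)
  then have "(\<integral>\<^sup>+x. g x \<partial>lborel) = (\<integral>\<^sup>+x. g x \<partial>density (distr lborel borel ?T) (\<lambda>_. (\<Prod>j\<in>Basis. \<bar>d j\<bar>)))" by simp
  also have "\<dots> = (\<integral>\<^sup>+x. ennreal (\<Prod>j\<in>Basis. \<bar>d j\<bar>) * g x \<partial>distr lborel borel ?T)"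
    by (subst nn_integral_density) auto
  also have "\<dots> = (\<integral>\<^sup>+x. ennreal (\<Prod>j\<in>Basis. \<bar>d j\<bar>) * g (?T x) \<partial>lborel)"
    by (subst nn_integral_distr) auto
  also have "\<dots> = ennreal (\<Prod>j\<in>Basis. \<bar>d j\<bar>) * (\<integral>\<^sup>+x. g (?T x) \<partial>lborel)"
    by (rule nn_integral_cmult) simp
  also have "(\<Prod>j\<in>Basis. \<bar>d j\<bar>) = \<bar>\<Prod>i\<in>UNIV. c i\<bar>"
    unfolding Basis by (subst prod.reindex[OF inj]) (simp add: d abs_prod)
  finally show ?thesis unfolding T .
qed

text \<open>When coordinate m is integrated first with all others fixed, the shear is a translation
  of that coordinate.\<close>

lemma nn_integral_shear:
  fixes g :: "real^'m::finite \<Rightarrow> ennreal"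
  assumes mn: "m \<noteq> n" and g[measurable]: "g \<in> borel_measurable borel"
  shows "(\<integral>\<^sup>+x. g (\<chi> i. if i = m then x $ m + x $ n else x $ i) \<partial>lborel) = (\<integral>\<^sup>+x. g x \<partial>lborel)"
proof -
  interpret product_sigma_finite "\<lambda>b::real^'m. lborel :: real measure" ..
  let ?ax = "\<lambda>j::'m. axis j (1::real)"
  have inj: "inj ?ax" by (auto simp: inj_on_def axis_eq_axis)
  have Basis: "(Basis :: (real^'m) set) = range ?ax" by (auto simp: Basis_vec_def)
  let ?P = "Pi\<^sub>M (Basis :: (real^'m) set) (\<lambda>b. lborel :: real measure)"
  let ?T = "\<lambda>x::(real^'m) \<Rightarrow> real. \<Sum>b\<in>Basis. x b *\<^sub>R b"
  let ?f = "\<lambda>x::real^'m. \<chi> i. if i = m then x $ m + x $ n else x $ i"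
  have axj: "?ax i $ j = (if i = j then 1 else 0)" for i j by (simp add: axis_def)
  have T: "?T x $ j = x (?ax j)" for x j
  proof -
    have "?T x $ j = (\<Sum>i\<in>UNIV. if i = j then x (?ax i) else 0)"
      unfolding Basis by (subst sum.reindex[OF inj]) (simp add: axj if_distrib[of "(*) _"] cong: if_cong)
    then show ?thesis by simp
  qed
  have vol: "(lborel :: (real^'m) measure) = distr ?P borel ?T" by (rule lborel_eq)
  have Tm[measurable]: "?T \<in> measurable ?P borel" by measurable
  have fm[measurable]: "?f \<in> borel \<rightarrow>\<^sub>M borel"
  proof (intro borel_measurable_continuous_onI continuous_on_vec_lambda)
    show "continuous_on UNIV (\<lambda>x::real^'m. if i = m then x $ m + x $ n else x $ i)" for i
      by (cases "i = m") (auto intro!: continuous_intros)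
  qed
  let ?I = "Basis - {?ax m}"
  have ins: "insert (?ax m) ?I = Basis" by (auto simp: Basis)
  have nin: "?ax n \<noteq> ?ax m" using mn by (simp add: axis_eq_axis)
  have split: "(\<integral>\<^sup>+x. G x \<partial>?P) = (\<integral>\<^sup>+x. (\<integral>\<^sup>+y. G (x(?ax m := y)) \<partial>lborel) \<partial>Pi\<^sub>M ?I (\<lambda>b. lborel))"
    if "G \<in> borel_measurable ?P" for G
    using product_nn_integral_insert[of ?I "?ax m" G] that unfolding ins by simp
  have "(\<integral>\<^sup>+x. g (?f x) \<partial>lborel) = (\<integral>\<^sup>+x. g (?f (?T x)) \<partial>?P)"
    unfolding vol by (rule nn_integral_distr) measurable
  also have "\<dots> = (\<integral>\<^sup>+x. (\<integral>\<^sup>+y. g (?f (?T (x(?ax m := y)))) \<partial>lborel) \<partial>Pi\<^sub>M ?I (\<lambda>b. lborel))"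
    by (rule split) measurable
  also have "\<dots> = (\<integral>\<^sup>+x. (\<integral>\<^sup>+y. g (?T (x(?ax m := y))) \<partial>lborel) \<partial>Pi\<^sub>M ?I (\<lambda>b. lborel))"
  proof (rule nn_integral_cong)
    fix x assume "x \<in> space (Pi\<^sub>M ?I (\<lambda>b. lborel :: real measure))"
    have "?f (?T (x(?ax m := y))) = ?T (x(?ax m := x (?ax n) + 1 * y))" for y
    proof (rule vec_eq_iff[THEN iffD2], intro allI)
      fix i
      have ax_eq: "?ax i = ?ax j \<longleftrightarrow> i = j" for i j by (simp add: axis_eq_axis)
      show "?f (?T (x(?ax m := y))) $ i = ?T (x(?ax m := x (?ax n) + 1 * y)) $ i"
        unfolding vec_lambda_beta T fun_upd_def ax_eq using mn by auto
    qed
    moreover have meas: "(\<lambda>y. g (?T (x(?ax m := y)))) \<in> borel_measurable borel"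
    proof (rule measurable_compose[OF _ g])
      show "(\<lambda>y. ?T (x(?ax m := y))) \<in> borel_measurable borel"
        unfolding fun_upd_def by measurable
    qed
    ultimately show "(\<integral>\<^sup>+y. g (?f (?T (x(?ax m := y)))) \<partial>lborel) = (\<integral>\<^sup>+y. g (?T (x(?ax m := y))) \<partial>lborel)"
      using nn_integral_real_affine[OF meas, of 1 "x (?ax n)"] by simp
  qed
  also have "\<dots> = (\<integral>\<^sup>+x. g (?T x) \<partial>?P)"
    by (rule split[symmetric]) measurable
  also have "\<dots> = (\<integral>\<^sup>+x. g x \<partial>lborel)"
    unfolding vol by (rule nn_integral_distr[symmetric]) measurable
  finally show ?thesis .
qed

lemma nn_integral_swap:
  fixes g :: "real^'m::finite \<Rightarrow> ennreal"
  assumes g[measurable]: "g \<in> borel_measurable borel"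
  shows "(\<integral>\<^sup>+x. g (\<chi> i. x $ Transposition.transpose m n i) \<partial>lborel) = (\<integral>\<^sup>+x. g x \<partial>lborel)"
proof -
  let ?p = "Transposition.transpose m n"
  let ?f = "\<lambda>x::real^'m. \<chi> i. x $ ?p i"
  have fm[measurable]: "?f \<in> borel \<rightarrow>\<^sub>M borel"
    by (intro borel_measurable_continuous_onI continuous_on_vec_lambda) (auto intro!: continuous_intros)
  have "lborel = distr lborel borel ?f"
  proof (rule lborel_eqI)
    fix l u :: "real^'m" assume le: "\<And>b. b \<in> Basis \<Longrightarrow> l \<bullet> b \<le> u \<bullet> b"
    then have le': "l $ i \<le> u $ i" for i by (metis axis_in_Basis_iff inner_axis inner_real_def mult.right_neutral Basis_real_def insertI1)
    have "?f -` box l u = box (?f l) (?f u)"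
    proof (rule set_eqI)
      fix x
      have "(\<forall>i. l $ i < x $ ?p i \<and> x $ ?p i < u $ i) \<longleftrightarrow> (\<forall>i. l $ ?p i < x $ i \<and> x $ i < u $ ?p i)"
        by (metis transpose_involutory)
      then show "x \<in> ?f -` box l u \<longleftrightarrow> x \<in> box (?f l) (?f u)" by (simp add: mem_box_cart)
    qed
    then have "emeasure (distr lborel borel ?f) (box l u) = emeasure lborel (box (?f l) (?f u))"
      by (simp add: emeasure_distr)
    also have "\<dots> = (\<Prod>i\<in>UNIV. u $ ?p i - l $ ?p i)"
      using le' by (simp add: emeasure_lborel_box_eq Basis_vec_def inner_axis prod.UNION_disjoint prod.reindex cart_eq_inner_axis[symmetric]
         axis_eq_axis inj_on_def prod.reindex[of "\<lambda>i. axis i 1" UNIV] )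
    also have "\<dots> = (\<Prod>i\<in>UNIV. u $ i - l $ i)"
      by (rule arg_cong[where f = ennreal], rule prod.reindex_bij_witness[of _ ?p ?p]) auto
    also have "\<dots> = ennreal (\<Prod>b\<in>Basis. (u - l) \<bullet> b)"
    proof -
      have "inj (\<lambda>j::'m. axis j (1::real))" by (auto simp: inj_on_def axis_eq_axis)
      then show ?thesis by (simp add: Basis_vec_def UNION_singleton_eq_range prod.reindex inner_axis)
    qed
    finally show "emeasure (distr lborel borel ?f) (box l u) = ennreal (\<Prod>b\<in>Basis. (u - l) \<bullet> b)" .
  qed simp
  then have "(\<integral>\<^sup>+x. g x \<partial>lborel) = (\<integral>\<^sup>+x. g x \<partial>distr lborel borel ?f)" by simp
  also have "\<dots> = (\<integral>\<^sup>+x. g (?f x) \<partial>lborel)" by (rule nn_integral_distr) auto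
  finally show ?thesis ..
qed

text \<open>Linear maps are composed of diagonal maps, swaps, shears and maps with a vanishing
  coordinate. The last kind has determinant 0 and satisfies the claim vacuously; a nonzero
  determinant of a composition passes to both factors.\<close>

lemma nn_integral_linear_change:
  fixes f :: "real^'m::finite \<Rightarrow> real^'m"
  assumes f: "linear f" and det: "det (matrix f) \<noteq> 0" and g: "g \<in> borel_measurable borel"
  shows "(\<integral>\<^sup>+x. g x \<partial>lborel) = ennreal \<bar>det (matrix f)\<bar> * (\<integral>\<^sup>+x. g (f x) \<partial>lborel)"
proof -
  let ?P = "\<lambda>f::real^'m \<Rightarrow> real^'m. det (matrix f) \<noteq> 0 \<longrightarrow> (\<forall>g\<in>borel_measurable borel.
    (\<integral>\<^sup>+x. g x \<partial>lborel) = ennreal \<bar>det (matrix f)\<bar> * (\<integral>\<^sup>+x. g (f x) \<partial>lborel))"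
  have "?P f"
  proof (rule induct_linear_elementary[OF f])
    fix f1 f2 :: "real^'m \<Rightarrow> real^'m" assume l: "linear f1" "linear f2" and P: "?P f1" "?P f2"
    show "?P (f1 \<circ> f2)"
    proof (intro impI ballI)
      fix g :: "real^'m \<Rightarrow> ennreal" assume g: "g \<in> borel_measurable borel"
      assume "det (matrix (f1 \<circ> f2)) \<noteq> 0"
      then have d: "det (matrix f1) \<noteq> 0" "det (matrix f2) \<noteq> 0" and
        dd: "det (matrix (f1 \<circ> f2)) = det (matrix f1) * det (matrix f2)"
        using l by (auto simp: matrix_compose det_mul)
      have "f1 \<in> borel_measurable borel" using l by (intro borel_measurable_continuous_onI linear_continuous_on linear_conv_bounded_linear[THEN iffD1])
      then have g1: "(\<lambda>x. g (f1 x)) \<in> borel_measurable borel" using g by (rule measurable_compose)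
      have "(\<integral>\<^sup>+x. g x \<partial>lborel) = ennreal \<bar>det (matrix f1)\<bar> * (\<integral>\<^sup>+x. g (f1 x) \<partial>lborel)"
        using P(1) d g by blast
      also have "(\<integral>\<^sup>+x. g (f1 x) \<partial>lborel) = ennreal \<bar>det (matrix f2)\<bar> * (\<integral>\<^sup>+x. g (f1 (f2 x)) \<partial>lborel)"
        using P(2) d g1 by blast
      finally show "(\<integral>\<^sup>+x. g x \<partial>lborel) = ennreal \<bar>det (matrix (f1 \<circ> f2))\<bar> * (\<integral>\<^sup>+x. g ((f1 \<circ> f2) x) \<partial>lborel)"
        by (simp add: dd abs_mult ennreal_mult mult.assoc)
    qed
  next
    fix f1 :: "real^'m \<Rightarrow> real^'m" and i assume l: "linear f1" "\<And>x. f1 x $ i = 0"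
    have "row i (matrix f1) = 0" using l(2) by (simp add: row_def matrix_def vec_eq_iff)
    then have "det (matrix f1) = 0" by (rule det_zero_row)
    then show "?P f1" by simp
  next
    fix c :: "'m \<Rightarrow> real"
    have "det (matrix (\<lambda>x. \<chi> i. c i * x $ i)) = (\<Prod>i\<in>UNIV. c i)"
      by (subst det_diagonal) (auto simp: matrix_def axis_def)
    then show "?P (\<lambda>x. \<chi> i. c i * x $ i)" using nn_integral_diagonal[of c] by auto
  next
    fix m n :: 'm assume "m \<noteq> n"
    have "matrix (\<lambda>x::real^'m. \<chi> i. x $ Transposition.transpose m n i) = (\<chi> i. mat 1 $ Transposition.transpose m n i)"
      by (auto simp: matrix_def vec_eq_iff mat_def axis_def)
    then have "\<bar>det (matrix (\<lambda>x::real^'m. \<chi> i. x $ Transposition.transpose m n i))\<bar> = 1"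
      by (simp add: det_permute_rows permutes_swap_id abs_mult sign_def)
    then show "?P (\<lambda>x. \<chi> i. x $ Transposition.transpose m n i)" by (simp add: nn_integral_swap)
  next
    fix m n :: 'm assume mn: "m \<noteq> n"
    have "matrix (\<lambda>x::real^'m. \<chi> i. if i = m then x $ m + x $ n else x $ i) =
        (\<chi> k. if k = m then row m (mat 1) + 1 *s row n (mat 1) else row k (mat 1))"
      by (auto simp: matrix_def vec_eq_iff mat_def axis_def row_def)
    then have "det (matrix (\<lambda>x::real^'m. \<chi> i. if i = m then x $ m + x $ n else x $ i)) = 1"
      using det_row_operation[OF mn, where c = "1 :: real" and A = "mat 1"] by simp
    then show "?P (\<lambda>x. \<chi> i. if i = m then x $ m + x $ n else x $ i)" using mn by (simp add: nn_integral_shear)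
  qed
  then show ?thesis using det g by blast
qed

section \<open>Diagonalisation and the Gaussian integral\<close>

text \<open>Gram-Schmidt for the inner product defined by M. As long as k is below the dimension,
  the span is proper and offers a new vector to be orthogonalised.\<close>

lemma orthonormal_system_form:
  fixes M :: "real^'m^'m::finite"
  assumes M: "positive_definite M" and k: "k \<le> CARD('m)"
  shows "\<exists>S. finite S \<and> card S = k \<and> (\<forall>u\<in>S. \<forall>v\<in>S. u \<bullet> (M *v v) = (if u = v then 1 else 0))"
  using k
proof (induction k)
  case 0
  show ?case by (intro exI[of _ "{}"]) auto
next
  case (Suc k)
  then obtain S where S: "finite S" "card S = k" and o: "\<And>u v. u \<in> S \<Longrightarrow> v \<in> S \<Longrightarrow> u \<bullet> (M *v v) = (if u = v then 1 else 0)"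
    by auto
  have sym: "u \<bullet> (M *v v) = v \<bullet> (M *v u)" for u v
    using M by (metis dot_lmul_matrix inner_commute positive_definite_def transpose_matrix_vector)
  have pos: "v \<noteq> 0 \<Longrightarrow> v \<bullet> (M *v v) > 0" for v using M by (simp add: positive_definite_def)
  have "dim (span S) \<le> k" using S dim_le_card'[of S] by (simp add: dim_span)
  moreover have "dim (UNIV :: (real^'m) set) = CARD('m)" by simp
  ultimately have "span S \<noteq> UNIV" using Suc.prems by (metis not_less_eq_eq)
  then obtain v where v: "v \<notin> span S" by auto
  define w where "w = v - (\<Sum>s\<in>S. (s \<bullet> (M *v v)) *\<^sub>R s)"
  have "(\<Sum>s\<in>S. (s \<bullet> (M *v v)) *\<^sub>R s) \<in> span S" by (intro span_sum span_mul span_base)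
  then have w0: "w \<noteq> 0" using v by (auto simp: w_def)
  have ow: "u \<bullet> (M *v w) = 0" if u: "u \<in> S" for u
  proof -
    have "u \<bullet> (M *v w) = u \<bullet> (M *v v) - (\<Sum>s\<in>S. (s \<bullet> (M *v v)) * (u \<bullet> (M *v s)))"
      by (simp add: w_def matrix_vector_mult_diff_distrib inner_diff_right linear_sum[OF matrix_vector_mul_linear] inner_sum_right
        matrix_vector_mult_scaleR)
    also have "(\<Sum>s\<in>S. (s \<bullet> (M *v v)) * (u \<bullet> (M *v s))) = (\<Sum>s\<in>S. if s = u then u \<bullet> (M *v v) else 0)"
      by (rule sum.cong) (auto simp: o u)
    also have "\<dots> = u \<bullet> (M *v v)" using u S by simp
    finally show ?thesis by simp
  qed
  define n where "n = (1 / sqrt (w \<bullet> (M *v w))) *\<^sub>R w"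
  have nn: "n \<bullet> (M *v n) = 1"
    using pos[OF w0] by (simp add: n_def matrix_vector_mult_scaleR field_simps)
  have on: "u \<bullet> (M *v n) = 0" if "u \<in> S" for u
    using ow[OF that] by (simp add: n_def matrix_vector_mult_scaleR)
  have "n \<notin> S" using on[of n] nn by auto
  then have "card (insert n S) = Suc k" using S by simp
  moreover have "u \<bullet> (M *v v) = (if u = v then 1 else 0)" if "u \<in> insert n S" "v \<in> insert n S" for u v
  proof (cases "u = n")
    case u: True
    show ?thesis
    proof (cases "v = n")
      case False
      then have "v \<in> S" using that by simp
      then show ?thesis using on[of v] sym[of n v] u False by simp
    qed (use u nn in simp)
  next
    case u: False
    then have uS: "u \<in> S" using that by simp
    show ?thesis
    proof (cases "v = n")
      case True
      then show ?thesis using on[OF uS] u by simp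
    next
      case False
      then have "v \<in> S" using that by simp
      then show ?thesis by (rule o[OF uS])
    qed
  qed
  ultimately show ?case using S(1) by (intro exI[of _ "insert n S"] conjI ballI) simp_all
qed

text \<open>The columns of B form an M-orthonormal basis, so B^T M B is the identity; its
  determinant gives the relation between det B and det M.\<close>

lemma positive_definite_diagonalize:
  fixes M :: "real^'m^'m::finite"
  assumes M: "positive_definite M"
  obtains B :: "real^'m^'m" where "(det B)\<^sup>2 * det M = 1" "\<And>y. (B *v y) \<bullet> (M *v (B *v y)) = y \<bullet> y"
proof -
  obtain S where S: "finite S" "card S = CARD('m)" and o: "\<And>u v. u \<in> S \<Longrightarrow> v \<in> S \<Longrightarrow> u \<bullet> (M *v v) = (if u = v then 1 else 0)"
    using orthonormal_system_form[OF M order_refl] by auto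
  obtain b where b: "bij_betw b (UNIV :: 'm set) S" using S finite_same_card_bij[of "UNIV :: 'm set" S] by auto
  define B where "B = (\<chi> i j. b j $ i)"
  have col: "column j B = b j" for j by (simp add: B_def column_def vec_eq_iff)
  have BMB: "transpose B ** M ** B = mat 1"
  proof -
    have "(transpose B ** M ** B) $ i $ j = b i \<bullet> (M *v b j)" for i j
    proof -
      have "(transpose B ** M ** B) $ i $ j = (transpose B ** (M ** B)) $ i $ j" by (simp add: matrix_mul_assoc)
      also have "\<dots> = row i (transpose B) \<bullet> column j (M ** B)" by (simp add: matrix_matrix_mult_def row_def column_def inner_vec_def)
      also have "row i (transpose B) = b i" by (simp add: col)
      also have "column j (M ** B) = M *v b j"
        by (simp add: col[symmetric] column_def matrix_matrix_mult_def matrix_vector_mult_def vec_eq_iff)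
      finally show ?thesis .
    qed
    moreover have "b i \<bullet> (M *v b j) = (if i = j then 1 else 0)" for i j
      using b o[of "b i" "b j"] by (auto simp: bij_betw_def inj_on_def)
    ultimately show ?thesis by (simp add: vec_eq_iff mat_def)
  qed
  show thesis
  proof (rule that[of B])
    have "det (transpose B ** M ** B) = 1" unfolding BMB by simp
    then show "(det B)\<^sup>2 * det M = 1" by (simp add: det_mul power2_eq_square mult_ac)
    fix y
    have "(B *v y) \<bullet> (M *v (B *v y)) = y \<bullet> (transpose B *v (M *v (B *v y)))"
      by (metis dot_lmul_matrix inner_commute transpose_matrix_vector transpose_transpose)
    also have "\<dots> = y \<bullet> ((transpose B ** M ** B) *v y)" by (simp add: matrix_vector_mul_assoc matrix_mul_assoc)
    finally show "(B *v y) \<bullet> (M *v (B *v y)) = y \<bullet> y" by (simp add: BMB)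
  qed
qed

lemma standard_gaussian_vec:
  "(\<integral>\<^sup>+x. ennreal (exp (- (x \<bullet> x) / 2)) \<partial>(lborel :: (real^'m::finite) measure)) = ennreal ((2 * pi) powr (real CARD('m) / 2))"
proof -
  have 1: "integrable lborel (\<lambda>t::real. exp (- t\<^sup>2 / 2))" "(\<integral>t. exp (- t\<^sup>2 / 2) \<partial>lborel) = sqrt (2 * pi)"
  proof -
    have e: "exp (- t\<^sup>2 / 2) = sqrt (2 * pi) * std_normal_density t" for t
      by (simp add: std_normal_density_def)
    show "integrable lborel (\<lambda>t::real. exp (- t\<^sup>2 / 2))" unfolding e by simp
    show "(\<integral>t. exp (- t\<^sup>2 / 2) \<partial>lborel) = sqrt (2 * pi)" unfolding e by simp
  qed
  have p: "exp (- (x \<bullet> x) / 2) = (\<Prod>j\<in>UNIV. exp (- (x $ j)\<^sup>2 / 2))" for x :: "real^'m"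
    by (simp add: inner_vec_def exp_sum[symmetric] sum_divide_distrib sum_negf power2_eq_square)
  have "(\<integral>\<^sup>+x. ennreal (exp (- (x \<bullet> x) / 2)) \<partial>(lborel :: (real^'m) measure)) =
      ennreal (\<integral>x. exp (- (x \<bullet> x) / 2) \<partial>(lborel :: (real^'m) measure))"
    unfolding p by (intro nn_integral_eq_integral prod_integral_vec(1) 1(1)) (auto intro!: prod_nonneg)
  also have "(\<integral>x. exp (- (x \<bullet> x) / 2) \<partial>(lborel :: (real^'m) measure)) = sqrt (2 * pi) ^ CARD('m)"
    unfolding p by (subst prod_integral_vec(2)) (use 1 in simp_all)
  also have "\<dots> = (2 * pi) powr (real CARD('m) / 2)"
    by (simp add: powr_half_sqrt[symmetric] powr_powr powr_realpow[symmetric] field_simps)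
  finally show ?thesis .
qed

text \<open>The substitution x = B y reduces the integral to the standard Gaussian, and |det B| = 1
  / sqrt (det M) is the Jacobian.\<close>

lemma gaussian_integral:
  fixes M :: "real^'m^'m::finite"
  assumes M: "positive_definite M"
  shows "det M > 0" "integrable lborel (\<lambda>x. exp (- (x \<bullet> (M *v x)) / 2))"
    "(\<integral>x. exp (- (x \<bullet> (M *v x)) / 2) \<partial>lborel) = (2 * pi) powr (real CARD('m) / 2) / sqrt (det M)"
proof -
  obtain B :: "real^'m^'m" where B: "(det B)\<^sup>2 * det M = 1" "\<And>y. (B *v y) \<bullet> (M *v (B *v y)) = y \<bullet> y"
    by (rule positive_definite_diagonalize[OF M]) auto
  have B0: "det B \<noteq> 0" using B(1) by auto
  then have "(det B)\<^sup>2 > 0" by simp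
  then show d: "det M > 0" using B(1) by (metis zero_less_mult_pos zero_less_one)
  have "det M = (1 / \<bar>det B\<bar>)\<^sup>2" using B(1) B0 by (simp add: field_simps)
  then have sq: "sqrt (det M) = 1 / \<bar>det B\<bar>" by simp
  have meas: "(\<lambda>x. exp (- (x \<bullet> (M *v x)) / 2)) \<in> borel_measurable borel"
  proof -
    have "continuous_on UNIV (\<lambda>x. M *v x)" by (rule linear_continuous_on[OF matrix_vector_mul_bounded_linear])
    then show ?thesis by (intro borel_measurable_continuous_onI continuous_intros) auto
  qed
  have "(\<integral>\<^sup>+x. ennreal (exp (- (x \<bullet> (M *v x)) / 2)) \<partial>lborel) =
      ennreal \<bar>det B\<bar> * (\<integral>\<^sup>+x. ennreal (exp (- ((B *v x) \<bullet> (M *v (B *v x))) / 2)) \<partial>lborel)"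
    using nn_integral_linear_change[of "(*v) B" "\<lambda>x. ennreal (exp (- (x \<bullet> (M *v x)) / 2))"] B0 meas by simp
  also have "\<dots> = ennreal ((2 * pi) powr (real CARD('m) / 2) / sqrt (det M))"
    unfolding B(2) standard_gaussian_vec sq by (simp add: ennreal_mult[symmetric] mult.commute)
  finally have nn: "(\<integral>\<^sup>+x. ennreal (exp (- (x \<bullet> (M *v x)) / 2)) \<partial>lborel) = ennreal ((2 * pi) powr (real CARD('m) / 2) / sqrt (det M))" .
  show "integrable lborel (\<lambda>x. exp (- (x \<bullet> (M *v x)) / 2))"
    using nn meas by (intro integrableI_nonneg) auto
  show "(\<integral>x. exp (- (x \<bullet> (M *v x)) / 2) \<partial>lborel) = (2 * pi) powr (real CARD('m) / 2) / sqrt (det M)"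
    using nn meas d by (subst integral_eq_nn_integral) auto
qed

section \<open>The phase near a critical point\<close>

lemma isCont_nhds: "isCont f x \<Longrightarrow> filterlim f (nhds (f x)) (nhds x)"
  by (simp add: isCont_def tendsto_at_iff_tendsto_nhds)

lemma bigo_cmult: "f \<in> O[F](g) \<Longrightarrow> (\<lambda>x. k * f x) \<in> O[F](g)" for k :: "'b::real_normed_field"
  by (cases "k = 0") auto

lemma taylor_second_order:
  fixes f :: "complex \<Rightarrow> complex"
  assumes f: "f holomorphic_on S" and S: "open S" "z0 \<in> S"
  shows "(\<lambda>z. f z - f z0 - deriv f z0 * (z - z0) - deriv (deriv f) z0 / 2 * (z - z0)\<^sup>2) \<in> O[nhds z0](\<lambda>z. (z - z0) ^ 3)"
proof -
  obtain d where d: "d > 0" "cball z0 d \<subseteq> S" using S by (meson open_contains_cball)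
  have h: "(deriv ^^ i) f holomorphic_on S" for i using f S by (intro holomorphic_intros)
  have "compact ((deriv ^^ 3) f ` cball z0 d)"
    using holomorphic_on_imp_continuous_on[OF h] d by (meson compact_cball compact_continuous_image continuous_on_subset)
  then obtain B where B: "\<And>z. z \<in> cball z0 d \<Longrightarrow> norm ((deriv ^^ 3) f z) \<le> B"
    by (metis bounded_iff compact_imp_bounded image_eqI)
  have T: "norm (f z - (\<Sum>i\<le>2. (deriv ^^ i) f z0 * (z - z0) ^ i / fact i)) \<le> B * norm (z - z0) ^ Suc 2 / fact 2"
    if z: "z \<in> cball z0 d" for z
  proof -
    have "norm ((deriv ^^ 0) f z - (\<Sum>i\<le>2. (deriv ^^ i) f z0 * (z - z0) ^ i / fact i)) \<le> B * norm (z - z0) ^ Suc 2 / fact 2"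
    proof (rule complex_Taylor[of "cball z0 d"])
      fix i x assume "x \<in> cball z0 d"
      then have "x \<in> S" using d by auto
      then show "((deriv ^^ i) f has_field_derivative (deriv ^^ Suc i) f x) (at x within cball z0 d)"
        using has_field_derivative_higher_deriv[OF f S(1)] by (auto intro: has_field_derivative_at_within)
    next
      fix x assume "x \<in> cball z0 d"
      then show "norm ((deriv ^^ Suc 2) f x) \<le> B" using B[of x] by (simp only: eval_nat_numeral)
    qed (use d z in auto)
    then show ?thesis by simp
  qed
  show ?thesis
  proof (rule bigoI[of _ "B / 2"])
    have "eventually (\<lambda>z. z \<in> cball z0 d) (nhds z0)"
      using d by (intro eventually_nhds[THEN iffD2] exI[of _ "ball z0 d"]) auto
    then show "eventually (\<lambda>z. norm (f z - f z0 - deriv f z0 * (z - z0) - deriv (deriv f) z0 / 2 * (z - z0)\<^sup>2) \<le> B / 2 * norm ((z - z0) ^ 3)) (nhds z0)"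
    proof eventually_elim
      case (elim z)
      have "(\<Sum>i\<le>2. (deriv ^^ i) f z0 * (z - z0) ^ i / fact i) = f z0 + deriv f z0 * (z - z0) + deriv (deriv f) z0 / 2 * (z - z0)\<^sup>2"
        by (simp add: eval_nat_numeral)
      then have "f z - f z0 - deriv f z0 * (z - z0) - deriv (deriv f) z0 / 2 * (z - z0)\<^sup>2 =
          f z - (\<Sum>i\<le>2. (deriv ^^ i) f z0 * (z - z0) ^ i / fact i)" by simp
      also have "norm \<dots> \<le> B * norm (z - z0) ^ Suc 2 / fact 2" by (rule T[OF elim])
      also have "\<dots> = B / 2 * norm ((z - z0) ^ 3)" by (simp only: norm_power) (simp add: eval_nat_numeral)
      finally show ?case .
    qed
  qed
qed

text \<open>Suppose v H v = 0 and put w = H v. The form at v + t w is 2 t |w|^2 + t^2 (w H w), which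
  is negative for small t < 0 unless w = 0; then v is a nonzero vector in the kernel.\<close>

lemma psd_nonsingular_imp_pd:
  fixes H :: "real^'m^'m::finite"
  assumes sym: "transpose H = H" and psd: "\<And>v. 0 \<le> v \<bullet> (H *v v)" and det: "det H \<noteq> 0"
  shows "positive_definite H"
  unfolding positive_definite_def
proof (intro conjI sym allI impI)
  fix v :: "real^'m" assume v: "v \<noteq> 0"
  show "0 < v \<bullet> (H *v v)"
  proof (rule ccontr)
    assume "\<not> 0 < v \<bullet> (H *v v)"
    then have z: "v \<bullet> (H *v v) = 0" using psd[of v] by simp
    define w where "w = H *v v"
    have sw: "v \<bullet> (H *v w) = w \<bullet> w"
      unfolding w_def by (metis dot_lmul_matrix sym transpose_matrix_vector)
    have q: "0 \<le> 2 * t * (w \<bullet> w) + t\<^sup>2 * (w \<bullet> (H *v w))" for t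
    proof -
      have "(v + t *\<^sub>R w) \<bullet> (H *v (v + t *\<^sub>R w)) = 2 * t * (w \<bullet> w) + t\<^sup>2 * (w \<bullet> (H *v w))"
        using z sw by (simp add: matrix_vector_right_distrib matrix_vector_mult_scaleR inner_add_left inner_add_right
             w_def[symmetric] power2_eq_square algebra_simps)
      then show ?thesis using psd[of "v + t *\<^sub>R w"] by simp
    qed
    have "w \<bullet> w = 0"
    proof (rule ccontr)
      assume "w \<bullet> w \<noteq> 0"
      then have w: "w \<bullet> w > 0" by simp
      define c where "c = w \<bullet> (H *v w)"
      have c: "c \<ge> 0" using psd by (simp add: c_def)
      \<comment> \<open>The denominator c + 1 is positive even if c = 0, and t (c + 1) = -|w|^2
        exposes the sign of the form.\<close>
      define t where "t = - (w \<bullet> w) / (c + 1)"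
      have tc: "t * (c + 1) = - (w \<bullet> w)" using c by (simp add: t_def)
      have tn: "t < 0" using w c by (simp add: t_def field_simps)
      have "2 * t * (w \<bullet> w) + t\<^sup>2 * c = t * (2 * (w \<bullet> w) + t * (c + 1) - t)" by (simp add: algebra_simps power2_eq_square)
      also have "\<dots> = t * ((w \<bullet> w) - t)" unfolding tc by simp
      also have "\<dots> < 0"
      proof (rule mult_neg_pos[OF tn])
        show "0 < w \<bullet> w - t" using tn w by linarith
      qed
      finally show False using q[of t] by (simp add: c_def)
    qed
    then have "H *v v = 0" by (simp add: w_def)
    then show False using v det by (metis invertible_det_nz invertible_left_inverse matrix_left_invertible_ker)
  qed
qed

locale critical_point =
  fixes \<alpha> r :: "real^('m::finite option)"
  assumes alpha_pos: "\<And>i. \<alpha> $ i > 0"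
    and r_pos: "\<And>i. r $ i > 0"
    and r_zero: "(\<Sum>i\<in>UNIV. exp (- (r $ i))) = real CARD('m)"
    and r_critical: "\<And>i j. \<alpha> $ i / (r $ i * exp (- (r $ i))) = \<alpha> $ j / (r $ j * exp (- (r $ j)))"
    and r_minimal: "strictly_minimal r"
    and nondegenerate: "det (hessian (Phi \<alpha>) (drop_last r)) \<noteq> 0"

begin

abbreviation (input) "rp \<equiv> r $ None"

abbreviation (input) "ap \<equiv> \<alpha> $ None"

lemma sum_exp_drop_last: "real CARD('m) - (\<Sum>j\<in>UNIV. exp (- (r $ Some j))) = exp (- rp)"
  using r_zero by (simp add: UNIV_option_conv sum.reindex)

text \<open>The critical equations in the shape in which differentiating log h produces
  them.\<close>

lemma critical: "ap * exp (- (r $ Some j)) / (exp (- rp) * rp) = \<alpha> $ Some j / r $ Some j"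
proof -
  have "\<alpha> $ Some j / (r $ Some j * exp (- (r $ Some j))) = ap / (rp * exp (- rp))" by (rule r_critical)
  then show ?thesis using r_pos[of "Some j"] r_pos[of None] by (simp add: field_simps)
qed

text \<open>The Hessian form of \<open>Phi\<close> in the angles of y_j = r_j e^(i \<theta>_j): a
  displacement v_j corresponds to v_j / r_j, as in \<open>hessian_quad\<close>. The same form is the
  second-order term of \<open>log_hh_expansion\<close>.\<close>

definition quad :: "real^'m \<Rightarrow> real" where
  "quad \<theta> = (\<Sum>j\<in>UNIV. \<alpha> $ Some j * (1 - r $ Some j) * (\<theta> $ j)\<^sup>2) + (1 - rp) / ap * (\<Sum>j\<in>UNIV. \<alpha> $ Some j * \<theta> $ j)\<^sup>2"

lemma hessian_Phi:
  "hessian (Phi \<alpha>) (drop_last r) = (\<chi> i j. (if i = j then \<alpha> $ Some j * (1 - r $ Some j) / (r $ Some j)\<^sup>2 else 0) +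
     (1 - rp) / ap * (\<alpha> $ Some i / r $ Some i) * (\<alpha> $ Some j / r $ Some j))"
proof -
  define D where "D = (\<lambda>y::real^'m. real CARD('m) - (\<Sum>i\<in>UNIV. exp (- (y $ i))))"
  \<comment> \<open>An open set on which every logarithm in \<open>Phi\<close> has a positive
    argument; D < 1 means that \<open>h_fun\<close> is positive.\<close>
  define U where "U = {y::real^'m. (\<forall>i. 0 < y $ i) \<and> 0 < D y \<and> D y < 1}"
  define P where "P = (\<lambda>j y. - \<alpha> $ Some j / y $ j + ap * exp (- (y $ j)) / (D y * h_fun y))"
  have hD: "h_fun y = - ln (D y)" for y by (simp add: h_fun_def D_def)
  have Dc: "continuous_on UNIV D" unfolding D_def by (intro continuous_intros)
  have "open U"
  proof -
    have "U = (\<Inter>i\<in>UNIV. {y. 0 < y $ i}) \<inter> {y. 0 < D y} \<inter> {y. D y < 1}" by (auto simp: U_def)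
    then show ?thesis by (auto intro!: open_Int open_INT open_Collect_less continuous_intros Dc)
  qed
  define dl :: "'m \<Rightarrow> 'm \<Rightarrow> real" where "dl = (\<lambda>i j. if i = j then 1 else 0)"
  have dl: "(\<Sum>i\<in>UNIV. f i * dl i j) = f j" for f j
    by (simp add: dl_def if_distrib[of "(*) _"] cong: if_cong)
  have line: "(y + t *\<^sub>R axis j 1) $ i = y $ i + t * dl i j" for y :: "real^'m" and t i j
    by (simp add: axis_def dl_def)
  have dD: "((\<lambda>t. D (y + t *\<^sub>R axis j 1)) has_real_derivative exp (- (y $ j))) (at 0)" for y j
  proof -
    have "((\<lambda>t. D (y + t *\<^sub>R axis j 1)) has_real_derivative (\<Sum>i\<in>UNIV. exp (- (y $ i)) * dl i j)) (at 0)"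
      unfolding D_def line by (auto intro!: derivative_eq_intros simp: sum_negf)
    then show ?thesis unfolding dl .
  qed
  have P: "partial_deriv j (Phi \<alpha>) y = P j y" if y: "y \<in> U" for y j
  proof -
    have pos: "0 < y $ i" "0 < D y" "D y < 1" for i using y by (auto simp: U_def)
    then have ln0: "ln (D y) < 0" by simp
    have s: "((\<lambda>t. \<Sum>i\<in>UNIV. \<alpha> $ Some i * ln ((y + t *\<^sub>R axis j 1) $ i)) has_real_derivative \<alpha> $ Some j / y $ j) (at 0)"
    proof -
      have "((\<lambda>t. \<Sum>i\<in>UNIV. \<alpha> $ Some i * ln ((y + t *\<^sub>R axis j 1) $ i)) has_real_derivative
          (\<Sum>i\<in>UNIV. (\<alpha> $ Some i / y $ i) * dl i j)) (at 0)"
        unfolding line using pos by (auto intro!: derivative_eq_intros sum.cong)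
      then show ?thesis unfolding dl .
    qed
    have l: "((\<lambda>t. ln (h_fun (y + t *\<^sub>R axis j 1))) has_real_derivative - (exp (- (y $ j)) / D y) / h_fun y) (at 0)"
      unfolding hD using dD[of y j] pos ln0
      by (auto intro!: derivative_eq_intros simp: field_simps)
    have "((\<lambda>t. Phi \<alpha> (y + t *\<^sub>R axis j 1)) has_real_derivative P j y) (at 0)"
      unfolding Phi_def P_def using DERIV_diff[OF DERIV_minus[OF s] DERIV_cmult[OF l, of ap]] by simp
    then show ?thesis unfolding partial_deriv_def by (rule DERIV_imp_deriv)
  qed
  let ?r = "drop_last r"
  have rj: "?r $ j = r $ Some j" for j by (simp add: drop_last_def)
  have Dr: "D ?r = exp (- rp)" using sum_exp_drop_last by (simp add: D_def rj)
  have rU: "?r \<in> U" using r_pos by (simp add: U_def rj Dr)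
  have hr: "h_fun ?r = rp" by (simp add: hD Dr)
  have "partial_deriv i (partial_deriv j (Phi \<alpha>)) ?r =
     (if i = j then \<alpha> $ Some j * (1 - r $ Some j) / (r $ Some j)\<^sup>2 else 0) +
     (1 - rp) / ap * (\<alpha> $ Some i / r $ Some i) * (\<alpha> $ Some j / r $ Some j)" for i j
  proof -
    \<comment> \<open>The formula P for the first derivatives holds on a whole neighbourhood of the
      critical point, so it may be differentiated again.\<close>
    have "eventually (\<lambda>t. ?r + t *\<^sub>R axis i 1 \<in> U) (nhds (0::real))"
    proof -
      have "open ((\<lambda>t::real. ?r + t *\<^sub>R axis i 1) -` U)"
        using \<open>open U\<close> by (intro continuous_open_vimage) (auto intro!: continuous_intros)
      then show ?thesis using rU by (intro eventually_nhds[THEN iffD2] exI[of _ "(\<lambda>t::real. ?r + t *\<^sub>R axis i 1) -` U"]) auto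
    qed
    then have ev: "eventually (\<lambda>t. partial_deriv j (Phi \<alpha>) (?r + t *\<^sub>R axis i 1) = P j (?r + t *\<^sub>R axis i 1)) (nhds 0)"
      by eventually_elim (rule P)
    let ?E = "exp (- rp)" and ?ei = "exp (- (r $ Some i))" and ?ej = "exp (- (r $ Some j))"
    let ?d = "dl j i"
    have dDh: "((\<lambda>t. D (?r + t *\<^sub>R axis i 1) * h_fun (?r + t *\<^sub>R axis i 1)) has_real_derivative ?ei * (rp - 1)) (at 0)"
      unfolding hD using dD[of ?r i] r_pos[of None]
      by (auto intro!: derivative_eq_intros simp: Dr rj field_simps)
    have dE: "((\<lambda>t. exp (- ((?r + t *\<^sub>R axis i 1) $ j))) has_real_derivative - ?d * ?ej) (at 0)"
      unfolding line by (auto intro!: derivative_eq_intros simp: rj)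
    have dI: "((\<lambda>t. - \<alpha> $ Some j / (?r + t *\<^sub>R axis i 1) $ j) has_real_derivative ?d * \<alpha> $ Some j / (r $ Some j)\<^sup>2) (at 0)"
      unfolding line using r_pos[of "Some j"] by (auto intro!: derivative_eq_intros simp: rj field_simps power2_eq_square)
    have nz: "D (?r + 0 *\<^sub>R axis i 1) * h_fun (?r + 0 *\<^sub>R axis i 1) \<noteq> 0" using r_pos[of None] by (simp add: Dr hr)
    have "((\<lambda>t. P j (?r + t *\<^sub>R axis i 1)) has_real_derivative
       ?d * \<alpha> $ Some j / (r $ Some j)\<^sup>2 + ((ap * (- ?d * ?ej)) * (?E * rp) - (ap * ?ej) * (?ei * (rp - 1))) / ((?E * rp) * (?E * rp))) (at 0)"
      unfolding P_def using DERIV_add[OF dI DERIV_divide[OF DERIV_cmult[OF dE, of ap] dDh nz]] by (simp add: Dr hr rj)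
    then have "deriv (\<lambda>t. P j (?r + t *\<^sub>R axis i 1)) 0 =
       ?d * \<alpha> $ Some j / (r $ Some j)\<^sup>2 + ((ap * (- ?d * ?ej)) * (?E * rp) - (ap * ?ej) * (?ei * (rp - 1))) / ((?E * rp) * (?E * rp))"
      by (rule DERIV_imp_deriv)
    also have "((ap * (- ?d * ?ej)) * (?E * rp) - (ap * ?ej) * (?ei * (rp - 1))) / ((?E * rp) * (?E * rp)) =
       - ?d * (ap * ?ej / (?E * rp)) + (1 - rp) / ap * (ap * ?ei / (?E * rp)) * (ap * ?ej / (?E * rp))"
    proof -
      have "?E * rp \<noteq> 0" "ap \<noteq> 0" using r_pos[of None] alpha_pos[of None] by auto
      then show ?thesis by (simp add: divide_simps) (simp add: algebra_simps)
    qed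
    \<comment> \<open>The critical equations enter here: they replace the exponentials by \<alpha>_i
      / r_i and turn the matrix into a diagonal one plus a rank-one term.\<close>
    also have "ap * ?ei / (?E * rp) = \<alpha> $ Some i / r $ Some i" by (rule critical)
    also have "ap * ?ej / (?E * rp) = \<alpha> $ Some j / r $ Some j" by (rule critical)
    also have "?d * \<alpha> $ Some j / (r $ Some j)\<^sup>2 + (- ?d * (\<alpha> $ Some j / r $ Some j) + (1 - rp) / ap * (\<alpha> $ Some i / r $ Some i) * (\<alpha> $ Some j / r $ Some j)) =
        (?d * \<alpha> $ Some j / (r $ Some j)\<^sup>2 - ?d * (\<alpha> $ Some j / r $ Some j)) + (1 - rp) / ap * (\<alpha> $ Some i / r $ Some i) * (\<alpha> $ Some j / r $ Some j)"
      by simp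
    also have "?d * \<alpha> $ Some j / (r $ Some j)\<^sup>2 - ?d * (\<alpha> $ Some j / r $ Some j) = (if i = j then \<alpha> $ Some j * (1 - r $ Some j) / (r $ Some j)\<^sup>2 else 0)"
      using r_pos[of "Some j"] by (auto simp: dl_def field_simps power2_eq_square)
    finally have "deriv (\<lambda>t. P j (?r + t *\<^sub>R axis i 1)) 0 = (if i = j then \<alpha> $ Some j * (1 - r $ Some j) / (r $ Some j)\<^sup>2 else 0) +
     (1 - rp) / ap * (\<alpha> $ Some i / r $ Some i) * (\<alpha> $ Some j / r $ Some j)"
      .
    moreover have "partial_deriv i (partial_deriv j (Phi \<alpha>)) ?r = deriv (\<lambda>t. P j (?r + t *\<^sub>R axis i 1)) 0"
      unfolding partial_deriv_def[of i] by (rule deriv_cong_ev[OF ev refl])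
    ultimately show ?thesis by simp
  qed
  then show ?thesis by (simp add: hessian_def vec_eq_iff)
qed

lemma hessian_quad:
  "v \<bullet> (hessian (Phi \<alpha>) (drop_last r) *v v) = quad (\<chi> j. v $ j / r $ Some j)"
proof -
  have "v \<bullet> (hessian (Phi \<alpha>) (drop_last r) *v v) = (\<Sum>i\<in>UNIV. \<Sum>j\<in>UNIV. 
      (if i = j then v $ i * v $ j * (\<alpha> $ Some j * (1 - r $ Some j) / (r $ Some j)\<^sup>2) else 0) +
      (1 - rp) / ap * ((\<alpha> $ Some i * (v $ i / r $ Some i)) * (\<alpha> $ Some j * (v $ j / r $ Some j))))"
    unfolding hessian_Phi inner_vec_def matrix_vector_mult_def
    by (simp add: sum_distrib_left) (intro sum.cong refl, auto simp: field_simps)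
  also have "\<dots> = quad (\<chi> j. v $ j / r $ Some j)"
    unfolding sum.distrib sum_distrib_left[symmetric] sum_distrib_right[symmetric]
    by (simp add: quad_def power2_eq_square field_simps)
  finally show ?thesis .
qed

lemma continuous_on_quad: "continuous_on S quad"
  unfolding quad_def[abs_def] by (intro continuous_intros)

lemma quad_scaleR: "quad (t *\<^sub>R \<theta>) = t\<^sup>2 * quad \<theta>"
proof -
  have "(\<Sum>j\<in>UNIV. \<alpha> $ Some j * (t *\<^sub>R \<theta>) $ j) = t * (\<Sum>j\<in>UNIV. \<alpha> $ Some j * \<theta> $ j)"
    by (simp add: sum_distrib_left mult_ac)
  moreover have "(\<Sum>j\<in>UNIV. \<alpha> $ Some j * (1 - r $ Some j) * ((t *\<^sub>R \<theta>) $ j)\<^sup>2) =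
      t\<^sup>2 * (\<Sum>j\<in>UNIV. \<alpha> $ Some j * (1 - r $ Some j) * (\<theta> $ j)\<^sup>2)"
    by (simp add: sum_distrib_left mult_ac power_mult_distrib)
  ultimately show ?thesis by (simp add: quad_def power_mult_distrib algebra_simps)
qed

section \<open>The root in the last variable\<close>

abbreviation cc :: "real^'m \<Rightarrow> complex" where "cc \<theta> \<equiv> c_fun (rot (drop_last r) \<theta>)"

text \<open>The zero of F in the last variable over the torus point with angles \<theta>, on the
  branch with value r_p at \<theta> = 0; it continues \<open>h_fun\<close> to complex
  arguments.\<close>

definition hh :: "real^'m \<Rightarrow> complex" where "hh \<theta> = - Ln (cc \<theta>)"

lemma cc_0: "cc 0 = of_real (exp (- rp))"
proof -
  have "cc 0 = of_real (real CARD('m) - (\<Sum>j\<in>UNIV. exp (- (r $ Some j))))"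
    by (simp add: c_fun_def rot_def drop_last_def sum_subtractf exp_of_real[symmetric])
  then show ?thesis unfolding sum_exp_drop_last .
qed

lemma hh_0: "hh 0 = of_real rp"
  unfolding hh_def cc_0 by (simp add: Ln_of_real)

lemma continuous_on_cc: "continuous_on S cc"
  unfolding c_fun_def rot_def by (intro continuous_intros)

text \<open>The critical equations make the linear term of ap log hh exactly -i times the sum of the
  \<alpha>_j \<theta>_j. That cancels against the phase of the Fourier integral to leading order in
  N, and what remains in second order is the real form \<open>quad\<close>.\<close>

lemma log_hh_expansion:
  "(\<lambda>\<theta>. of_real ap * (Ln (hh \<theta>) - of_real (ln rp)) + \<i> * of_real (\<Sum>j\<in>UNIV. \<alpha> $ Some j * \<theta> $ j) - of_real (quad \<theta> / 2))
    \<in> O[nhds 0](\<lambda>\<theta>. of_real (norm \<theta>) ^ 3)"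
proof -
  let ?n = "\<lambda>\<theta>::real^'m. complex_of_real (norm \<theta>)"
  let ?\<theta> = "\<lambda>j (\<theta>::real^'m). complex_of_real (\<theta> $ j)"
  let ?r = "\<lambda>j. complex_of_real (r $ Some j)"
  have th: "?\<theta> j \<in> O[nhds 0](?n)" for j
    by (rule bigoI[of _ 1]) (simp add: component_le_norm_cart)
  have tlim: "filterlim (?\<theta> j) (nhds 0) (nhds 0)" for j
  proof -
    have "isCont (?\<theta> j) 0" by (intro continuous_intros)
    from isCont_nhds[OF this] show ?thesis by simp
  qed
  \<comment> \<open>\<open>cc\<close> is a sum of functions of one angle each, so one-variable
    Taylor expansions suffice.\<close>
  let ?g = "\<lambda>j x. exp (- ?r j * exp (\<i> * x))"
  let ?E = "\<lambda>j. exp (- ?r j)"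
  have g: "(\<lambda>\<theta>. ?g j (?\<theta> j \<theta>) - ?E j + \<i> * ?r j * ?E j * ?\<theta> j \<theta> - (?r j - (?r j)\<^sup>2) * ?E j / 2 * (?\<theta> j \<theta>)\<^sup>2) \<in> O[nhds 0](\<lambda>\<theta>. ?n \<theta> ^ 3)" for j
  proof -
    have d1: "deriv (?g j) = (\<lambda>x. - ?r j * \<i> * exp (\<i> * x) * ?g j x)"
      by (intro ext DERIV_imp_deriv) (auto intro!: derivative_eq_intros simp: algebra_simps)
    have d2: "deriv (deriv (?g j)) 0 = (?r j - (?r j)\<^sup>2) * ?E j"
      unfolding d1 by (intro DERIV_imp_deriv) (auto intro!: derivative_eq_intros simp: algebra_simps power2_eq_square)
    have "(\<lambda>z. ?g j z - ?g j 0 - deriv (?g j) 0 * (z - 0) - deriv (deriv (?g j)) 0 / 2 * (z - 0)\<^sup>2) \<in> O[nhds 0](\<lambda>z. (z - 0) ^ 3)"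
      by (rule taylor_second_order[of _ UNIV]) (auto intro!: holomorphic_intros)
    then have "(\<lambda>z. ?g j z - ?E j + \<i> * ?r j * ?E j * z - (?r j - (?r j)\<^sup>2) * ?E j / 2 * z\<^sup>2) \<in> O[nhds 0](\<lambda>z. z ^ 3)"
      unfolding d2 unfolding d1 by (simp add: algebra_simps)
    from landau_o.big.compose[OF this tlim[of j]]
    have "(\<lambda>\<theta>. ?g j (?\<theta> j \<theta>) - ?E j + \<i> * ?r j * ?E j * ?\<theta> j \<theta> - (?r j - (?r j)\<^sup>2) * ?E j / 2 * (?\<theta> j \<theta>)\<^sup>2) \<in> O[nhds 0](\<lambda>\<theta>. ?\<theta> j \<theta> ^ 3)" .
    moreover have "(\<lambda>\<theta>. ?\<theta> j \<theta> ^ 3) \<in> O[nhds 0](\<lambda>\<theta>. ?n \<theta> ^ 3)" by (intro landau_o.big_power th)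
    ultimately show ?thesis by (rule landau_o.big_trans)
  qed
  define \<Delta> where "\<Delta> = (\<lambda>\<theta>. cc \<theta> - cc 0)"
  define \<Delta>1 where "\<Delta>1 = (\<lambda>\<theta>. \<Sum>j\<in>UNIV. \<i> * ?r j * ?E j * ?\<theta> j \<theta>)"
  define \<Delta>2 where "\<Delta>2 = (\<lambda>\<theta>. \<Sum>j\<in>UNIV. - ((?r j - (?r j)\<^sup>2) * ?E j / 2 * (?\<theta> j \<theta>)\<^sup>2))"
  have R: "(\<lambda>\<theta>. \<Delta> \<theta> - \<Delta>1 \<theta> - \<Delta>2 \<theta>) \<in> O[nhds 0](\<lambda>\<theta>. ?n \<theta> ^ 3)"
  proof -
    have "(\<lambda>\<theta>. \<Sum>j\<in>UNIV. - (?g j (?\<theta> j \<theta>) - ?E j + \<i> * ?r j * ?E j * ?\<theta> j \<theta> - (?r j - (?r j)\<^sup>2) * ?E j / 2 * (?\<theta> j \<theta>)\<^sup>2)) \<in> O[nhds 0](\<lambda>\<theta>. ?n \<theta> ^ 3)"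
      by (intro big_sum_in_bigo) (simp only: landau_o.big.uminus_in_iff g)
    moreover have "(\<Sum>j\<in>UNIV. - (?g j (?\<theta> j \<theta>) - ?E j + \<i> * ?r j * ?E j * ?\<theta> j \<theta> - (?r j - (?r j)\<^sup>2) * ?E j / 2 * (?\<theta> j \<theta>)\<^sup>2)) = \<Delta> \<theta> - \<Delta>1 \<theta> - \<Delta>2 \<theta>" for \<theta>
      unfolding \<Delta>_def \<Delta>1_def \<Delta>2_def c_fun_def rot_def drop_last_def sum_subtractf[symmetric]
      by (intro sum.cong refl) (simp add: cis_conv_exp)
    ultimately show ?thesis by simp
  qed
  have D1: "\<Delta>1 \<in> O[nhds 0](?n)"
    unfolding \<Delta>1_def by (intro big_sum_in_bigo) (simp add: th)
  have D2: "\<Delta>2 \<in> O[nhds 0](\<lambda>\<theta>. ?n \<theta> ^ 2)"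
    unfolding \<Delta>2_def by (intro big_sum_in_bigo) (simp add: landau_o.big_power[OF th])
  have n0: "filterlim ?n (nhds 0) (nhds 0)"
  proof -
    have "isCont ?n 0" by (intro continuous_intros)
    from isCont_nhds[OF this] show ?thesis by simp
  qed
  have n_small: "eventually (\<lambda>\<theta>. norm (?n \<theta>) \<le> 1) (nhds 0)"
  proof -
    have "eventually (\<lambda>\<theta>. norm (?n \<theta>) < 1) (nhds 0)"
      by (rule order_tendstoD(2)[OF tendsto_norm[OF n0]]) simp
    then show ?thesis by (rule eventually_mono) simp
  qed
  have n32: "(\<lambda>\<theta>. ?n \<theta> ^ 3) \<in> O[nhds 0](\<lambda>\<theta>. ?n \<theta> ^ 2)"
    by (rule bigoI[of _ 1], rule eventually_mono[OF n_small]) (simp add: norm_power power_decreasing)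
  have n21: "(\<lambda>\<theta>. ?n \<theta> ^ 2) \<in> O[nhds 0](?n)"
    by (rule bigoI[of _ 1], rule eventually_mono[OF n_small]) (auto simp: norm_power norm_mult power2_eq_square intro: mult_left_le)
  have DD: "(\<lambda>\<theta>. \<Delta> \<theta> - \<Delta>1 \<theta>) \<in> O[nhds 0](\<lambda>\<theta>. ?n \<theta> ^ 2)"
    using sum_in_bigo(1)[OF landau_o.big_trans[OF R n32] D2] by simp
  have D: "\<Delta> \<in> O[nhds 0](?n)"
    using sum_in_bigo(1)[OF landau_o.big_trans[OF DD n21] D1] by simp
  have sq: "(\<lambda>\<theta>. (\<Delta> \<theta>)\<^sup>2 - (\<Delta>1 \<theta>)\<^sup>2) \<in> O[nhds 0](\<lambda>\<theta>. ?n \<theta> ^ 3)"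
  proof -
    have "(\<lambda>\<theta>. (\<Delta> \<theta> - \<Delta>1 \<theta>) * (\<Delta> \<theta> + \<Delta>1 \<theta>)) \<in> O[nhds 0](\<lambda>\<theta>. ?n \<theta> ^ 2 * ?n \<theta>)"
      by (intro landau_o.big.mult DD sum_in_bigo(1) D D1)
    then show ?thesis by (simp add: power2_eq_square power3_eq_cube algebra_simps)
  qed
  \<comment> \<open>Composes the two logarithms. Near ?c0 the conditions Re c > 0 and |c| < 1 keep
    both c and - Ln c off the branch cut.\<close>
  let ?G = "\<lambda>c. Ln (- Ln c)"
  let ?c0 = "complex_of_real (exp (- rp))"
  let ?S = "{c. c \<notin> \<real>\<^sub>\<le>\<^sub>0} \<inter> {c. Re (- Ln c) > 0}"
  let ?a = "complex_of_real rp"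
  have opS: "open (ball ?c0 (exp (- rp)) \<inter> ball 0 1)" by auto
  have sub: "Re c > 0 \<and> c \<noteq> 0 \<and> Re (- Ln c) > 0" if "c \<in> ball ?c0 (exp (- rp)) \<inter> ball 0 1" for c
  proof -
    have "\<bar>Re (?c0 - c)\<bar> \<le> cmod (?c0 - c)" by (rule abs_Re_le_cmod)
    moreover have "cmod (?c0 - c) < exp (- rp)" using that by (simp add: dist_norm)
    moreover have "Re (?c0 - c) = exp (- rp) - Re c" by simp
    ultimately have re: "Re c > 0" by linarith
    then have "c \<noteq> 0" by auto
    moreover have "cmod c < 1" using that by simp
    ultimately show ?thesis using re by (simp add: Re_Ln)
  qed
  have c0: "?c0 \<in> ball ?c0 (exp (- rp)) \<inter> ball 0 1" using r_pos[of None] by (simp add: norm_exp_eq_Re)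
  have nonpos: "c \<notin> \<real>\<^sub>\<le>\<^sub>0" "- Ln c \<notin> \<real>\<^sub>\<le>\<^sub>0" if "c \<in> ball ?c0 (exp (- rp)) \<inter> ball 0 1" for c
    using sub[OF that] by (auto simp: complex_nonpos_Reals_iff)
  have hG: "?G holomorphic_on ball ?c0 (exp (- rp)) \<inter> ball 0 1"
    by (intro holomorphic_intros) (use nonpos in blast)+
  have dG: "(?G has_field_derivative 1 / (c * Ln c)) (at c)" if "c \<in> ball ?c0 (exp (- rp)) \<inter> ball 0 1" for c
  proof -
    have "Ln c \<noteq> 0" using sub[OF that] by auto
    then show ?thesis using nonpos[OF that] sub[OF that]
      by (auto intro!: derivative_eq_intros simp: field_simps)
  qed
  have Lc0: "Ln ?c0 = - ?a" by (simp add: Ln_of_real)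
  have c0n: "?c0 \<noteq> 0" "?a \<noteq> 0" using r_pos[of None] by auto
  have dG1: "deriv ?G ?c0 = - 1 / (?c0 * ?a)"
    using DERIV_imp_deriv[OF dG[OF c0]] c0n by (simp add: Lc0)
  have dG2: "deriv (deriv ?G) ?c0 = - (1 - ?a) / (?c0 * ?a)\<^sup>2"
  proof -
    have ev: "eventually (\<lambda>c. deriv ?G c = 1 / (c * Ln c)) (nhds ?c0)"
      using eventually_nhds_in_open[OF opS c0] by eventually_elim (rule DERIV_imp_deriv[OF dG])
    have "((\<lambda>c. 1 / (c * Ln c)) has_field_derivative - (1 - ?a) / (?c0 * ?a)\<^sup>2) (at ?c0)"
      using nonpos(1)[OF c0] c0n by (auto intro!: derivative_eq_intros simp: Lc0 field_simps power2_eq_square)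
    then show ?thesis using deriv_cong_ev[OF ev refl] DERIV_imp_deriv by metis
  qed
  have "filterlim cc (nhds (cc 0)) (nhds 0)"
  proof -
    have "isCont cc 0" using continuous_on_cc[of UNIV] by (simp add: continuous_on_eq_continuous_at)
    then show ?thesis by (rule isCont_nhds)
  qed
  then have clim: "filterlim cc (nhds ?c0) (nhds 0)" unfolding cc_0 .
  from landau_o.big.compose[OF taylor_second_order[OF hG opS c0] clim]
  have T: "(\<lambda>\<theta>. ?G (cc \<theta>) - ?G ?c0 - deriv ?G ?c0 * \<Delta> \<theta> - deriv (deriv ?G) ?c0 / 2 * (\<Delta> \<theta>)\<^sup>2) \<in> O[nhds 0](\<lambda>\<theta>. \<Delta> \<theta> ^ 3)"
    by (simp add: \<Delta>_def cc_0)
  have T3: "(\<lambda>\<theta>. ?G (cc \<theta>) - ?G ?c0 - deriv ?G ?c0 * \<Delta> \<theta> - deriv (deriv ?G) ?c0 / 2 * (\<Delta> \<theta>)\<^sup>2) \<in> O[nhds 0](\<lambda>\<theta>. ?n \<theta> ^ 3)"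
    by (rule landau_o.big_trans[OF T landau_o.big_power[OF D]])
  \<comment> \<open>\<Delta> is replaced by its linear and quadratic parts in the first-order term
    and by its linear part alone in the second-order term; both replacements cost a cubic
    error.\<close>
  have T4: "(\<lambda>\<theta>. (?G (cc \<theta>) - ?G ?c0 - deriv ?G ?c0 * \<Delta> \<theta> - deriv (deriv ?G) ?c0 / 2 * (\<Delta> \<theta>)\<^sup>2) +
      deriv ?G ?c0 * (\<Delta> \<theta> - \<Delta>1 \<theta> - \<Delta>2 \<theta>) + deriv (deriv ?G) ?c0 / 2 * ((\<Delta> \<theta>)\<^sup>2 - (\<Delta>1 \<theta>)\<^sup>2)) \<in> O[nhds 0](\<lambda>\<theta>. ?n \<theta> ^ 3)"
    by (intro sum_in_bigo(1) T3 bigo_cmult R sq)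
  have "(\<lambda>\<theta>. of_real ap * ((?G (cc \<theta>) - ?G ?c0 - deriv ?G ?c0 * \<Delta> \<theta> - deriv (deriv ?G) ?c0 / 2 * (\<Delta> \<theta>)\<^sup>2) +
      deriv ?G ?c0 * (\<Delta> \<theta> - \<Delta>1 \<theta> - \<Delta>2 \<theta>) + deriv (deriv ?G) ?c0 / 2 * ((\<Delta> \<theta>)\<^sup>2 - (\<Delta>1 \<theta>)\<^sup>2))) \<in> O[nhds 0](\<lambda>\<theta>. ?n \<theta> ^ 3)"
    by (rule bigo_cmult[OF T4])
  moreover have "of_real ap * ((?G (cc \<theta>) - ?G ?c0 - deriv ?G ?c0 * \<Delta> \<theta> - deriv (deriv ?G) ?c0 / 2 * (\<Delta> \<theta>)\<^sup>2) +
      deriv ?G ?c0 * (\<Delta> \<theta> - \<Delta>1 \<theta> - \<Delta>2 \<theta>) + deriv (deriv ?G) ?c0 / 2 * ((\<Delta> \<theta>)\<^sup>2 - (\<Delta>1 \<theta>)\<^sup>2)) =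
    of_real ap * (Ln (hh \<theta>) - of_real (ln rp)) + \<i> * of_real (\<Sum>j\<in>UNIV. \<alpha> $ Some j * \<theta> $ j) - of_real (quad \<theta> / 2)" for \<theta>
  proof -
    have k: "of_real ap * (?r j * ?E j) / (?c0 * ?a) = of_real (\<alpha> $ Some j)" for j
    proof -
      have "ap * (r $ Some j * exp (- (r $ Some j))) / (exp (- rp) * rp) = \<alpha> $ Some j"
        using critical[of j] r_pos[of "Some j"] by (simp add: field_simps)
      then have "complex_of_real (ap * (r $ Some j * exp (- (r $ Some j))) / (exp (- rp) * rp)) = of_real (\<alpha> $ Some j)" by simp
      then show ?thesis by (simp add: exp_of_real[symmetric])
    qed
    have s1: "of_real ap * \<Delta>1 \<theta> / (?c0 * ?a) = \<i> * of_real (\<Sum>j\<in>UNIV. \<alpha> $ Some j * \<theta> $ j)"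
    proof -
      have "of_real ap * \<Delta>1 \<theta> / (?c0 * ?a) = (\<Sum>j\<in>UNIV. \<i> * (of_real ap * (?r j * ?E j) / (?c0 * ?a)) * ?\<theta> j \<theta>)"
        by (simp add: \<Delta>1_def sum_distrib_left sum_divide_distrib mult_ac)
      then show ?thesis unfolding k by (simp add: sum_distrib_left mult_ac)
    qed
    have s2: "of_real ap * \<Delta>2 \<theta> / (?c0 * ?a) = - of_real (\<Sum>j\<in>UNIV. \<alpha> $ Some j * (1 - r $ Some j) * (\<theta> $ j)\<^sup>2) / 2"
    proof -
      have "of_real ap * \<Delta>2 \<theta> / (?c0 * ?a) = (\<Sum>j\<in>UNIV. - ((of_real ap * (?r j * ?E j) / (?c0 * ?a)) * (1 - ?r j) * (?\<theta> j \<theta>)\<^sup>2) / 2)"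
        unfolding \<Delta>2_def sum_distrib_left sum_divide_distrib
        by (intro sum.cong refl) (simp add: algebra_simps power2_eq_square add_divide_distrib diff_divide_distrib)
      then show ?thesis unfolding k by (simp add: sum_divide_distrib sum_negf)
    qed
    have s3: "of_real ap * (\<Delta>1 \<theta>)\<^sup>2 / (?c0 * ?a)\<^sup>2 = - of_real ((\<Sum>j\<in>UNIV. \<alpha> $ Some j * \<theta> $ j)\<^sup>2 / ap)"
    proof -
      have "of_real ap * (\<Delta>1 \<theta>)\<^sup>2 / (?c0 * ?a)\<^sup>2 = (of_real ap * \<Delta>1 \<theta> / (?c0 * ?a))\<^sup>2 / of_real ap"
      proof -
        have "A * X\<^sup>2 / K\<^sup>2 = (A * X / K)\<^sup>2 / A" if "A \<noteq> 0" for A X K :: complex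
          using that by (simp add: power2_eq_square)
        then show ?thesis using alpha_pos[of None] by (metis less_irrefl of_real_eq_0_iff)
      qed
      then show ?thesis unfolding s1 by (simp add: power_mult_distrib)
    qed
    have "Ln (hh \<theta>) = ?G (cc \<theta>)" by (simp add: hh_def)
    moreover have "?G ?c0 = of_real (ln rp)" using r_pos[of None] by (simp add: Lc0 Ln_of_real)
    moreover have "of_real ap * ((?G (cc \<theta>) - ?G ?c0 - deriv ?G ?c0 * \<Delta> \<theta> - deriv (deriv ?G) ?c0 / 2 * (\<Delta> \<theta>)\<^sup>2) +
      deriv ?G ?c0 * (\<Delta> \<theta> - \<Delta>1 \<theta> - \<Delta>2 \<theta>) + deriv (deriv ?G) ?c0 / 2 * ((\<Delta> \<theta>)\<^sup>2 - (\<Delta>1 \<theta>)\<^sup>2)) =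
      of_real ap * (?G (cc \<theta>) - ?G ?c0) + of_real ap * \<Delta>1 \<theta> / (?c0 * ?a) + of_real ap * \<Delta>2 \<theta> / (?c0 * ?a)
        + (1 - ?a) / 2 * (of_real ap * (\<Delta>1 \<theta>)\<^sup>2 / (?c0 * ?a)\<^sup>2)"
      unfolding dG1 dG2 by (simp add: algebra_simps add_divide_distrib diff_divide_distrib)
    ultimately show ?thesis
      unfolding s1 s2 s3 quad_def by (simp add: algebra_simps add_divide_distrib diff_divide_distrib)
  qed
  ultimately show ?thesis by (simp only:)
qed

end

section \<open>Consequences of strict minimality\<close>

context critical_point

begin

abbreviation (input) "\<rho> \<equiv> drop_last r"

lemma rho_nth: "\<rho> $ j = r $ Some j" and rho_pos: "\<rho> $ j > 0"
  using r_pos by (simp_all add: drop_last_def)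

text \<open>Joining w and z into one vector turns e^(-z) = c(w) into a zero of \<open>F_fun\<close>
  in the closed polydisc. All later uses of strict minimality pass through this form.\<close>

lemma minimal:
  fixes w :: "complex^'m"
  assumes "\<And>j. cmod (w $ j) \<le> \<rho> $ j" "cmod z \<le> rp" "exp (- z) = c_fun w"
  shows "w = (\<chi> j. of_real (\<rho> $ j))" "z = of_real rp"
proof -
  define y :: "complex^('m option)" where "y = (\<chi> i. case i of None \<Rightarrow> z | Some j \<Rightarrow> w $ j)"
  have "F_fun y = exp (- z) + (\<Sum>j\<in>UNIV. exp (- (w $ j))) - of_nat CARD('m)"
    by (simp add: F_fun_def y_def UNIV_option_conv sum.reindex)
  also have "\<dots> = exp (- z) - c_fun w" by (simp add: c_fun_def sum_subtractf)
  finally have "F_fun y = 0" using assms(3) by simp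
  moreover have "cmod (y $ i) \<le> r $ i" for i
    using assms(1,2) by (cases i) (auto simp: y_def rho_nth)
  ultimately have "y \<in> {y. (\<forall>i. cmod (y $ i) \<le> r $ i) \<and> F_fun y = 0}" by simp
  then have y: "y = (\<chi> i. complex_of_real (r $ i))" using r_minimal unfolding strictly_minimal_def by blast
  have "y $ None = of_real rp" "\<And>j. y $ Some j = of_real (r $ Some j)" unfolding y by simp_all
  then show "w = (\<chi> j. of_real (\<rho> $ j))" "z = of_real rp" by (simp_all add: y_def vec_eq_iff rho_nth)
qed

lemma norm_rot: "cmod (rot \<rho> \<theta> $ j) = \<rho> $ j"
  using rho_pos[of j] by (simp add: rot_def norm_mult)

lemma norm_scaled_rot: "cmod \<zeta> \<le> 1 \<Longrightarrow> cmod ((\<zeta> *s rot \<rho> \<theta>) $ j) \<le> \<rho> $ j"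
  using rho_pos[of j] by (simp add: norm_mult norm_rot mult_left_le_one_le)

lemma compact_torus_box: "compact (torus_box :: (real^'m) set)"
  by (simp add: torus_box_def)

text \<open>Scaling by |\<zeta>| \<le> 1 stays in the polydisc, so by minimality a zero with |z|
  \<le> r_p would have z = r_p. The radius r_p / 2 is one choice below r_p; it serves for
  convergence on the whole torus and not for the final growth rate.\<close>

lemma global_bound:
  assumes s: "s > 0"
  obtains C R where "C \<ge> 0" "R > 1"
    "\<And>\<theta> n M. \<theta> \<in> torus_box \<Longrightarrow> cmod (x_coeff s n M (rot \<rho> \<theta>)) \<le> C / (R ^ M * (rp / 2) ^ n)"
    "\<And>\<theta> \<zeta> z. \<theta> \<in> torus_box \<Longrightarrow> cmod \<zeta> < R \<Longrightarrow> cmod z \<le> rp / 2 \<Longrightarrow> exp (- z) \<noteq> c_fun (\<zeta> *s rot \<rho> \<theta>)"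
proof -
  let ?K = "rot \<rho> ` (torus_box :: (real^'m) set)"
  have K: "compact ?K" by (intro compact_continuous_image compact_torus_box continuous_on_rot)
  have half: "rp / 2 > 0" using r_pos[of None] by simp
  have nz: "exp (- z) \<noteq> c_fun (\<zeta> *s w)" if wK: "w \<in> ?K" and \<zeta>: "cmod \<zeta> \<le> 1" and z: "cmod z \<le> rp / 2" for w \<zeta> z
  proof
    assume eq: "exp (- z) = c_fun (\<zeta> *s w)"
    obtain \<theta> where \<theta>: "w = rot \<rho> \<theta>" using wK by auto
    have "cmod z \<le> rp" using z r_pos[of None] by simp
    from minimal(2)[OF norm_scaled_rot[OF \<zeta>] this eq[unfolded \<theta>]] have "z = of_real rp" .
    then show False using z r_pos[of None] by simp
  qed
  show thesis
  proof (rule x_coeff_bound[OF s K half nz])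
    fix C R :: real
    assume "C \<ge> 0" "R > 1"
      and a: "\<And>w n M. w \<in> ?K \<Longrightarrow> cmod (x_coeff s n M w) \<le> C / (R ^ M * (rp / 2) ^ n)"
      and b: "\<And>w \<zeta> z. w \<in> ?K \<Longrightarrow> cmod \<zeta> < R \<Longrightarrow> cmod z \<le> rp / 2 \<Longrightarrow> exp (- z) \<noteq> c_fun (\<zeta> *s w)"
    show thesis by (rule that[OF \<open>C \<ge> 0\<close> \<open>R > 1\<close> a b]) auto
  qed
qed

lemma cis_eq_1_torus:
  assumes "cis t = 1" "\<bar>t\<bar> \<le> pi" shows "t = 0"
proof -
  have "cos t = 1" using assms(1) by (simp add: complex_eq_iff)
  then obtain n :: int where n: "t = of_int n * 2 * pi" by (auto simp: cos_one_2pi_int)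
  have "\<bar>of_int n :: real\<bar> * (2 * pi) \<le> pi" using assms(2) unfolding n by (simp add: abs_mult)
  then have "\<bar>of_int n :: real\<bar> * 2 \<le> 1" using pi_gt_zero by (simp add: field_simps)
  then have "n = 0" by linarith
  then show ?thesis by (simp add: n)
qed

text \<open>A zero with |z| \<le> r_p over the torus forces all angles to vanish. On the compact set
  of angles of norm at least \<eta> the nearest zero therefore has modulus above r_p, which gives a
  geometric gain over r_p^(-n).\<close>

lemma far_bound:
  assumes s: "s > 0" and \<eta>: "\<eta> > 0"
  obtains B R where "B \<ge> 0" "R > rp"
    "\<And>\<theta> n. \<theta> \<in> torus_box \<Longrightarrow> norm \<theta> \<ge> \<eta> \<Longrightarrow> cmod (X_coeff s n (rot \<rho> \<theta>)) \<le> B / R ^ n"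
proof -
  obtain C R0 where C: "C \<ge> 0" "R0 > 1"
    "\<And>\<theta> n M. \<theta> \<in> torus_box \<Longrightarrow> cmod (x_coeff s n M (rot \<rho> \<theta>)) \<le> C / (R0 ^ M * (rp / 2) ^ n)"
    "\<And>\<theta> \<zeta> z. \<theta> \<in> torus_box \<Longrightarrow> cmod \<zeta> < R0 \<Longrightarrow> cmod z \<le> rp / 2 \<Longrightarrow> exp (- z) \<noteq> c_fun (\<zeta> *s rot \<rho> \<theta>)"
    by (rule global_bound[OF s]) blast
  define K where "K = (torus_box :: (real^'m) set) - ball 0 \<eta>"
  have K: "compact K" unfolding K_def by (intro compact_diff compact_torus_box) simp
  let ?g = "\<lambda>x. exp (- snd x) - cc (fst x)"
  have gc: "continuous_on S ?g" for S :: "((real^'m) \<times> complex) set"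
    by (intro continuous_intros continuous_on_compose2[OF continuous_on_rot[of UNIV \<rho>]]) auto
  \<comment> \<open>The bound 2 r_p serves only to make the set of zeros compact.\<close>
  define Z where "Z = {x \<in> K \<times> cball 0 (2 * rp). ?g x = 0}"
  have T: "compact (K \<times> cball (0::complex) (2 * rp))" using K by (intro compact_Times) auto
  have "closedin (top_of_set (K \<times> cball 0 (2 * rp))) Z"
    unfolding Z_def by (rule continuous_closedin_preimage_constant[OF gc])
  then have Zc: "compact Z" using T by (rule closedin_compact[rotated])
  have Zbig: "cmod (snd x) > rp" if "x \<in> Z" for x
  proof (rule ccontr)
    assume "\<not> cmod (snd x) > rp"
    then have le: "cmod (snd x) \<le> rp" by simp
    have x: "fst x \<in> torus_box" "norm (fst x) \<ge> \<eta>" "exp (- snd x) = cc (fst x)"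
      using that by (auto simp: Z_def K_def)
    have w: "rot \<rho> (fst x) = (\<chi> j. of_real (\<rho> $ j))"
      by (rule minimal(1)[OF _ le x(3)]) (simp add: norm_rot)
    have "fst x $ j = 0" for j
    proof (rule cis_eq_1_torus)
      have "rot \<rho> (fst x) $ j = of_real (\<rho> $ j)" unfolding w by simp
      then show "cis (fst x $ j) = 1" using rho_pos[of j] by (simp add: rot_def)
      show "\<bar>fst x $ j\<bar> \<le> pi" using x(1) by (auto simp: torus_box_def mem_box_cart abs_le_iff) (smt (verit))
    qed
    then have "fst x = 0" by (simp add: vec_eq_iff)
    then show False using x(2) \<eta> by simp
  qed
  have "\<exists>R1>rp. R1 \<le> 2 * rp \<and> (\<forall>\<theta>\<in>K. \<forall>z. cmod z < R1 \<longrightarrow> ?g (\<theta>, z) \<noteq> 0)"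
  proof (cases "Z = {}")
    case True
    then show ?thesis using r_pos[of None] by (intro exI[of _ "2 * rp"]) (auto simp: Z_def)
  next
    case False
    have "continuous_on Z (\<lambda>x. cmod (snd x))" by (intro continuous_intros)
    from continuous_attains_inf[OF Zc False this] obtain x0 where x0: "x0 \<in> Z" "\<And>x. x \<in> Z \<Longrightarrow> cmod (snd x0) \<le> cmod (snd x)" by blast
    show ?thesis
    proof (intro exI[of _ "cmod (snd x0)"] conjI ballI allI impI Zbig x0)
      show "cmod (snd x0) \<le> 2 * rp" using x0(1) by (auto simp: Z_def)
      fix \<theta> z assume a: "\<theta> \<in> K" "cmod z < cmod (snd x0)"
      show "?g (\<theta>, z) \<noteq> 0"
      proof
        assume "?g (\<theta>, z) = 0"
        then have "(\<theta>, z) \<in> Z" using a \<open>cmod (snd x0) \<le> 2 * rp\<close> by (auto simp: Z_def)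
        from x0(2)[OF this] show False using a by simp
      qed
    qed
  qed
  then obtain R1 where R1: "R1 > rp" "\<And>\<theta> z. \<theta> \<in> K \<Longrightarrow> cmod z < R1 \<Longrightarrow> exp (- z) \<noteq> cc \<theta>" by auto
  \<comment> \<open>Halfway between r_p and the zero-free radius R1, so that |F| has a positive
    minimum for |z| \<le> R.\<close>
  define R where "R = (rp + R1) / 2"
  have R: "rp < R" "R < R1" using R1(1) by (auto simp: R_def)
  have T': "compact (K \<times> cball (0::complex) R)" using K by (intro compact_Times) auto
  have "\<exists>b>0. \<forall>x\<in>K \<times> cball 0 R. b \<le> cmod (?g x)"
  proof (cases "K \<times> cball (0::complex) R = {}")
    case True
    then show ?thesis by (intro exI[of _ 1]) auto
  next
    case False
    have "continuous_on (K \<times> cball 0 R) (\<lambda>x. cmod (?g x))" by (intro continuous_on_norm gc)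
    from continuous_attains_inf[OF T' False this] obtain x0 where x0: "x0 \<in> K \<times> cball 0 R"
      "\<forall>x\<in>K \<times> cball 0 R. cmod (?g x0) \<le> cmod (?g x)" by blast
    have "cmod (?g x0) > 0" using x0(1) R1(2)[of "fst x0" "snd x0"] R by (cases x0) auto
    then show ?thesis using x0 by blast
  qed
  then obtain b where b: "b > 0" "\<And>\<theta> z. \<theta> \<in> K \<Longrightarrow> cmod z \<le> R \<Longrightarrow> b \<le> cmod (exp (- z) - cc \<theta>)" by force
  show thesis
  proof (rule that[of "b powr (- s)" R])
    fix \<theta> :: "real^'m" and n assume \<theta>: "\<theta> \<in> torus_box" "norm \<theta> \<ge> \<eta>"
    then have K: "\<theta> \<in> K" by (simp add: K_def)
    show "cmod (X_coeff s n (rot \<rho> \<theta>)) \<le> b powr (- s) / R ^ n"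
      by (rule X_coeff_far_bound[OF C(1,2) _ s C(3)[OF \<theta>(1)] C(4)[OF \<theta>(1)] _ R(2) R1(2)[OF K] b(1) b(2)[OF K]])
         (use r_pos[of None] R in auto)
  qed (use R in auto)
qed

section \<open>Behaviour near the positive point\<close>

text \<open>Supplies the hypothesis \<open>small\<close> of \<open>X_coeff_expansion\<close>. At
  \<theta> = 0 the value c(t \<rho>) is largest at t = 1, where it is e^(-r_p); uniform continuity
  carries the estimate to small \<theta> for all t at once.\<close>

lemma cc_near_0:
  obtains \<eta> where "\<eta> > 0" "\<And>\<theta>. norm \<theta> < \<eta> \<Longrightarrow> cc \<theta> \<noteq> 0" 
    "\<And>\<theta> t z. norm \<theta> < \<eta> \<Longrightarrow> 0 \<le> t \<Longrightarrow> t \<le> 1 \<Longrightarrow> cmod z < rp / 2 \<Longrightarrow> cmod (exp z * c_fun (of_real t *s rot \<rho> \<theta>)) < 1"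
proof -
  let ?T = "cball (0::real^'m) 1 \<times> {0..1::real}"
  let ?g = "\<lambda>x. c_fun (of_real (snd x) *s rot \<rho> (fst x))"
  have gc: "continuous_on ?T ?g"
    by (intro continuous_intros)
       (auto simp: vector_scalar_mult_def rot_def intro!: continuous_intros)
  have "uniformly_continuous_on ?T ?g" by (intro compact_uniformly_continuous gc compact_Times) auto
  \<comment> \<open>The first bound keeps \<open>cc\<close> away from 0; the second keeps |c| below
    e^(-r_p/2), which compensates |e^z| \<le> e^(r_p/2).\<close>
  define e where "e = min (exp (- rp) / 2) (exp (- (rp / 2)) - exp (- rp))"
  have e: "e > 0" using r_pos[of None] by (auto simp: e_def)
  obtain d where d: "d > 0" "\<And>x x'. x \<in> ?T \<Longrightarrow> x' \<in> ?T \<Longrightarrow> dist x' x < d \<Longrightarrow> dist (?g x') (?g x) < e"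
    using \<open>uniformly_continuous_on ?T ?g\<close> e unfolding uniformly_continuous_on_def by metis
  have close: "cmod (?g (\<theta>, t) - ?g (0, t)) < e" if "norm \<theta> < min d 1" "0 \<le> t" "t \<le> 1" for \<theta> t
    using d(2)[of "(0, t)" "(\<theta>, t)"] that by (auto simp: dist_norm norm_Pair)
  have g0: "cmod (?g (0, t)) \<le> exp (- rp)" if t: "0 \<le> t" "t \<le> 1" for t
  proof -
    have "?g (0, t) = of_real (\<Sum>j\<in>UNIV. 1 - exp (- (t * r $ Some j)))"
      by (simp add: c_fun_def rot_def rho_nth exp_of_real[symmetric])
    moreover have "(\<Sum>j\<in>UNIV. 1 - exp (- (t * r $ Some j))) \<le> (\<Sum>j\<in>UNIV. 1 - exp (- (r $ Some j)))"
      using t r_pos by (intro sum_mono) (simp add: mult_left_le_one_le less_imp_le)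
    moreover have "(\<Sum>j\<in>UNIV. 1 - exp (- (r $ Some j))) = exp (- rp)"
      using sum_exp_drop_last by (simp add: sum_subtractf)
    moreover have "0 \<le> (\<Sum>j\<in>UNIV. 1 - exp (- (t * r $ Some j)))"
      using t r_pos by (intro sum_nonneg) (simp add: less_imp_le)
    ultimately show ?thesis by (simp only: norm_of_real)
  qed
  show thesis
  proof (rule that[of "min d 1"])
    show "min d 1 > 0" using d by simp
    fix \<theta> :: "real^'m" assume \<theta>: "norm \<theta> < min d 1"
    have "cmod (cc \<theta> - cc 0) < e" using close[OF \<theta>, of 1] by simp
    moreover have "cmod (cc 0) = exp (- rp)" unfolding cc_0 by (simp only: norm_of_real abs_exp_cancel)
    moreover have "e \<le> exp (- rp) / 2" unfolding e_def by (rule min.cobounded1)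
    moreover have "exp (- rp) > 0" by simp
    ultimately have "cmod (cc \<theta> - cc 0) < cmod (cc 0)" by linarith
    then show "cc \<theta> \<noteq> 0" by auto
    fix t :: real and z assume t: "0 \<le> t" "t \<le> 1" and z: "cmod (z::complex) < rp / 2"
    have "cmod (?g (\<theta>, t)) \<le> cmod (?g (0, t)) + cmod (?g (\<theta>, t) - ?g (0, t))"
      by (metis add.commute diff_add_cancel norm_triangle_ineq)
    also have "\<dots> < exp (- rp) + e" using g0[OF t] close[OF \<theta> t] by simp
    also have "\<dots> \<le> exp (- (rp / 2))"
    proof -
      have "e \<le> exp (- (rp / 2)) - exp (- rp)" unfolding e_def by (rule min.cobounded2)
      then show ?thesis by linarith
    qed
    finally have 1: "cmod (c_fun (of_real t *s rot \<rho> \<theta>)) < exp (- (rp / 2))" by simp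
    have "Re z \<le> cmod z" by (rule complex_Re_le_cmod)
    then have 2: "cmod (exp z) \<le> exp (rp / 2)" using z by simp
    have "cmod (exp z * c_fun (of_real t *s rot \<rho> \<theta>)) < exp (rp / 2) * exp (- (rp / 2))"
      unfolding norm_mult using 1 2 by (intro mult_le_less_imp_less) auto
    then show "cmod (exp z * c_fun (of_real t *s rot \<rho> \<theta>)) < 1" by (simp add: exp_add[symmetric])
  qed
qed

lemma continuous_hh_at_0: "isCont hh 0"
proof -
  have "isCont cc 0" using continuous_on_cc[of UNIV] by (simp add: continuous_on_eq_continuous_at)
  then show ?thesis unfolding hh_def[abs_def] 
    by (intro continuous_intros) (auto simp: cc_0 complex_nonpos_Reals_iff)
qed

text \<open>hh \<theta> is a zero of F over the torus, so |hh \<theta>| < r_p would contradict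
  minimality.\<close>

lemma eventually_hh_ge: "eventually (\<lambda>\<theta>. Re (Ln (hh \<theta>)) \<ge> ln rp \<and> hh \<theta> \<noteq> 0 \<and> exp (- hh \<theta>) = cc \<theta>) (nhds 0)"
proof -
  obtain \<eta> where \<eta>: "\<eta> > 0" "\<And>\<theta>. norm \<theta> < \<eta> \<Longrightarrow> cc \<theta> \<noteq> 0" by (rule cc_near_0) blast
  have "eventually (\<lambda>\<theta>. \<theta> \<in> ball (0::real^'m) \<eta>) (nhds 0)" using \<eta> by (intro eventually_nhds_in_open) auto
  then show ?thesis
  proof eventually_elim
    case (elim \<theta>)
    then have e: "exp (- hh \<theta>) = cc \<theta>" using \<eta>(2)[of \<theta>] by (simp add: hh_def)
    have "cmod (hh \<theta>) \<ge> rp"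
    proof (rule ccontr)
      assume "\<not> rp \<le> cmod (hh \<theta>)"
      then have lt: "cmod (hh \<theta>) < rp" by simp
      have "hh \<theta> = of_real rp" by (rule minimal(2)[OF _ less_imp_le[OF lt] e]) (simp add: norm_rot)
      then show False using lt r_pos[of None] by simp
    qed
    moreover from this have "hh \<theta> \<noteq> 0" using r_pos[of None] by auto
    ultimately show ?case using e r_pos[of None] by (simp add: Re_Ln)
  qed
qed

text \<open>The linear term of \<open>log_hh_expansion\<close> is purely imaginary and disappears
  from the real part.\<close>

lemma quad_near:
  "\<exists>C\<ge>0. eventually (\<lambda>\<theta>. \<bar>ap * (Re (Ln (hh \<theta>)) - ln rp) - quad \<theta> / 2\<bar> \<le> C * norm \<theta> ^ 3) (nhds 0)"
proof -
  obtain C where C: "C > 0" and ev: "eventually (\<lambda>\<theta>. norm (of_real ap * (Ln (hh \<theta>) - of_real (ln rp)) + \<i> * of_real (\<Sum>j\<in>UNIV. \<alpha> $ Some j * \<theta> $ j) - of_real (quad \<theta> / 2)) \<le> C * norm (complex_of_real (norm \<theta>) ^ 3)) (nhds 0)"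
    using log_hh_expansion by (rule landau_o.bigE)
  have "eventually (\<lambda>\<theta>. \<bar>ap * (Re (Ln (hh \<theta>)) - ln rp) - quad \<theta> / 2\<bar> \<le> C * norm \<theta> ^ 3) (nhds 0)"
    using ev
  proof eventually_elim
    case (elim \<theta>)
    let ?z = "of_real ap * (Ln (hh \<theta>) - of_real (ln rp)) + \<i> * of_real (\<Sum>j\<in>UNIV. \<alpha> $ Some j * \<theta> $ j) - of_real (quad \<theta> / 2)"
    have "Re ?z = ap * (Re (Ln (hh \<theta>)) - ln rp) - quad \<theta> / 2" by simp
    then have "\<bar>ap * (Re (Ln (hh \<theta>)) - ln rp) - quad \<theta> / 2\<bar> \<le> norm ?z" using abs_Re_le_cmod[of ?z] by simp
    also have "\<dots> \<le> C * norm \<theta> ^ 3" using elim by (simp add: norm_power)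
    finally show ?case .
  qed
  then show ?thesis using C by (intro exI[of _ C]) auto
qed

section \<open>Positive definiteness of the Hessian\<close>

text \<open>Along the ray t x the form scales like t^2 and the error like t^3, while log |hh| \<ge>
  log r_p near 0. Dividing by t^2 and letting t decrease to 0 excludes a negative value.\<close>

lemma quad_nonneg: "quad x \<ge> 0"
proof (rule ccontr)
  assume neg: "\<not> quad x \<ge> 0"
  obtain C where C: "C \<ge> 0" and ev: "eventually (\<lambda>\<theta>. \<bar>ap * (Re (Ln (hh \<theta>)) - ln rp) - quad \<theta> / 2\<bar> \<le> C * norm \<theta> ^ 3) (nhds 0)"
    using quad_near by blast
  have "eventually (\<lambda>\<theta>. - quad \<theta> / 2 \<le> C * norm \<theta> ^ 3) (nhds 0)"
    using ev eventually_hh_ge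
  proof eventually_elim
    case (elim \<theta>)
    have "0 \<le> ap * (Re (Ln (hh \<theta>)) - ln rp)" using elim alpha_pos[of None]
      by (intro mult_nonneg_nonneg) (simp_all del: Re_Ln add: less_imp_le)
    then show ?case using elim by linarith
  qed
  moreover have "filterlim (\<lambda>t::real. t *\<^sub>R x) (nhds 0) (at_right 0)"
    by (rule tendsto_eq_intros | simp)+
  ultimately have "eventually (\<lambda>t. - quad (t *\<^sub>R x) / 2 \<le> C * norm (t *\<^sub>R x) ^ 3) (at_right 0)"
    by (rule eventually_compose_filterlim)
  then have "eventually (\<lambda>t. - quad x / 2 \<le> C * norm x ^ 3 * t) (at_right 0)"
    using eventually_at_right_less[of "0::real"]
  proof eventually_elim
    case (elim t)
    have "t\<^sup>2 * (- quad x / 2) \<le> t\<^sup>2 * (C * norm x ^ 3 * t)"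
      using elim by (simp add: quad_scaleR power_mult_distrib power2_eq_square power3_eq_cube mult_ac)
    then show ?case by (subst (asm) mult_le_cancel_left_pos) (use elim(2) in auto)
  qed
  moreover have "((\<lambda>t. C * norm x ^ 3 * t) \<longlongrightarrow> 0) (at_right 0)"
    by (rule tendsto_eq_intros | simp)+
  then have "eventually (\<lambda>t. C * norm x ^ 3 * t < - quad x / 2) (at_right 0)"
    by (rule order_tendstoD) (use neg in auto)
  ultimately have "eventually (\<lambda>t::real. False) (at_right 0)" by eventually_elim simp
  then show False by simp
qed

abbreviation (input) "H \<equiv> hessian (Phi \<alpha>) (drop_last r)"

lemma hessian_pd: "positive_definite H"
proof (rule psd_nonsingular_imp_pd[OF _ _ nondegenerate])
  show "transpose H = H" by (auto simp: hessian_Phi transpose_def vec_eq_iff mult_ac)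
  show "0 \<le> v \<bullet> (H *v v)" for v unfolding hessian_quad by (rule quad_nonneg)
qed

lemma quad_pos: "x \<noteq> 0 \<Longrightarrow> quad x > 0"
proof -
  assume x: "x \<noteq> 0"
  define v where "v = (\<chi> j. r $ Some j * x $ j)"
  have xv: "x = (\<chi> j. v $ j / r $ Some j)" using r_pos by (auto simp: v_def vec_eq_iff less_imp_neq[symmetric])
  then have "v \<noteq> 0" using x by (auto simp: vec_eq_iff)
  then have "0 < v \<bullet> (hessian (Phi \<alpha>) (drop_last r) *v v)"
    using hessian_pd unfolding positive_definite_def by blast
  then show ?thesis unfolding hessian_quad xv[symmetric] .
qed

lemma quad_lower: obtains \<kappa> where "\<kappa> > 0" "\<And>x. quad x \<ge> \<kappa> * (norm x)\<^sup>2"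
proof -
  have ne: "sphere (0::real^'m) 1 \<noteq> {}" by simp
  from continuous_attains_inf[OF compact_sphere ne continuous_on_quad]
  obtain x0 :: "real^'m" where x0: "x0 \<in> sphere 0 1" "\<And>x. x \<in> sphere 0 1 \<Longrightarrow> quad x0 \<le> quad x" by blast
  show thesis
  proof (rule that[of "quad x0"])
    show "quad x0 > 0" using x0(1) by (intro quad_pos) auto
    fix x show "quad x \<ge> quad x0 * (norm x)\<^sup>2"
    proof (cases "x = 0")
      case False
      have "quad x = (norm x)\<^sup>2 * quad ((1 / norm x) *\<^sub>R x)" using False by (simp add: quad_scaleR power_divide)
      moreover have "quad x0 \<le> quad ((1 / norm x) *\<^sub>R x)" using False by (intro x0(2)) simp
      from mult_left_mono[OF this, of "(norm x)\<^sup>2"]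
      have "quad x0 * (norm x)\<^sup>2 \<le> (norm x)\<^sup>2 * quad ((1 / norm x) *\<^sub>R x)" by (simp add: mult.commute)
      ultimately show ?thesis by simp
    qed (use quad_nonneg[of 0] in simp)
  qed
qed

text \<open>\<open>quad\<close> is the form of D H D with D the diagonal matrix of the r_j, so its
  determinant is det H times the square of their product. This is the origin of the product of the
  r_j in the final denominator.\<close>

lemma gaussian_quad:
  "integrable lborel (\<lambda>x. exp (- quad x / 2))"
  "(\<integral>x. exp (- quad x / 2) \<partial>lborel) = (2 * pi) powr (real CARD('m) / 2) / ((\<Prod>j\<in>UNIV. r $ Some j) * sqrt (det H))"
  "det H > 0"
proof -
  define D :: "real^'m^'m" where "D = (\<chi> i j. if i = j then r $ Some i else 0)"
  have Dv: "D *v x = (\<chi> j. r $ Some j * x $ j)" for x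
    by (simp add: D_def matrix_vector_mult_def if_distrib[of "\<lambda>a. a * _"] cong: if_cong)
  have DT: "transpose D = D" by (auto simp: D_def transpose_def vec_eq_iff)
  define M where "M = D ** H ** D"
  have q: "x \<bullet> (M *v x) = quad x" for x
  proof -
    have "x \<bullet> (M *v x) = (D *v x) \<bullet> (H *v (D *v x))"
      unfolding M_def by (metis DT dot_lmul_matrix matrix_vector_mul_assoc transpose_matrix_vector)
    also have "\<dots> = quad x" unfolding hessian_quad Dv
      using r_pos by (auto intro!: arg_cong[where f = quad] simp: vec_eq_iff less_imp_neq[symmetric])
    finally show ?thesis .
  qed
  have detM: "det M = (\<Prod>j\<in>UNIV. r $ Some j)\<^sup>2 * det H"
  proof -
    have "det D = (\<Prod>j\<in>UNIV. r $ Some j)" by (subst det_diagonal) (auto simp: D_def)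
    then show ?thesis by (simp add: M_def det_mul power2_eq_square)
  qed
  have "transpose M = M"
    using hessian_pd by (simp add: M_def matrix_transpose_mul DT matrix_mul_assoc positive_definite_def)
  then have M: "positive_definite M" by (simp add: positive_definite_def q quad_pos)
  show "det H > 0" using gaussian_integral(1)[OF hessian_pd] .
  show "integrable lborel (\<lambda>x. exp (- quad x / 2))" using gaussian_integral(2)[OF M] by (simp add: q)
  have "(\<Prod>j\<in>UNIV. r $ Some j) > 0" using r_pos by (intro prod_pos) auto
  then show "(\<integral>x. exp (- quad x / 2) \<partial>lborel) = (2 * pi) powr (real CARD('m) / 2) / ((\<Prod>j\<in>UNIV. r $ Some j) * sqrt (det H))"
    using gaussian_integral(3)[OF M] by (simp add: q detM real_sqrt_mult)
qed

end

section \<open>Localisation of the torus integral\<close>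

lemma integral_scaleR_vec:
  fixes f :: "real^'m::finite \<Rightarrow> complex"
  assumes c: "c > 0" and f[measurable]: "f \<in> borel_measurable borel"
  shows "(\<integral>x. f x \<partial>lborel) = of_real (c ^ CARD('m)) * (\<integral>x. f (c *\<^sub>R x) \<partial>lborel)"
proof -
  have "lborel = density (distr lborel borel (\<lambda>x::real^'m. 0 + c *\<^sub>R x)) (\<lambda>_. \<bar>c\<bar> ^ DIM(real^'m))"
    by (rule lborel_affine) (use c in simp)
  then have "(\<integral>x. f x \<partial>lborel) = (\<integral>x. f x \<partial>density (distr lborel borel (\<lambda>x::real^'m. 0 + c *\<^sub>R x)) (\<lambda>_. ennreal (\<bar>c\<bar> ^ DIM(real^'m))))"
    by simp
  also have "\<dots> = (\<integral>x. (\<bar>c\<bar> ^ DIM(real^'m)) *\<^sub>R f x \<partial>distr lborel borel (\<lambda>x::real^'m. 0 + c *\<^sub>R x))"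
    by (rule integral_density) auto
  also have "\<dots> = (\<integral>x. (\<bar>c\<bar> ^ DIM(real^'m)) *\<^sub>R f (0 + c *\<^sub>R x) \<partial>lborel)"
    by (rule integral_distr) auto
  finally show ?thesis using c by (simp add: scaleR_conv_of_real)
qed

lemma integrable_exp_neg_norm_sq:
  assumes "\<kappa> > 0"
  shows "integrable lborel (\<lambda>x::real^'m::finite. exp (- \<kappa> * (norm x)\<^sup>2))"
proof -
  define M :: "real^'m^'m" where "M = mat (2 * \<kappa>)"
  have Mv: "M *v x = (2 * \<kappa>) *\<^sub>R x" for x
    by (simp add: M_def matrix_vector_mult_def mat_def vec_eq_iff if_distrib[of "\<lambda>a. a * _"] cong: if_cong)
  have "transpose M = M" by (simp add: M_def transpose_mat)
  then have "positive_definite M" using assms by (simp add: positive_definite_def Mv)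
  from gaussian_integral(2)[OF this] show ?thesis by (simp add: Mv power2_norm_eq_inner)
qed

lemma norm_phase: "cmod (phase \<mu> \<theta>) = 1"
  by (simp add: phase_def)

context critical_point

begin

lemma continuous_on_X_coeff:
  assumes s: "s > 0"
  shows "continuous_on torus_box (\<lambda>\<theta>. X_coeff s n (rot \<rho> \<theta>))"
proof -
  obtain C R where C: "C \<ge> 0" "R > 1"
    "\<And>\<theta> n M. \<theta> \<in> torus_box \<Longrightarrow> cmod (x_coeff s n M (rot \<rho> \<theta>)) \<le> C / (R ^ M * (rp / 2) ^ n)"
    by (rule global_bound[OF s]) blast
  have "uniform_limit torus_box (\<lambda>m \<theta>. \<Sum>M<m. x_coeff s n M (rot \<rho> \<theta>)) (\<lambda>\<theta>. \<Sum>M. x_coeff s n M (rot \<rho> \<theta>)) sequentially"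
    by (rule Weierstrass_m_test[OF C(3) geometric_summable[OF C(2)]])
  moreover have "continuous_on torus_box (\<lambda>\<theta>. \<Sum>M<m. x_coeff s n M (rot \<rho> \<theta>))" for m
    by (intro continuous_intros continuous_on_compose2[OF continuous_on_x_coeff[of UNIV] continuous_on_rot]) auto
  ultimately show ?thesis unfolding X_coeff_def
    by (intro uniform_limit_theorem[OF _ _ sequentially_bot]) auto
qed

text \<open>The geometric bound in M allows the sum to be exchanged with the integral, and only M =
  sum of the mu j survives. Hence the full branch of F^(-s) has the same torus integral as its
  homogeneous component.\<close>

lemma set_integral_X_coeff:
  fixes l :: "'m option \<Rightarrow> nat"
  assumes s: "s > 0"
  defines "mu \<equiv> \<lambda>j. l (Some j)"
  shows "(LINT \<theta>:torus_box|lborel. phase (\<lambda>j. int (mu j)) \<theta> * X_coeff s (l None) (rot \<rho> \<theta>)) =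
    of_real ((2 * pi) ^ CARD('m) * (\<Prod>j\<in>UNIV. \<rho> $ j ^ mu j) / (\<Prod>i\<in>UNIV. fact (l i)) *
      ((-1) ^ (\<Sum>i\<in>UNIV. l i) * poly (chromatic_poly (multipartite_verts l) (multipartite_edges l)) (- s)))"
proof -
  let ?n = "l None" and ?ph = "phase (\<lambda>j. int (mu j))"
  obtain C R where C: "C \<ge> 0" "R > 1"
    "\<And>\<theta> n M. \<theta> \<in> torus_box \<Longrightarrow> cmod (x_coeff s n M (rot \<rho> \<theta>)) \<le> C / (R ^ M * (rp / 2) ^ n)"
    by (rule global_bound[OF s]) blast
  let ?f = "\<lambda>M \<theta>. indicator torus_box \<theta> *\<^sub>R (?ph \<theta> * x_coeff s ?n M (rot \<rho> \<theta>))"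
  let ?D = "(rp / 2) ^ ?n"
  have sx: "(\<lambda>M. x_coeff s ?n M (rot \<rho> \<theta>)) sums X_coeff s ?n (rot \<rho> \<theta>)" if "\<theta> \<in> torus_box" for \<theta>
    unfolding X_coeff_def using r_pos[of None] C(3)[OF that]
    by (intro summable_sums X_coeff_bound(1)[OF C(1,2), of "rp / 2"]) auto
  have fb: "norm (?f M \<theta>) \<le> indicator torus_box \<theta> * (C / (R ^ M * ?D))" for M \<theta>
    using C(3)[of \<theta> ?n M] by (cases "\<theta> \<in> torus_box") (auto simp: norm_mult norm_phase)
  have fi: "integrable lborel (?f M)" for M
  proof -
    have "continuous_on torus_box (\<lambda>\<theta>. ?ph \<theta> * x_coeff s ?n M (rot \<rho> \<theta>))"
      by (intro continuous_intros continuous_on_compose2[OF continuous_on_x_coeff[of UNIV] continuous_on_rot]) auto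
    from set_integrable_torus_box[OF this] show ?thesis unfolding set_integrable_def .
  qed
  have torus_meas: "emeasure lborel (torus_box :: (real^'m) set) < \<infinity>"
    unfolding torus_box_def by (rule emeasure_lborel_cbox_finite)
  have ii: "integrable lborel (\<lambda>\<theta>::real^'m. indicator torus_box \<theta> * c)" for c :: real
    using torus_meas by (intro integrable_mult_left integrable_real_indicator) (auto simp: torus_box_def)
  have summable_pt: "summable (\<lambda>M. norm (?f M \<theta>))" for \<theta>
    by (rule summable_comparison_test'[OF summable_mult[OF geometric_summable[OF C(2)], of "indicator torus_box \<theta>"]]) (use fb in auto)
  have summable_int: "summable (\<lambda>M. \<integral>\<theta>. norm (?f M \<theta>) \<partial>lborel)"
  proof (rule summable_comparison_test')
    show "summable (\<lambda>M. (\<integral>\<theta>. indicator torus_box (\<theta>::real^'m) \<partial>lborel) * (C / (R ^ M * ?D)))"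
      by (intro summable_mult geometric_summable C(2))
    fix M
    have "(\<integral>\<theta>. norm (?f M \<theta>) \<partial>lborel) \<le> (\<integral>\<theta>. indicator torus_box (\<theta>::real^'m) * (C / (R ^ M * ?D)) \<partial>lborel)"
    proof (rule integral_mono)
      show "integrable lborel (\<lambda>\<theta>. norm (?f M \<theta>))" by (rule integrable_norm[OF fi])
      show "norm (?f M \<theta>) \<le> indicator torus_box \<theta> * (C / (R ^ M * ?D))" for \<theta> by (rule fb)
    qed (rule ii)
    then show "norm (\<integral>\<theta>. norm (?f M \<theta>) \<partial>lborel) \<le> (\<integral>\<theta>. indicator torus_box (\<theta>::real^'m) \<partial>lborel) * (C / (R ^ M * ?D))"
      by simp
  qed
  have S: "(\<lambda>M. integral\<^sup>L lborel (?f M)) sums (\<integral>\<theta>. (\<Sum>M. ?f M \<theta>) \<partial>lborel)"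
    using summable_pt by (intro sums_integral fi summable_int) auto
  have "(\<Sum>M. ?f M \<theta>) = indicator torus_box \<theta> *\<^sub>R (?ph \<theta> * X_coeff s ?n (rot \<rho> \<theta>))" for \<theta>
  proof (cases "\<theta> \<in> torus_box")
    case True
    then show ?thesis using sums_unique[OF sums_mult[OF sx[OF True], of "?ph \<theta>"]] by simp
  qed simp
  then have S': "(\<lambda>M. LINT \<theta>:torus_box|lborel. ?ph \<theta> * x_coeff s ?n M (rot \<rho> \<theta>)) sums
      (LINT \<theta>:torus_box|lborel. ?ph \<theta> * X_coeff s ?n (rot \<rho> \<theta>))"
    using S by (simp add: set_lebesgue_integral_def)
  let ?V = "of_real ((2 * pi) ^ CARD('m) * (\<Prod>j\<in>UNIV. \<rho> $ j ^ mu j) / (\<Prod>i\<in>UNIV. fact (l i)) *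
      ((-1) ^ (\<Sum>i\<in>UNIV. l i) * poly (chromatic_poly (multipartite_verts l) (multipartite_edges l)) (- s)))"
  have "(\<lambda>M. if M = (\<Sum>j\<in>UNIV. mu j) then ?V else 0) sums (LINT \<theta>:torus_box|lborel. ?ph \<theta> * X_coeff s ?n (rot \<rho> \<theta>))"
    using S' unfolding mu_def set_integral_x_coeff .
  moreover have "(\<lambda>M. if M = (\<Sum>j\<in>UNIV. mu j) then ?V else 0) sums ?V" by (rule sums_single)
  ultimately show ?thesis by (rule sums_unique2)
qed

text \<open>Singularity analysis with h = hh \<theta>, whose constants are uniform in \<theta>, is
  combined with a quadratic lower bound for log |hh \<theta>| that will dominate the rescaled
  integrand.\<close>

lemma near_expansion:
  assumes s: "s > 0"
  obtains \<eta> C \<kappa> where "\<eta> > 0" "\<eta> \<le> pi" "C \<ge> 0" "\<kappa> > 0"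
    "\<And>\<theta>. norm \<theta> < \<eta> \<Longrightarrow> hh \<theta> \<noteq> 0" 
    "\<And>\<theta>. norm \<theta> < \<eta> \<Longrightarrow> \<kappa> * (norm \<theta>)\<^sup>2 \<le> Re (Ln (hh \<theta>)) - ln rp"
    "\<And>\<theta> n. norm \<theta> < \<eta> \<Longrightarrow> n > 0 \<Longrightarrow> cmod (X_coeff s n (rot \<rho> \<theta>) * hh \<theta> ^ n) * real n powr (1 - s) \<le> C"
    "\<And>\<theta> n. \<theta> \<longlonglongrightarrow> 0 \<Longrightarrow> (\<And>k. norm (\<theta> k) < \<eta>) \<Longrightarrow> filterlim n at_top sequentially \<Longrightarrow>
       (\<lambda>k. X_coeff s (n k) (rot \<rho> (\<theta> k)) * hh (\<theta> k) ^ n k * of_real (real (n k) powr (1 - s))) \<longlonglongrightarrow>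
        of_real (exp (s * rp) * rp powr (- s) / Gamma s)"
proof -
  obtain C0 R0 where C0: "C0 \<ge> 0" "R0 > 1"
    "\<And>\<theta> n M. \<theta> \<in> torus_box \<Longrightarrow> cmod (x_coeff s n M (rot \<rho> \<theta>)) \<le> C0 / (R0 ^ M * (rp / 2) ^ n)"
    "\<And>\<theta> \<zeta> z. \<theta> \<in> torus_box \<Longrightarrow> cmod \<zeta> < R0 \<Longrightarrow> cmod z \<le> rp / 2 \<Longrightarrow> exp (- z) \<noteq> c_fun (\<zeta> *s rot \<rho> \<theta>)"
    by (rule global_bound[OF s]) blast
  obtain \<eta>1 where \<eta>1: "\<eta>1 > 0" "\<And>\<theta>. norm \<theta> < \<eta>1 \<Longrightarrow> cc \<theta> \<noteq> 0" 
    "\<And>\<theta> t z. norm \<theta> < \<eta>1 \<Longrightarrow> 0 \<le> t \<Longrightarrow> t \<le> 1 \<Longrightarrow> cmod z < rp / 2 \<Longrightarrow> cmod (exp z * c_fun (of_real t *s rot \<rho> \<theta>)) < 1"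
    by (rule cc_near_0) blast
  obtain \<delta> C where \<delta>: "\<delta> > 0" "\<delta> < rp" "C \<ge> 0"
    "\<And>h Y n. cmod (h - of_real rp) < \<delta> \<Longrightarrow> n > 0 \<Longrightarrow>
      (\<lambda>z. exp (of_real s * z) * (1 - exp z * exp (- h)) powr (- of_real s)) has_fps_expansion Y \<Longrightarrow>
      cmod (fps_nth Y n * h ^ n) * real n powr (1 - s) \<le> C"
    "\<And>h Y n. h \<longlonglongrightarrow> of_real rp \<Longrightarrow> filterlim n at_top sequentially \<Longrightarrow>
      (\<And>k. cmod (h k - of_real rp) < \<delta>) \<Longrightarrow>
      (\<And>k. (\<lambda>z. exp (of_real s * z) * (1 - exp z * exp (- h k)) powr (- of_real s)) has_fps_expansion Y k) \<Longrightarrow>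
      (\<lambda>k. fps_nth (Y k) (n k) * h k ^ n k * of_real (real (n k) powr (1 - s))) \<longlonglongrightarrow>
        of_real (exp (s * rp) * rp powr (- s) / Gamma s)"
    by (rule algebraic_singularity_asymptotics[OF r_pos[of None], of s]) blast
  obtain \<kappa>0 where \<kappa>0: "\<kappa>0 > 0" "\<And>x. quad x \<ge> \<kappa>0 * (norm x)\<^sup>2" by (rule quad_lower) blast
  \<comment> \<open>Half of \<open>quad\<close> / 2 is given up to absorb the cubic error, which
    leaves \<kappa>0 / 4; division by ap isolates log |hh|.\<close>
  define \<kappa> where "\<kappa> = \<kappa>0 / (4 * ap)"
  have \<kappa>: "\<kappa> > 0" using \<kappa>0 alpha_pos[of None] by (simp add: \<kappa>_def)
  obtain C2 where C2: "C2 \<ge> 0" and ev2: "eventually (\<lambda>\<theta>. \<bar>ap * (Re (Ln (hh \<theta>)) - ln rp) - quad \<theta> / 2\<bar> \<le> C2 * norm \<theta> ^ 3) (nhds 0)"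
    using quad_near by blast
  have ev1: "eventually (\<lambda>\<theta>. cmod (hh \<theta> - of_real rp) < \<delta>) (nhds 0)"
    using tendstoD[OF isCont_nhds[OF continuous_hh_at_0] \<delta>(1)] by (simp add: hh_0 dist_norm)
  \<comment> \<open>The last bound makes the cubic error at most \<kappa>0 |\<theta>|^2 / 4; the
    summand 1 avoids a division by 0 when C2 = 0.\<close>
  have ev3: "eventually (\<lambda>\<theta>::real^'m. norm \<theta> < min (min pi \<eta>1) (\<kappa>0 / (4 * (C2 + 1)))) (nhds 0)"
  proof -
    have "eventually (\<lambda>\<theta>. \<theta> \<in> ball (0::real^'m) (min (min pi \<eta>1) (\<kappa>0 / (4 * (C2 + 1))))) (nhds 0)"
      using \<eta>1 \<kappa>0 C2 by (intro eventually_nhds_in_open) (auto simp: add_nonneg_pos)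
    then show ?thesis by eventually_elim simp
  qed
  have "eventually (\<lambda>\<theta>. cmod (hh \<theta> - of_real rp) < \<delta> \<and> norm \<theta> < pi \<and> norm \<theta> < \<eta>1 \<and> hh \<theta> \<noteq> 0 \<and> exp (- hh \<theta>) = cc \<theta> \<and>
      \<kappa> * (norm \<theta>)\<^sup>2 \<le> Re (Ln (hh \<theta>)) - ln rp) (nhds 0)"
    using ev1 ev2 ev3 eventually_hh_ge
  proof eventually_elim
    case (elim \<theta>)
    have "norm \<theta> * (C2 + 1) \<le> \<kappa>0 / 4" using elim(3) C2 by (simp add: field_simps add_nonneg_pos)
    moreover have "norm \<theta> * (C2 + 1) = C2 * norm \<theta> + norm \<theta>" by (simp add: algebra_simps)
    ultimately have "C2 * norm \<theta> \<le> \<kappa>0 / 4" using norm_ge_zero[of \<theta>] by linarith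
    then have "(norm \<theta>)\<^sup>2 * (C2 * norm \<theta>) \<le> (norm \<theta>)\<^sup>2 * (\<kappa>0 / 4)" by (intro mult_left_mono) auto
    then have "C2 * norm \<theta> ^ 3 \<le> \<kappa>0 * (norm \<theta>)\<^sup>2 / 4" by (simp add: power2_eq_square power3_eq_cube mult_ac)
    then have "\<kappa>0 * (norm \<theta>)\<^sup>2 / 4 \<le> ap * (Re (Ln (hh \<theta>)) - ln rp)"
      using elim(2) \<kappa>0(2)[of \<theta>] by linarith
    then have "\<kappa> * (norm \<theta>)\<^sup>2 \<le> Re (Ln (hh \<theta>)) - ln rp"
      using alpha_pos[of None] by (simp add: \<kappa>_def field_simps del: Re_Ln)
    then show ?case using elim by (simp del: Re_Ln)
  qed
  then obtain \<eta>0 where \<eta>0: "\<eta>0 > 0" "\<And>\<theta>. norm \<theta> < \<eta>0 \<Longrightarrow> cmod (hh \<theta> - of_real rp) < \<delta> \<and> norm \<theta> < pi \<and> norm \<theta> < \<eta>1 \<and> hh \<theta> \<noteq> 0 \<and> exp (- hh \<theta>) = cc \<theta> \<and>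
      \<kappa> * (norm \<theta>)\<^sup>2 \<le> Re (Ln (hh \<theta>)) - ln rp"
    unfolding eventually_nhds_metric dist_norm diff_zero by blast
  define \<eta> where "\<eta> = min \<eta>0 pi"
  have \<eta>: "\<eta> > 0" "\<eta> \<le> pi" "\<And>\<theta>. norm \<theta> < \<eta> \<Longrightarrow> norm \<theta> < \<eta>0" using \<eta>0 by (auto simp: \<eta>_def)
  have box: "\<theta> \<in> torus_box" if "norm \<theta> < \<eta>" for \<theta> :: "real^'m"
  proof -
    have "\<bar>\<theta> $ j\<bar> \<le> pi" for j using component_le_norm_cart[of \<theta> j] that \<eta>(2) by linarith
    then show ?thesis by (auto simp: torus_box_def mem_box_cart abs_le_iff minus_le_iff)
  qed
  have exp': "(\<lambda>z. exp (of_real s * z) * (1 - exp z * exp (- hh \<theta>)) powr (- of_real s)) has_fps_expansion Abs_fps (\<lambda>n. X_coeff s n (rot \<rho> \<theta>))"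
    if \<theta>: "norm \<theta> < \<eta>" for \<theta>
  proof -
    have e: "exp (- hh \<theta>) = cc \<theta>" and n1: "norm \<theta> < \<eta>1" using \<eta>0(2)[OF \<eta>(3)[OF \<theta>]] by auto
    show ?thesis unfolding e
      by (rule X_coeff_expansion[OF C0(1,2) _ C0(3)[OF box[OF \<theta>]] C0(4)[OF box[OF \<theta>]] \<eta>1(3)[OF n1]])
         (use r_pos[of None] in auto)
  qed
  show thesis
  proof (rule that[of \<eta> C \<kappa>])
    fix \<theta> :: "real^'m" and n assume "norm \<theta> < \<eta>" "(n::nat) > 0"
    then show "cmod (X_coeff s n (rot \<rho> \<theta>) * hh \<theta> ^ n) * real n powr (1 - s) \<le> C"
      using \<delta>(4)[OF _ _ exp', of \<theta> n] \<eta>0(2)[OF \<eta>(3)] by simp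
  next
    fix \<theta> :: "nat \<Rightarrow> real^'m" and n :: "nat \<Rightarrow> nat"
    assume lim: "\<theta> \<longlonglongrightarrow> 0" and \<theta>: "\<And>k. norm (\<theta> k) < \<eta>" and n: "filterlim n at_top sequentially"
    have "(\<lambda>k. hh (\<theta> k)) \<longlonglongrightarrow> of_real rp" using isCont_tendsto_compose[OF continuous_hh_at_0 lim] by (simp add: hh_0)
    then show "(\<lambda>k. X_coeff s (n k) (rot \<rho> (\<theta> k)) * hh (\<theta> k) ^ n k * of_real (real (n k) powr (1 - s))) \<longlonglongrightarrow>
        of_real (exp (s * rp) * rp powr (- s) / Gamma s)"
      using \<delta>(5)[OF _ n _ exp'[OF \<theta>]] \<eta>0(2)[OF \<eta>(3)[OF \<theta>]] by simp
  next
    fix \<theta> :: "real^'m" assume "norm \<theta> < \<eta>"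
    then show "hh \<theta> \<noteq> 0" "\<kappa> * (norm \<theta>)\<^sup>2 \<le> Re (Ln (hh \<theta>)) - ln rp" using \<eta>0(2)[OF \<eta>(3)] by blast+
  qed (use \<eta> \<delta> \<kappa> in auto)
qed

text \<open>At the scale \<theta> = x / sqrt N, N times the cubic error is of order 1 / sqrt N and N
  \<open>quad\<close> \<theta> equals \<open>quad\<close> x. The bounded \<delta> only multiply
  quantities that tend to 0.\<close>

lemma phase_exponent_limit:
  fixes N n :: "nat \<Rightarrow> nat" and mu :: "nat \<Rightarrow> 'm \<Rightarrow> nat" and \<delta> :: "nat \<Rightarrow> 'm option \<Rightarrow> real"
    and x :: "real^'m"
  assumes N: "filterlim N at_top sequentially"
    and n: "\<And>k. real (n k) = ap * real (N k) + \<delta> k None"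
    and mu: "\<And>k j. real (mu k j) = \<alpha> $ Some j * real (N k) + \<delta> k (Some j)"
    and \<delta>: "\<And>k i. \<bar>\<delta> k i\<bar> \<le> D"
  defines "\<theta> \<equiv> \<lambda>k. (1 / sqrt (real (N k))) *\<^sub>R x"
  shows "(\<lambda>k. of_real (real (n k)) * (Ln (hh (\<theta> k)) - of_real (ln rp)) + \<i> * of_real (\<Sum>j\<in>UNIV. real (mu k j) * \<theta> k $ j))
     \<longlonglongrightarrow> of_real (quad x / 2)"
proof -
  let ?s = "\<lambda>k. sqrt (real (N k))"
  have Nr: "filterlim (\<lambda>k. real (N k)) at_top sequentially" by (rule filterlim_compose[OF filterlim_real_sequentially N])
  have sN: "filterlim ?s at_top sequentially" by (rule filterlim_compose[OF sqrt_at_top Nr])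
  have inv: "(\<lambda>k. 1 / ?s k) \<longlonglongrightarrow> 0" using tendsto_inverse_0_at_top[OF sN] by (simp add: inverse_eq_divide)
  have \<theta>0: "\<theta> \<longlonglongrightarrow> 0" unfolding \<theta>_def using tendsto_scaleR[OF inv tendsto_const[of x]] by simp
  have Npos: "eventually (\<lambda>k. N k > 0) sequentially" by (rule eventually_compose_filterlim[OF eventually_gt_at_top N])
  let ?e = "\<lambda>\<theta>. of_real ap * (Ln (hh \<theta>) - of_real (ln rp)) + \<i> * of_real (\<Sum>j\<in>UNIV. \<alpha> $ Some j * \<theta> $ j) - of_real (quad \<theta> / 2)"
  obtain C where C: "C > 0" and ev: "eventually (\<lambda>\<theta>. norm (?e \<theta>) \<le> C * norm (complex_of_real (norm \<theta>) ^ 3)) (nhds 0)"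
    using log_hh_expansion by (rule landau_o.bigE)
  have ek: "eventually (\<lambda>k. norm (?e (\<theta> k)) \<le> C * norm (\<theta> k) ^ 3) sequentially"
    using eventually_compose_filterlim[OF ev \<theta>0] by (simp add: norm_power)
  have E1: "(\<lambda>k. of_real (real (N k)) * ?e (\<theta> k)) \<longlonglongrightarrow> 0"
  proof (rule Lim_null_comparison)
    show "eventually (\<lambda>k. norm (of_real (real (N k)) * ?e (\<theta> k)) \<le> C * norm x ^ 3 * (1 / ?s k)) sequentially"
      using ek Npos
    proof eventually_elim
      case (elim k)
      have "norm (of_real (real (N k)) * ?e (\<theta> k)) \<le> real (N k) * (C * norm (\<theta> k) ^ 3)"
        unfolding norm_mult using elim by (intro mult_mono) auto
      also have "norm (\<theta> k) = norm x / ?s k" by (simp add: \<theta>_def)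
      also have "real (N k) * (C * (norm x / ?s k) ^ 3) = (?s k * ?s k) * (C * (norm x / ?s k) ^ 3)" by simp
      also have "\<dots> = C * norm x ^ 3 * (1 / ?s k)" using elim(2) by (simp add: power3_eq_cube field_simps del: real_sqrt_mult_self)
      finally show ?case .
    qed
    show "(\<lambda>k. C * norm x ^ 3 * (1 / ?s k)) \<longlonglongrightarrow> 0" using tendsto_mult[OF tendsto_const[of "C * norm x ^ 3"] inv] by simp
  qed
  have L0: "(\<lambda>k. Ln (hh (\<theta> k)) - of_real (ln rp)) \<longlonglongrightarrow> 0"
  proof -
    have "isCont (\<lambda>\<theta>. Ln (hh \<theta>)) 0"
      using continuous_hh_at_0 r_pos[of None] by (intro continuous_intros) (auto simp: hh_0 complex_nonpos_Reals_iff)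
    from isCont_tendsto_compose[OF this \<theta>0] have "(\<lambda>k. Ln (hh (\<theta> k))) \<longlonglongrightarrow> Ln (hh 0)" .
    moreover have "Ln (hh 0) = of_real (ln rp)" using r_pos[of None] by (simp add: hh_0 Ln_of_real)
    ultimately show ?thesis by (simp add: LIM_zero)
  qed
  have E2: "(\<lambda>k. of_real (\<delta> k None) * (Ln (hh (\<theta> k)) - of_real (ln rp))) \<longlonglongrightarrow> 0"
  proof (rule Lim_null_comparison)
    show "eventually (\<lambda>k. norm (of_real (\<delta> k None) * (Ln (hh (\<theta> k)) - of_real (ln rp))) \<le> D * norm (Ln (hh (\<theta> k)) - of_real (ln rp))) sequentially"
      by (intro always_eventually allI) (simp add: norm_mult mult_right_mono \<delta>)
    show "(\<lambda>k. D * norm (Ln (hh (\<theta> k)) - of_real (ln rp))) \<longlonglongrightarrow> 0"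
      using tendsto_mult[OF tendsto_const[of D] tendsto_norm[OF L0]] by simp
  qed
  have E3: "(\<lambda>k. \<Sum>j\<in>UNIV. \<delta> k (Some j) * \<theta> k $ j) \<longlonglongrightarrow> 0"
  proof (rule tendsto_null_sum)
    fix j
    show "(\<lambda>k. \<delta> k (Some j) * \<theta> k $ j) \<longlonglongrightarrow> 0"
    proof (rule Lim_null_comparison)
      show "eventually (\<lambda>k. norm (\<delta> k (Some j) * \<theta> k $ j) \<le> D * norm (\<theta> k)) sequentially"
      proof (rule always_eventually, rule allI)
        fix k
        have "\<bar>\<delta> k (Some j)\<bar> * \<bar>\<theta> k $ j\<bar> \<le> D * norm (\<theta> k)"
          using order_trans[OF abs_ge_zero \<delta>[of k "Some j"]] by (intro mult_mono \<delta> component_le_norm_cart) auto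
        then show "norm (\<delta> k (Some j) * \<theta> k $ j) \<le> D * norm (\<theta> k)" by (simp add: abs_mult)
      qed
      show "(\<lambda>k. D * norm (\<theta> k)) \<longlonglongrightarrow> 0" using tendsto_mult[OF tendsto_const[of D] tendsto_norm[OF \<theta>0]] by simp
    qed
  qed
  have "(\<lambda>k. of_real (real (N k)) * ?e (\<theta> k) + of_real (quad x / 2) + of_real (\<delta> k None) * (Ln (hh (\<theta> k)) - of_real (ln rp)) +
     \<i> * of_real (\<Sum>j\<in>UNIV. \<delta> k (Some j) * \<theta> k $ j)) \<longlonglongrightarrow> 0 + of_real (quad x / 2) + 0 + \<i> * of_real 0"
    by (intro tendsto_add tendsto_mult tendsto_of_real tendsto_const E1 E2 E3)
  moreover have "eventually (\<lambda>k. of_real (real (N k)) * ?e (\<theta> k) + of_real (quad x / 2) + of_real (\<delta> k None) * (Ln (hh (\<theta> k)) - of_real (ln rp)) +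
     \<i> * of_real (\<Sum>j\<in>UNIV. \<delta> k (Some j) * \<theta> k $ j) =
     of_real (real (n k)) * (Ln (hh (\<theta> k)) - of_real (ln rp)) + \<i> * of_real (\<Sum>j\<in>UNIV. real (mu k j) * \<theta> k $ j)) sequentially"
    using Npos
  proof eventually_elim
    case (elim k)
    have q: "real (N k) * quad (\<theta> k) = quad x"
      using elim by (simp add: \<theta>_def quad_scaleR power_divide)
    have q': "complex_of_real (real (N k)) * of_real (quad (\<theta> k) / 2) = of_real (quad x / 2)"
      by (simp only: of_real_divide times_divide_eq_right of_real_mult[symmetric] q)
    have m: "(\<Sum>j\<in>UNIV. real (mu k j) * \<theta> k $ j) = real (N k) * (\<Sum>j\<in>UNIV. \<alpha> $ Some j * \<theta> k $ j) + (\<Sum>j\<in>UNIV. \<delta> k (Some j) * \<theta> k $ j)"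
      unfolding mu by (simp add: algebra_simps sum.distrib sum_distrib_left)
    show ?case unfolding n m q'[symmetric] by (simp add: algebra_simps)
  qed
  ultimately show ?thesis by (simp add: tendsto_cong)
qed

end

section \<open>Laplace method\<close>

context critical_point

begin

text \<open>N is at most linear in n, so the remaining factors are bounded by a power of n + 1, and
  the geometric factor (r_p / R)^n prevails.\<close>

lemma far_contribution:
  fixes N n :: "nat \<Rightarrow> nat"
  assumes n: "filterlim n at_top sequentially" and Nn: "\<And>k. real (N k) \<le> A * real (n k) + A" and A: "A > 0"
    and R: "R > rp"
  shows "(\<lambda>k. sqrt (real (N k)) ^ m * real (n k) powr t * rp ^ n k / R ^ n k) \<longlonglongrightarrow> 0"
proof -
  define q where "q = rp / R"
  have q: "0 \<le> q" "q < 1" using R r_pos[of None] by (auto simp: q_def)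
  let ?e = "real m / 2 + \<bar>t\<bar>"
  have "(\<lambda>j. q ^ j * (2 * (real j + 1)) powr ?e) \<longlonglongrightarrow> 0"
    by (rule summable_LIMSEQ_zero[OF summable_poly_geometric[OF q]])
  from filterlim_compose[OF this n] have lim: "(\<lambda>k. A powr (real m / 2) * (q ^ n k * (2 * (real (n k) + 1)) powr ?e)) \<longlonglongrightarrow> 0"
    by (rule tendsto_mult_right_zero)
  show ?thesis
  proof (rule Lim_null_comparison[OF _ lim], rule always_eventually, rule allI)
    fix k
    let ?n = "n k"
    show "norm (sqrt (real (N k)) ^ m * real (n k) powr t * rp ^ n k / R ^ n k) \<le>
        A powr (real m / 2) * (q ^ n k * (2 * (real (n k) + 1)) powr ?e)"
    proof -
      have a: "sqrt (real (N k)) ^ m \<le> A powr (real m / 2) * (2 * (real ?n + 1)) powr (real m / 2)"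
      proof -
        have "real (N k) \<le> A * (2 * (real ?n + 1))" using Nn[of k] A by (simp add: algebra_simps)
        then have "sqrt (real (N k)) ^ m \<le> sqrt (A * (2 * (real ?n + 1))) ^ m" by (intro power_mono) auto
        also have "\<dots> = (A * (2 * (real ?n + 1))) powr (real m / 2)"
          using A by (simp add: powr_half_sqrt[symmetric] powr_realpow[symmetric] powr_powr)
        also have "\<dots> = A powr (real m / 2) * (2 * (real ?n + 1)) powr (real m / 2)" using A by (simp add: powr_mult)
        finally show ?thesis .
      qed
      have b: "real ?n powr t \<le> (2 * (real ?n + 1)) powr \<bar>t\<bar>"
      proof (cases "?n = 0")
        case False
        then have "real ?n powr t \<le> real ?n powr \<bar>t\<bar>" by (intro powr_mono) auto
        also have "\<dots> \<le> (2 * (real ?n + 1)) powr \<bar>t\<bar>" by (intro powr_mono2) auto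
        finally show ?thesis .
      qed simp
      have "norm (sqrt (real (N k)) ^ m * real ?n powr t * rp ^ ?n / R ^ ?n) = sqrt (real (N k)) ^ m * real ?n powr t * q ^ ?n"
        using r_pos[of None] R by (simp add: q_def power_divide abs_mult)
      also have "\<dots> \<le> (A powr (real m / 2) * (2 * (real ?n + 1)) powr (real m / 2)) * (2 * (real ?n + 1)) powr \<bar>t\<bar> * q ^ ?n"
        using a b q by (intro mult_mono) auto
      also have "\<dots> = A powr (real m / 2) * (q ^ ?n * (2 * (real ?n + 1)) powr ?e)"
        by (simp add: powr_add mult_ac)
      finally show ?thesis .
    qed
  qed
qed

lemma laplace:
  fixes N n :: "nat \<Rightarrow> nat" and mu :: "nat \<Rightarrow> 'm \<Rightarrow> nat" and \<delta> :: "nat \<Rightarrow> 'm option \<Rightarrow> real"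
  assumes s: "s > 0" and N: "filterlim N at_top sequentially"
    and n: "\<And>k. real (n k) = ap * real (N k) + \<delta> k None"
    and mu: "\<And>k j. real (mu k j) = \<alpha> $ Some j * real (N k) + \<delta> k (Some j)"
    and \<delta>: "\<And>k i. \<bar>\<delta> k i\<bar> \<le> D"
  shows "(\<lambda>k. of_real (sqrt (real (N k)) ^ CARD('m) * real (n k) powr (1 - s) * rp ^ n k) *
      (LINT \<theta>:torus_box|lborel. phase (\<lambda>j. int (mu k j)) \<theta> * X_coeff s (n k) (rot \<rho> \<theta>)))
    \<longlonglongrightarrow> of_real (exp (s * rp) * rp powr (- s) / Gamma s * (\<integral>x. exp (- quad x / 2) \<partial>lborel))"
proof -
  obtain \<eta> C \<kappa> where \<eta>: "\<eta> > 0" "\<eta> \<le> pi" and C: "C \<ge> 0" and \<kappa>: "\<kappa> > 0"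
    and hh0: "\<And>\<theta>. norm \<theta> < \<eta> \<Longrightarrow> hh \<theta> \<noteq> 0" 
    and hhl: "\<And>\<theta>. norm \<theta> < \<eta> \<Longrightarrow> \<kappa> * (norm \<theta>)\<^sup>2 \<le> Re (Ln (hh \<theta>)) - ln rp"
    and Xb: "\<And>\<theta> n. norm \<theta> < \<eta> \<Longrightarrow> n > 0 \<Longrightarrow> cmod (X_coeff s n (rot \<rho> \<theta>) * hh \<theta> ^ n) * real n powr (1 - s) \<le> C"
    and Xl: "\<And>\<theta> n. \<theta> \<longlonglongrightarrow> 0 \<Longrightarrow> (\<And>k. norm (\<theta> k) < \<eta>) \<Longrightarrow> filterlim n at_top sequentially \<Longrightarrow>
       (\<lambda>k. X_coeff s (n k) (rot \<rho> (\<theta> k)) * hh (\<theta> k) ^ n k * of_real (real (n k) powr (1 - s))) \<longlonglongrightarrow>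
        of_real (exp (s * rp) * rp powr (- s) / Gamma s)"
    by (rule near_expansion[OF s]) blast
  obtain B R where B: "B \<ge> 0" and R: "R > rp"
    and far: "\<And>\<theta> n. \<theta> \<in> torus_box \<Longrightarrow> norm \<theta> \<ge> \<eta> \<Longrightarrow> cmod (X_coeff s n (rot \<rho> \<theta>)) \<le> B / R ^ n"
    by (rule far_bound[OF s \<eta>(1)]) blast
  have ap: "ap > 0" by (rule alpha_pos)
  have D0: "D \<ge> 0" using \<delta>[of 0 None] by linarith
  let ?s = "\<lambda>k. sqrt (real (N k))"
  let ?f = "\<lambda>k \<theta>. phase (\<lambda>j. int (mu k j)) \<theta> * X_coeff s (n k) (rot \<rho> \<theta>)"
  let ?c = "\<lambda>k. real (n k) powr (1 - s) * rp ^ n k"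
  have Nr: "filterlim (\<lambda>k. real (N k)) at_top sequentially" by (rule filterlim_compose[OF filterlim_real_sequentially N])
  have sN: "filterlim ?s at_top sequentially" by (rule filterlim_compose[OF sqrt_at_top Nr])
  have inv: "(\<lambda>k. 1 / ?s k) \<longlonglongrightarrow> 0" using tendsto_inverse_0_at_top[OF sN] by (simp add: inverse_eq_divide)
  have nlim: "filterlim n at_top sequentially"
  proof -
    have "filterlim (\<lambda>k. ap * real (N k) + - D) at_top sequentially"
      using filterlim_tendsto_add_at_top[OF tendsto_const[of "- D"] filterlim_tendsto_pos_mult_at_top[OF tendsto_const[of ap] ap Nr]]
      by (simp add: add.commute)
    then have "filterlim (\<lambda>k. real (n k)) at_top sequentially"
    proof (rule filterlim_at_top_mono, intro always_eventually allI)
      show "ap * real (N k) + - D \<le> real (n k)" for k using n[of k] \<delta>[of k None] by linarith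
    qed
    then show ?thesis by (simp add: filterlim_sequentially_iff_filterlim_real)
  qed
  \<comment> \<open>The inequality n \<ge> (ap / 2) N converts decay in n into a Gaussian in x that
    does not depend on k.\<close>
  have good: "eventually (\<lambda>k. N k > 0 \<and> n k > 0 \<and> real (n k) \<ge> ap / 2 * real (N k)) sequentially"
  proof -
    have "eventually (\<lambda>k. real (N k) \<ge> 2 * D / ap) sequentially" using Nr by (simp add: filterlim_at_top)
    then show ?thesis
      using eventually_compose_filterlim[OF eventually_gt_at_top N, of 0] eventually_compose_filterlim[OF eventually_gt_at_top nlim, of 0]
    proof eventually_elim
      case (elim k)
      have "D \<le> ap / 2 * real (N k)" using elim(1) ap by (simp add: field_simps)
      moreover have "real (n k) \<ge> ap * real (N k) - D" using n[of k] \<delta>[of k None] by linarith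
      ultimately have "real (n k) \<ge> ap / 2 * real (N k)" by (simp add: algebra_simps)
      then show ?case using elim by simp
    qed
  qed
  have cf: "continuous_on torus_box (?f k)" for k
    by (intro continuous_intros continuous_on_X_coeff s)
  have ball_box: "ball 0 \<eta> \<subseteq> (torus_box :: (real^'m) set)"
  proof
    fix \<theta> :: "real^'m" assume "\<theta> \<in> ball 0 \<eta>"
    then have "norm \<theta> < \<eta>" by simp
    then have "\<bar>\<theta> $ j\<bar> \<le> pi" for j using component_le_norm_cart[of \<theta> j] \<eta>(2) by linarith
    then show "\<theta> \<in> torus_box" by (auto simp: torus_box_def mem_box_cart abs_le_iff minus_le_iff)
  qed
  have tb_meas[measurable]: "(torus_box :: (real^'m) set) \<in> sets borel" by (simp add: torus_box_def)
  have si: "set_integrable lborel torus_box (?f k)" for k by (rule set_integrable_torus_box[OF cf])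
  have sib: "set_integrable lborel (ball 0 \<eta>) (?f k)" for k by (rule set_integrable_subset[OF si]) (use ball_box in auto)
  have sir: "set_integrable lborel (torus_box - ball 0 \<eta>) (?f k)" for k by (rule set_integrable_subset[OF si]) auto
  have split: "(LINT \<theta>:torus_box|lborel. ?f k \<theta>) = (LINT \<theta>:ball 0 \<eta>|lborel. ?f k \<theta>) + (LINT \<theta>:torus_box - ball 0 \<eta>|lborel. ?f k \<theta>)" for k
  proof -
    have "(torus_box :: (real^'m) set) = ball 0 \<eta> \<union> (torus_box - ball 0 \<eta>)" using ball_box by auto
    then show ?thesis using set_integral_Un[OF _ sib[of k] sir[of k]] by auto
  qed
  define vol where "vol = measure lborel (torus_box :: (real^'m) set)"
  have far_int: "cmod (LINT \<theta>:torus_box - ball 0 \<eta>|lborel. ?f k \<theta>) \<le> vol * (B / R ^ n k)" for k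
  proof -
    have fin: "emeasure lborel (torus_box :: (real^'m) set) < \<infinity>" unfolding torus_box_def by (rule emeasure_lborel_cbox_finite)
    have "cmod (LINT \<theta>:torus_box - ball 0 \<eta>|lborel. ?f k \<theta>) \<le>
       (\<integral>\<theta>. norm (indicator (torus_box - ball 0 \<eta>) \<theta> *\<^sub>R ?f k \<theta>) \<partial>lborel)"
      unfolding set_lebesgue_integral_def by (rule integral_norm_bound)
    also have "\<dots> \<le> (\<integral>\<theta>. indicator torus_box (\<theta>::real^'m) * (B / R ^ n k) \<partial>lborel)"
    proof (rule integral_mono)
      show "integrable lborel (\<lambda>\<theta>. norm (indicator (torus_box - ball 0 \<eta>) \<theta> *\<^sub>R ?f k \<theta>))"
        using sir[of k] unfolding set_integrable_def by (rule integrable_norm)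
      show "integrable lborel (\<lambda>\<theta>::real^'m. indicator torus_box \<theta> * (B / R ^ n k))"
        using fin by (intro integrable_mult_left integrable_real_indicator) auto
      fix \<theta> :: "real^'m"
      show "norm (indicator (torus_box - ball 0 \<eta>) \<theta> *\<^sub>R ?f k \<theta>) \<le> indicator torus_box \<theta> * (B / R ^ n k)"
      proof (cases "\<theta> \<in> torus_box - ball 0 \<eta>")
        case True
        then have "cmod (X_coeff s (n k) (rot \<rho> \<theta>)) \<le> B / R ^ n k" by (intro far) auto
        then show ?thesis using True by (simp add: norm_mult norm_phase)
      qed (use B R r_pos[of None] in \<open>simp add: less_imp_le\<close>)
    qed
    also have "\<dots> = vol * (B / R ^ n k)" by (simp add: vol_def)
    finally show ?thesis .
  qed
  have far_lim: "(\<lambda>k. of_real (?s k ^ CARD('m) * ?c k) * (LINT \<theta>:torus_box - ball 0 \<eta>|lborel. ?f k \<theta>)) \<longlonglongrightarrow> 0"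
  proof (rule Lim_null_comparison)
    let ?A = "max (1 / ap) (D / ap) + 1"
    have A: "real (N k) \<le> ?A * real (n k) + ?A" for k
    proof -
      have "real (N k) = (real (n k) - \<delta> k None) / ap" using n[of k] ap by (simp add: field_simps)
      also have "\<dots> \<le> (real (n k) + D) / ap" using \<delta>[of k None] ap by (intro divide_right_mono) auto
      also have "\<dots> = 1 / ap * real (n k) + D / ap" by (simp add: add_divide_distrib)
      also have "\<dots> \<le> ?A * real (n k) + ?A" by (intro add_mono mult_right_mono) auto
      finally show ?thesis .
    qed
    have Ap: "?A > 0" using ap D0 by (intro add_nonneg_pos) (simp_all add: le_max_iff_disj)
    show "eventually (\<lambda>k. norm (of_real (?s k ^ CARD('m) * ?c k) * (LINT \<theta>:torus_box - ball 0 \<eta>|lborel. ?f k \<theta>)) \<le>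
       vol * B * (?s k ^ CARD('m) * real (n k) powr (1 - s) * rp ^ n k / R ^ n k)) sequentially"
    proof (rule always_eventually, rule allI)
      fix k
      have "norm (complex_of_real (?s k ^ CARD('m) * ?c k)) = ?s k ^ CARD('m) * ?c k"
        unfolding norm_of_real using r_pos[of None] by (simp add: abs_mult)
      then show "norm (of_real (?s k ^ CARD('m) * ?c k) * (LINT \<theta>:torus_box - ball 0 \<eta>|lborel. ?f k \<theta>)) \<le>
         vol * B * (?s k ^ CARD('m) * real (n k) powr (1 - s) * rp ^ n k / R ^ n k)"
        using mult_left_mono[OF far_int[of k], of "?s k ^ CARD('m) * ?c k"] r_pos[of None]
        unfolding norm_mult by (simp add: mult_ac)
    qed
    show "(\<lambda>k. vol * B * (?s k ^ CARD('m) * real (n k) powr (1 - s) * rp ^ n k / R ^ n k)) \<longlonglongrightarrow> 0"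
      by (rule tendsto_mult_right_zero[OF far_contribution[OF nlim A Ap R]])
  qed
  \<comment> \<open>The inner integrand after \<theta> = x / sqrt N, with the cutoff and all scalar
    factors except the power of sqrt N, which cancels against the Jacobian.\<close>
  define g where "g = (\<lambda>k (x::real^'m). indicator (ball 0 \<eta>) ((1 / ?s k) *\<^sub>R x) *\<^sub>R ?f k ((1 / ?s k) *\<^sub>R x) * of_real (?c k))"
  have fm: "(\<lambda>\<theta>. indicator (ball 0 \<eta>) \<theta> *\<^sub>R ?f k \<theta>) \<in> borel_measurable borel" for k
    using borel_measurable_integrable[OF sib[of k, unfolded set_integrable_def]] by simp
  have gm: "g k \<in> borel_measurable borel" for k
  proof -
    have "(\<lambda>x::real^'m. indicator (ball 0 \<eta>) ((1 / ?s k) *\<^sub>R x) *\<^sub>R ?f k ((1 / ?s k) *\<^sub>R x)) \<in> borel_measurable borel"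
      by (rule measurable_compose[OF _ fm]) measurable
    then show ?thesis unfolding g_def by measurable
  qed
  have near_int: "of_real (?s k ^ CARD('m) * ?c k) * (LINT \<theta>:ball 0 \<eta>|lborel. ?f k \<theta>) = (\<integral>x. g k x \<partial>lborel)" if "N k > 0" for k
  proof -
    have i: "(LINT \<theta>:ball 0 \<eta>|lborel. ?f k \<theta>) = of_real ((1 / ?s k) ^ CARD('m)) *
        (\<integral>x. indicator (ball 0 \<eta>) ((1 / ?s k) *\<^sub>R x) *\<^sub>R ?f k ((1 / ?s k) *\<^sub>R x) \<partial>lborel)"
      unfolding set_lebesgue_integral_def by (rule integral_scaleR_vec[OF _ fm]) (use that in simp)
    have u: "?s k ^ CARD('m) * (1 / ?s k) ^ CARD('m) = 1" using that by (simp add: power_mult_distrib[symmetric])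
    have v: "of_real (S * c) * (of_real T * I) = I * of_real c" if "S * T = 1" for S T c :: real and I :: complex
    proof -
      have "of_real (S * c) * (of_real T * I) = of_real (S * T) * (I * of_real c)" by (simp add: mult_ac)
      then show ?thesis using that by simp
    qed
    show ?thesis unfolding i g_def integral_mult_left_zero by (rule v[OF u])
  qed
  define W where "W = (\<lambda>x::real^'m. C * exp (- (\<kappa> * (ap / 2)) * (norm x)\<^sup>2))"
  let ?E = "\<lambda>k \<theta>. of_real (real (n k)) * (Ln (hh \<theta>) - of_real (ln rp)) + \<i> * of_real (\<Sum>j\<in>UNIV. real (mu k j) * \<theta> $ j)"
  \<comment> \<open>Inserting hh^n and its inverse separates a bounded factor with a constant limit
    from exp (- ?E), which carries both the oscillation and the decay.\<close>
  have factor: "?f k \<theta> * of_real (?c k) = (X_coeff s (n k) (rot \<rho> \<theta>) * hh \<theta> ^ n k * of_real (real (n k) powr (1 - s))) * exp (- ?E k \<theta>)"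
    if \<theta>: "norm \<theta> < \<eta>" for k \<theta>
  proof -
    have ph: "phase (\<lambda>j. int (mu k j)) \<theta> = exp (- (\<i> * of_real (\<Sum>j\<in>UNIV. real (mu k j) * \<theta> $ j)))"
      by (simp add: phase_def cis_conv_exp)
    have hp: "hh \<theta> ^ n k = exp (of_real (real (n k)) * Ln (hh \<theta>))"
      using hh0[OF \<theta>] by (simp add: exp_of_nat_mult)
    have rpp: "of_real (rp ^ n k) = exp (complex_of_real (real (n k)) * of_real (ln rp))"
    proof -
      have "exp (complex_of_real (real (n k)) * of_real (ln rp)) = exp (of_real (ln rp)) ^ n k" by (simp add: exp_of_nat_mult)
      also have "exp (complex_of_real (ln rp)) = of_real rp" using r_pos[of None] by (simp only: exp_of_real exp_ln)
      finally show ?thesis by simp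
    qed
    have "hh \<theta> ^ n k * exp (- ?E k \<theta>) = of_real (rp ^ n k) * phase (\<lambda>j. int (mu k j)) \<theta>"
      unfolding ph hp rpp mult_exp_exp by (simp add: algebra_simps)
    then have "X_coeff s (n k) (rot \<rho> \<theta>) * of_real (real (n k) powr (1 - s)) * (hh \<theta> ^ n k * exp (- ?E k \<theta>)) =
      X_coeff s (n k) (rot \<rho> \<theta>) * of_real (real (n k) powr (1 - s)) * (of_real (rp ^ n k) * phase (\<lambda>j. int (mu k j)) \<theta>)" by simp
    then show ?thesis by (auto simp: mult_ac)
  qed
  have bound: "norm (g k x) \<le> W x" if gk: "N k > 0 \<and> n k > 0 \<and> real (n k) \<ge> ap / 2 * real (N k)" for k x
  proof (cases "norm ((1 / ?s k) *\<^sub>R x) < \<eta>")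
    case True
    define \<theta> where "\<theta> = (1 / ?s k) *\<^sub>R x"
    have \<theta>: "norm \<theta> < \<eta>" using True by (simp add: \<theta>_def)
    have g: "g k x = ?f k \<theta> * of_real (?c k)" using \<theta> by (simp add: g_def \<theta>_def[symmetric])
    have nt: "real (N k) * (norm \<theta>)\<^sup>2 = (norm x)\<^sup>2" using gk by (simp add: \<theta>_def power_divide)
    have "ap / 2 * (norm x)\<^sup>2 = (ap / 2 * real (N k)) * (norm \<theta>)\<^sup>2" by (simp add: nt[symmetric] mult_ac)
    also have "\<dots> \<le> real (n k) * (norm \<theta>)\<^sup>2" using gk by (intro mult_right_mono) auto
    finally have "\<kappa> * (ap / 2 * (norm x)\<^sup>2) \<le> \<kappa> * (real (n k) * (norm \<theta>)\<^sup>2)" using \<kappa> by (intro mult_left_mono) auto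
    also have "\<dots> = real (n k) * (\<kappa> * (norm \<theta>)\<^sup>2)" by simp
    also have "\<dots> \<le> real (n k) * (Re (Ln (hh \<theta>)) - ln rp)" using hhl[OF \<theta>] by (intro mult_left_mono) auto
    also have "\<dots> = Re (?E k \<theta>)" by simp
    finally have "cmod (exp (- ?E k \<theta>)) \<le> exp (- (\<kappa> * (ap / 2)) * (norm x)\<^sup>2)" by (simp add: mult.assoc del: Re_Ln)
    moreover have "cmod (X_coeff s (n k) (rot \<rho> \<theta>) * hh \<theta> ^ n k * of_real (real (n k) powr (1 - s))) \<le> C"
      using Xb[OF \<theta>, of "n k"] gk by (simp add: norm_mult)
    ultimately show ?thesis unfolding g factor[OF \<theta>] W_def norm_mult[of _ "exp _"] using C by (intro mult_mono) auto
  next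
    case False
    then show ?thesis using C by (simp add: g_def W_def)
  qed
  have Wi: "integrable lborel W"
    unfolding W_def using \<kappa> ap by (intro integrable_mult_right integrable_exp_neg_norm_sq) simp
  let ?L = "complex_of_real (exp (s * rp) * rp powr (- s) / Gamma s)"
  have pointwise: "(\<lambda>k. g k x) \<longlonglongrightarrow> ?L * of_real (exp (- quad x / 2))" for x
  proof -
    define \<theta> where "\<theta> = (\<lambda>k. (1 / ?s k) *\<^sub>R x)"
    \<comment> \<open>The limit in \<open>near_expansion\<close> asks for small norm at every index;
      the finitely many exceptions are replaced by 0.\<close>
    define \<theta>' where "\<theta>' = (\<lambda>k. if norm (\<theta> k) < \<eta> then \<theta> k else 0)"
    have \<theta>0: "\<theta> \<longlonglongrightarrow> 0" unfolding \<theta>_def using tendsto_scaleR[OF inv tendsto_const[of x]] by simp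
    have ev: "eventually (\<lambda>k. norm (\<theta> k) < \<eta>) sequentially"
      using tendsto_norm[OF \<theta>0] \<eta>(1) by (intro order_tendstoD(2)[of _ "norm (0::real^'m)"]) auto
    have "eventually (\<lambda>k. \<theta> k = \<theta>' k) sequentially" using ev by eventually_elim (simp add: \<theta>'_def)
    then have "\<theta>' \<longlonglongrightarrow> 0" using \<theta>0 tendsto_cong by metis
    from Xl[OF this _ nlim] have A: "(\<lambda>k. X_coeff s (n k) (rot \<rho> (\<theta>' k)) * hh (\<theta>' k) ^ n k * of_real (real (n k) powr (1 - s))) \<longlonglongrightarrow> ?L"
      using \<eta>(1) by (simp add: \<theta>'_def)
    have "(\<lambda>k. ?E k (\<theta> k)) \<longlonglongrightarrow> of_real (quad x / 2)"
      unfolding \<theta>_def by (rule phase_exponent_limit[OF N n mu \<delta>])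
    from tendsto_exp[OF tendsto_minus[OF this]] have E: "(\<lambda>k. exp (- ?E k (\<theta> k))) \<longlonglongrightarrow> of_real (exp (- quad x / 2))"
      by (simp add: exp_of_real[symmetric])
    have "(\<lambda>k. (X_coeff s (n k) (rot \<rho> (\<theta>' k)) * hh (\<theta>' k) ^ n k * of_real (real (n k) powr (1 - s))) * exp (- ?E k (\<theta> k)))
      \<longlonglongrightarrow> ?L * of_real (exp (- quad x / 2))" by (rule tendsto_mult[OF A E])
    moreover have "eventually (\<lambda>k. (X_coeff s (n k) (rot \<rho> (\<theta>' k)) * hh (\<theta>' k) ^ n k * of_real (real (n k) powr (1 - s))) * exp (- ?E k (\<theta> k)) = g k x) sequentially"
      using ev
    proof eventually_elim
      case (elim k)
      have "g k x = ?f k (\<theta> k) * of_real (?c k)" using elim by (simp add: g_def \<theta>_def)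
      then show ?case unfolding factor[OF elim] using elim by (simp add: \<theta>'_def)
    qed
    ultimately show ?thesis by (rule Lim_transform_eventually)
  qed
  \<comment> \<open>The integrand is set to 0 at the finitely many indices where \<open>good\<close>
    fails, so that W dominates the entire sequence.\<close>
  have dom: "(\<lambda>k. \<integral>x. (if N k > 0 \<and> n k > 0 \<and> real (n k) \<ge> ap / 2 * real (N k) then g k x else 0) \<partial>lborel) \<longlonglongrightarrow>
      (\<integral>x. ?L * of_real (exp (- quad x / 2)) \<partial>lborel)"
  proof (rule integral_dominated_convergence[where w = W])
    show "(\<lambda>x. ?L * of_real (exp (- quad x / 2))) \<in> borel_measurable lborel"
      using borel_measurable_continuous_onI[OF continuous_on_quad[of UNIV]] by simp
    show "(\<lambda>x. if N k > 0 \<and> n k > 0 \<and> real (n k) \<ge> ap / 2 * real (N k) then g k x else 0) \<in> borel_measurable lborel" for k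
      using gm[of k] by (cases "N k > 0 \<and> n k > 0 \<and> real (n k) \<ge> ap / 2 * real (N k)") auto
    show "AE x in lborel. (\<lambda>k. if N k > 0 \<and> n k > 0 \<and> real (n k) \<ge> ap / 2 * real (N k) then g k x else 0) \<longlonglongrightarrow> ?L * of_real (exp (- quad x / 2))"
    proof (rule AE_I2)
      fix x
      show "(\<lambda>k. if N k > 0 \<and> n k > 0 \<and> real (n k) \<ge> ap / 2 * real (N k) then g k x else 0) \<longlonglongrightarrow> ?L * of_real (exp (- quad x / 2))"
        by (rule Lim_transform_eventually[OF pointwise]) (use good in eventually_elim, simp)
    qed
    show "AE x in lborel. norm (if N k > 0 \<and> n k > 0 \<and> real (n k) \<ge> ap / 2 * real (N k) then g k x else 0) \<le> W x" for k
    proof (rule AE_I2)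
      fix x
      have "0 \<le> W x" using C by (simp add: W_def)
      then show "norm (if N k > 0 \<and> n k > 0 \<and> real (n k) \<ge> ap / 2 * real (N k) then g k x else 0) \<le> W x"
        using bound[of k x] by auto
    qed
  qed (rule Wi)
  have Lval: "(\<integral>x. ?L * of_real (exp (- quad x / 2)) \<partial>lborel) =
      of_real (exp (s * rp) * rp powr (- s) / Gamma s * (\<integral>x. exp (- quad x / 2) \<partial>lborel))"
    by (simp only: integral_mult_right_zero integral_complex_of_real of_real_mult)
  have near_lim: "(\<lambda>k. of_real (?s k ^ CARD('m) * ?c k) * (LINT \<theta>:ball 0 \<eta>|lborel. ?f k \<theta>)) \<longlonglongrightarrow>
      of_real (exp (s * rp) * rp powr (- s) / Gamma s * (\<integral>x. exp (- quad x / 2) \<partial>lborel))"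
  proof (rule Lim_transform_eventually[OF dom[unfolded Lval]])
    show "eventually (\<lambda>k. (\<integral>x. (if N k > 0 \<and> n k > 0 \<and> real (n k) \<ge> ap / 2 * real (N k) then g k x else 0) \<partial>lborel) =
       of_real (?s k ^ CARD('m) * ?c k) * (LINT \<theta>:ball 0 \<eta>|lborel. ?f k \<theta>)) sequentially"
      using good
    proof eventually_elim
      case (elim k)
      then show ?case by (subst near_int) simp_all
    qed
  qed
  have "(\<lambda>k. of_real (?s k ^ CARD('m) * ?c k) * (LINT \<theta>:ball 0 \<eta>|lborel. ?f k \<theta>) +
       of_real (?s k ^ CARD('m) * ?c k) * (LINT \<theta>:torus_box - ball 0 \<eta>|lborel. ?f k \<theta>)) \<longlonglongrightarrow>
      of_real (exp (s * rp) * rp powr (- s) / Gamma s * (\<integral>x. exp (- quad x / 2) \<partial>lborel)) + 0"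
    by (rule tendsto_add[OF near_lim far_lim])
  then show ?thesis unfolding split by (simp add: algebra_simps)
qed

end

section \<open>The asymptotic formula\<close>

context critical_point

begin

lemma h_fun_drop_last: "h_fun \<rho> = rp"
proof -
  have "real CARD('m) - (\<Sum>i\<in>UNIV. exp (- (\<rho> $ i))) = exp (- rp)"
    using r_zero by (simp add: UNIV_option_conv sum.reindex drop_last_def)
  then show ?thesis by (simp add: h_fun_def)
qed

lemma Phi_drop_last: "Phi \<alpha> \<rho> = - (\<Sum>i\<in>UNIV. \<alpha> $ i * ln (r $ i))"
  unfolding Phi_def h_fun_drop_last by (simp add: UNIV_option_conv sum.reindex drop_last_def)

lemma chromatic_poly_asymptotics:
  fixes N :: "nat \<Rightarrow> nat" and lam :: "nat \<Rightarrow> 'm option \<Rightarrow> nat" and \<delta> :: "nat \<Rightarrow> 'm option \<Rightarrow> real"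
  assumes s: "s > 0" and N: "filterlim N at_top sequentially"
    and lam: "\<And>k i. real (lam k i) = \<alpha> $ i * real (N k) + \<delta> k i"
    and size: "\<And>k. (\<Sum>i\<in>UNIV. lam k i) = N k"
    and \<delta>: "\<And>k i. \<bar>\<delta> k i\<bar> \<le> D"
  shows "(\<lambda>k. (-1) ^ N k *
             poly (chromatic_poly (multipartite_verts (lam k)) (multipartite_edges (lam k))) (- s))
         \<sim>[sequentially]
         (\<lambda>k. (\<Prod>i\<in>UNIV. fact (lam k i)) * (\<Prod>i\<in>UNIV. (r $ i) powr (- \<delta> k i)) *
             (real (lam k None) powr (s - 1) / Gamma s) *
             (exp (s * rp) / (rp powr s * (\<Prod>i\<in>UNIV. r $ Some i))) *
             (exp (real (N k) * Phi \<alpha> \<rho>) /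
               ((2 * pi * real (N k)) powr (real CARD('m) / 2) * sqrt (det H))))"
    (is "?A \<sim>[sequentially] ?Q")
proof -
  \<comment> \<open>A common normaliser: ?A k * w k tends to L by Laplace's method, and ?Q k * w k
    eventually equals L, so the quotient ?A / ?Q tends to 1.\<close>
  define w where "w = (\<lambda>k. sqrt (real (N k)) ^ CARD('m) * real (lam k None) powr (1 - s) *
     (rp ^ lam k None * (\<Prod>j\<in>UNIV. \<rho> $ j ^ lam k (Some j))) * (2 * pi) ^ CARD('m) / (\<Prod>i\<in>UNIV. fact (lam k i)))"
  define R where "R = (\<Prod>i\<in>UNIV. r $ Some i)"
  define S where "S = sqrt (det H)"
  define V where "V = (2 * pi) powr (real CARD('m) / 2)"
  define L where "L = exp (s * rp) * rp powr (- s) / Gamma s * (V / (R * S))"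
  have rp0: "rp \<noteq> 0" using r_pos[of None] by simp
  have pos: "R > 0" "S > 0" "V > 0" "Gamma s > 0" "rp > 0" "rp powr s > 0"
    using gaussian_quad(3) r_pos rp0 s by (auto simp: R_def S_def V_def intro!: prod_pos Gamma_real_pos)
  then have L: "L \<noteq> 0" by (simp add: L_def)
  have "(\<lambda>k. complex_of_real (?A k * w k)) \<longlonglongrightarrow> of_real L"
    using laplace[OF s N lam lam \<delta>]
    unfolding set_integral_X_coeff[OF s] gaussian_quad(2) size of_real_mult[symmetric]
    unfolding w_def L_def R_def S_def V_def
    by (simp add: mult_ac del: of_real_mult of_real_divide of_real_power of_real_prod)
  from tendsto_Re[OF this] have Aw: "(\<lambda>k. ?A k * w k) \<longlonglongrightarrow> L" by simp
  \<comment> \<open>Beyond N = D / ap the last part is nonempty, which is needed for its powers s -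
    1 and 1 - s to cancel.\<close>
  have ev: "eventually (\<lambda>k. ?Q k * w k = L) sequentially"
    using eventually_compose_filterlim[OF eventually_gt_at_top N, of "nat \<lceil>D / ap\<rceil>"]
  proof eventually_elim
    case (elim k)
    have D0: "D \<ge> 0" using \<delta>[of 0 None] by linarith
    have ap: "ap > 0" by (rule alpha_pos)
    have N0: "real (N k) > 0" using elim by linarith
    have "D / ap < real (N k)" using elim by linarith
    then have "ap * real (N k) > D" using ap by (simp add: field_simps)
    then have n0: "real (lam k None) > 0" using lam[of k None] \<delta>[of k None] by linarith
    have e1: "real (lam k None) powr (s - 1) * real (lam k None) powr (1 - s) = 1"
      using n0 by (simp add: powr_add[symmetric])
    \<comment> \<open>Fourier inversion contributes (2 pi)^(p-1) and the Gaussian integral its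
      square root V; one such square root remains in the denominator.\<close>
    have e2: "sqrt (real (N k)) ^ CARD('m) * (2 * pi) ^ CARD('m) = (2 * pi * real (N k)) powr (real CARD('m) / 2) * V"
    proof -
      have "sqrt (real (N k)) ^ CARD('m) = real (N k) powr (real CARD('m) / 2)"
        using N0 by (simp add: powr_half_sqrt[symmetric] powr_realpow[symmetric] powr_powr)
      moreover have "(2 * pi) ^ CARD('m) = V * V"
        by (simp add: V_def powr_add[symmetric] powr_realpow)
      ultimately show ?thesis using N0 by (simp add: powr_mult V_def)
    qed
    \<comment> \<open>For each i the exponents -\<delta>_i, -\<alpha>_i N and \<lambda>_i of r_i add
      up to 0.\<close>
    have e3: "(\<Prod>i\<in>UNIV. (r $ i) powr (- \<delta> k i)) * exp (real (N k) * Phi \<alpha> \<rho>) *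
       (rp ^ lam k None * (\<Prod>j\<in>UNIV. \<rho> $ j ^ lam k (Some j))) = 1"
    proof -
      have "rp ^ lam k None * (\<Prod>j\<in>UNIV. \<rho> $ j ^ lam k (Some j)) = (\<Prod>i\<in>UNIV. r $ i ^ lam k i)"
        by (simp add: UNIV_option_conv prod.reindex drop_last_def)
      moreover have "exp (real (N k) * Phi \<alpha> \<rho>) = (\<Prod>i\<in>UNIV. r $ i powr (- (\<alpha> $ i * real (N k))))"
        unfolding Phi_drop_last using r_pos
        by (simp add: powr_def exp_sum[symmetric] sum_distrib_left sum_negf mult_ac less_imp_neq[THEN not_sym])
      moreover have "r $ i powr (- \<delta> k i) * r $ i powr (- (\<alpha> $ i * real (N k))) * r $ i ^ lam k i = 1" for i
        using r_pos[of i] by (simp add: powr_realpow[symmetric] powr_add[symmetric] lam)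
      ultimately show ?thesis by (simp add: prod.distrib[symmetric])
    qed
    define E :: real where "E = (\<Prod>i\<in>UNIV. fact (lam k i))"
    define P where "P = (\<Prod>i\<in>UNIV. (r $ i) powr (- \<delta> k i))"
    define T where "T = (2 * pi * real (N k)) powr (real CARD('m) / 2)"
    define X where "X = exp (real (N k) * Phi \<alpha> \<rho>)"
    define Y where "Y = rp ^ lam k None * (\<Prod>j\<in>UNIV. \<rho> $ j ^ lam k (Some j))"
    define a where "a = real (lam k None) powr (s - 1)"
    define b where "b = real (lam k None) powr (1 - s)"
    define q where "q = sqrt (real (N k)) ^ CARD('m)"
    define W where "W = (2 * pi) ^ CARD('m)"
    have nz: "E \<noteq> 0" "T \<noteq> 0" using N0 by (auto simp: E_def T_def)
    have "?Q k * w k = (P * X * Y) * (a * b) * ((q * W) / T) * exp (s * rp) / (rp powr s * R * Gamma s * S)"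
      unfolding w_def E_def[symmetric] P_def[symmetric] T_def[symmetric] X_def[symmetric] Y_def[symmetric]
        a_def[symmetric] b_def[symmetric] q_def[symmetric] W_def[symmetric] R_def[symmetric] S_def[symmetric]
      using nz pos by (simp add: field_simps)
    also have "\<dots> = L"
      using e1 e2 e3 nz pos unfolding P_def[symmetric] T_def[symmetric] X_def[symmetric] Y_def[symmetric]
        a_def[symmetric] b_def[symmetric] q_def[symmetric] W_def[symmetric]
      by (simp add: L_def powr_minus field_simps)
    finally show ?case .
  qed
  show ?thesis
  proof (rule asymp_equivI')
    have "(\<lambda>k. (?A k * w k) / L) \<longlonglongrightarrow> 1" using tendsto_divide[OF Aw tendsto_const L] L by simp
    moreover have "eventually (\<lambda>k. (?A k * w k) / L = ?A k / ?Q k) sequentially"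
      using ev
    proof eventually_elim
      case (elim k)
      then have "w k \<noteq> 0" using L by auto
      then show ?case unfolding elim[symmetric] by simp
    qed
    ultimately show "(\<lambda>k. ?A k / ?Q k) \<longlonglongrightarrow> 1" by (rule Lim_transform_eventually)
  qed
qed

end

theorem theorem5:
  fixes s :: real
    and \<alpha> r :: "real ^ ('m::finite option)"
    and N :: "nat \<Rightarrow> nat"
    and lam :: "nat \<Rightarrow> 'm option \<Rightarrow> nat"
    and \<delta> :: "nat \<Rightarrow> 'm option \<Rightarrow> real"
  assumes s_pos: "s > 0"
    and alpha_pos: "\<And>i. \<alpha> $ i > 0"
    and alpha_sum: "(\<Sum>i\<in>UNIV. \<alpha> $ i) = 1"
    and N_lim: "filterlim N at_top sequentially"
    and parts: "\<And>k i. real (lam k i) = \<alpha> $ i * real (N k) + \<delta> k i"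
    and delta_bounded: "\<And>i. (\<lambda>k. \<delta> k i) \<in> O(\<lambda>_. 1)"
    and delta_sum: "\<And>k. (\<Sum>i\<in>UNIV. \<delta> k i) = 0"
    and r_pos: "\<And>i. r $ i > 0"
    and r_zero: "(\<Sum>i\<in>UNIV. exp (- (r $ i))) = real CARD('m)"
    and r_critical: "\<And>i j. \<alpha> $ i / (r $ i * exp (- (r $ i))) = \<alpha> $ j / (r $ j * exp (- (r $ j)))"
    and r_minimal: "strictly_minimal r"
    and nondegenerate: "det (hessian (Phi \<alpha>) (drop_last r)) \<noteq> 0"
  shows "positive_definite (hessian (Phi \<alpha>) (drop_last r)) \<and>
         ((\<lambda>k. (-1) ^ N k *
             poly (chromatic_poly (multipartite_verts (lam k)) (multipartite_edges (lam k))) (- s))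
         \<sim>[sequentially]
         (\<lambda>k. (\<Prod>i\<in>UNIV. fact (lam k i)) * (\<Prod>i\<in>UNIV. (r $ i) powr (- \<delta> k i)) *
             (real (lam k None) powr (s - 1) / Gamma s) *
             (exp (s * r $ None) / ((r $ None) powr s * (\<Prod>i\<in>UNIV. r $ Some i))) *
             (exp (real (N k) * Phi \<alpha> (drop_last r)) /
               ((2 * pi * real (N k)) powr (real CARD('m) / 2) *
                sqrt (det (hessian (Phi \<alpha>) (drop_last r))))))) \<and>
         (\<forall>k. connected_graph (multipartite_verts (lam k)) (multipartite_edges (lam k)) \<longrightarrow>
           (-1) ^ N k *
             poly (chromatic_poly (multipartite_verts (lam k)) (multipartite_edges (lam k))) (- s)
           = s * tutte (multipartite_verts (lam k)) (multipartite_edges (lam k)) (1 + s) 0)"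
proof -
  have cp: "critical_point \<alpha> r"
    by (rule critical_point.intro[OF alpha_pos r_pos r_zero r_critical r_minimal nondegenerate])
  have size: "(\<Sum>i\<in>UNIV. lam k i) = N k" for k
  proof -
    have "real (\<Sum>i\<in>UNIV. lam k i) = real (N k)"
      using alpha_sum delta_sum[of k] by (simp add: parts sum.distrib sum_distrib_right[symmetric])
    then show ?thesis by (simp only: of_nat_eq_iff)
  qed
  \<comment> \<open>The hypothesis bounds each \<delta>_i only eventually; an eventually bounded
    sequence is bounded, and the sum of the finitely many bounds serves all i at once.\<close>
  have "\<exists>K. \<forall>k. \<bar>\<delta> k i\<bar> \<le> K" for i
  proof -
    obtain c where "eventually (\<lambda>k. norm (\<delta> k i) \<le> c * norm (1::real)) sequentially"
      using delta_bounded[of i] by (rule landau_o.bigE)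
    then have "Bseq (\<lambda>k. \<delta> k i)" by (intro BfunI[of _ c]) simp
    then show ?thesis by (auto simp: Bseq_def)
  qed
  then obtain K where K: "\<And>i k. \<bar>\<delta> k i\<bar> \<le> K i" by metis
  have \<delta>: "\<bar>\<delta> k i\<bar> \<le> (\<Sum>i\<in>UNIV. K i)" for k i
    using member_le_sum[of i UNIV K] K[of k i] order_trans[OF abs_ge_zero K] by (force intro: order_trans)
  have "(-1) ^ N k * poly (chromatic_poly (multipartite_verts (lam k)) (multipartite_edges (lam k))) (- s)
      = s * tutte (multipartite_verts (lam k)) (multipartite_edges (lam k)) (1 + s) 0"
    if "connected_graph (multipartite_verts (lam k)) (multipartite_edges (lam k))" for k
    using chromatic_poly_tutte[OF simple_graph_multipartite that] by (simp add: card_multipartite_verts size)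
  then show ?thesis
    using critical_point.hessian_pd[OF cp] critical_point.chromatic_poly_asymptotics[OF cp s_pos N_lim parts size \<delta>]
    by blast
qed

end
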